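(* Let $k$ be an algebraically closed field of characteristic zero, let $1 \le r \le n$ and $m \ge 0$ be integers, and let $X=\operatorname{Spec} k[x_1,\ldots,x_n]/(x_1\cdots x_r)$. Let $R = k[x_i^{(j)} : 1\le i\le n,\ 0\le j\le m]$ and let $J_m(X)\subseteq R$ be the ideal generated by $g_0,\ldots,g_m$. Let $t_1,\ldots,t_r$ be integers with $0\le t_i\le m+1$ and $\sum_{i=1}^r t_i = m+1$, and let $P=P(m;t_1,\ldots,t_r)$. Then the multiplicity of $\mathcal{J}_m(X)$ along $P$, i.e. the length $\ell\big(R_P/J_m(X)R_P\big)$, equals $$\frac{(m+1)!}{t_1!\cdots t_r!}.$$
   Context: For $0\le k\le m$, $g_k$ denotes the coefficient of $t^k$ in the product $\prod_{i=1}^r (x_i^{(0)}+x_i^{(1)}t+\cdots+x_i^{(m)}t^m)$, i.e. $g_k=\sum x_1^{(i_1)}x_2^{(i_2)}\cdots x_r^{(i_r)}$, the sum over all tuples $(i_1,\ldots,i_r)$ of nonnegative integers with $\sum_j i_j = k$. The ideal $J_m(X)=(g_0,\ldots,g_m)$ defines the $m$-th jet scheme $\mathcal{J}_m(X)$ of $X$ inside $\mathcal{J}_m(\mathbb{A}^n)=\operatorname{Spec} R$. For nonnegative integers $t_1,\ldots,t_r$, $P(m;t_1,\ldots,t_r)$ is the prime ideal $(x_1^{(0)},\ldots,x_1^{(t_1-1)},\ldots,x_r^{(0)},\ldots,x_r^{(t_r-1)})$, where $t_i=0$ means no variable $x_i^{(j)}$ appears. (Such ideals with $\sum t_i=m+1$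 are exactly the minimal primes of $J_m(X)$.) $\ell$ denotes length of a module over the local ring $R_P$. *)

theory Defs
  imports "HOL-Library.Poly_Mapping" "HOL-Library.FuncSet" "HOL-Library.Extended_Nat"
    "HOL-Algebra.QuotRing" "HOL-Computational_Algebra.Polynomial"
begin

definition alg_closed :: "'k::field itself \<Rightarrow> bool" where
  "alg_closed _ \<longleftrightarrow> (\<forall>p :: 'k poly. degree p > 0 \<longrightarrow> (\<exists>x. poly p x = 0))"

text \<open>Polynomials over k in variables indexed by pairs (i,j) (standing for x_i^(j)),
  as finitely supported maps from monomials (finitely supported exponent vectors)
  to coefficients.\<close>

type_synonym 'k mpoly = "((nat \<times> nat) \<Rightarrow>\<^sub>0 nat) \<Rightarrow>\<^sub>0 'k"

definition jet_vars :: "nat \<Rightarrow> nat \<Rightarrow> (nat \<times> nat) set" where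
  "jet_vars n m = {1..n} \<times> {0..m}"

definition jet_ring :: "nat \<Rightarrow> nat \<Rightarrow> ('k::field) mpoly ring" where
  "jet_ring n m = \<lparr> carrier = {p. \<forall>mon \<in> Poly_Mapping.keys p. Poly_Mapping.keys mon \<subseteq> jet_vars n m},
                    monoid.mult = (*), one = 1, zero = 0, add = (+) \<rparr>"

definition var :: "nat \<Rightarrow> nat \<Rightarrow> ('k::field) mpoly" where
  "var i j = Poly_Mapping.single (Poly_Mapping.single (i, j) 1) 1"

definition jet_gen :: "nat \<Rightarrow> nat \<Rightarrow> ('k::field) mpoly" where
  "jet_gen r k = (\<Sum>f \<in> {f \<in> {1..r} \<rightarrow>\<^sub>E {0..k}. (\<Sum>l=1..r. f l) = k}. \<Prod>l=1..r. var l (f l))"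

definition jet_ideal :: "nat \<Rightarrow> nat \<Rightarrow> nat \<Rightarrow> ('k::field) mpoly set" where
  "jet_ideal n m r = genideal (jet_ring n m) {jet_gen r k | k. k \<le> m}"

definition Pideal :: "nat \<Rightarrow> nat \<Rightarrow> nat \<Rightarrow> (nat \<Rightarrow> nat) \<Rightarrow> ('k::field) mpoly set" where
  "Pideal n m r t = genideal (jet_ring n m) {var i j | i j. 1 \<le> i \<and> i \<le> r \<and> j < t i}"

definition loc_rel :: "('a, 'b) ring_scheme \<Rightarrow> 'a set \<Rightarrow> (('a \<times> 'a) \<times> ('a \<times> 'a)) set" where
  "loc_rel R S = {((a, s), (b, u)). a \<in> carrier R \<and> s \<in> S \<and> b \<in> carrier R \<and> u \<in> S \<and>
                     (\<exists>v \<in> S. v \<otimes>\<^bsub>R\<^esub> ((a \<otimes>\<^bsub>R\<^esub> u) \<ominus>\<^bsub>R\<^esub> (b \<otimes>\<^bsub>R\<^esub> s)) = \<zero>\<^bsub>R\<^esub>)}"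

definition loc_cls :: "('a, 'b) ring_scheme \<Rightarrow> 'a set \<Rightarrow> 'a \<Rightarrow> 'a \<Rightarrow> ('a \<times> 'a) set" where
  "loc_cls R S a s = loc_rel R S `` {(a, s)}"

definition localization :: "('a, 'b) ring_scheme \<Rightarrow> 'a set \<Rightarrow> ('a \<times> 'a) set ring" where
  "localization R S = \<lparr> carrier = (carrier R \<times> S) // loc_rel R S,
     monoid.mult = (\<lambda>A B. \<Union>(a, s) \<in> A. \<Union>(b, u) \<in> B. loc_cls R S (a \<otimes>\<^bsub>R\<^esub> b) (s \<otimes>\<^bsub>R\<^esub> u)),
     one = loc_cls R S \<one>\<^bsub>R\<^esub> \<one>\<^bsub>R\<^esub>,
     zero = loc_cls R S \<zero>\<^bsub>R\<^esub> \<one>\<^bsub>R\<^esub>,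
     add = (\<lambda>A B. \<Union>(a, s) \<in> A. \<Union>(b, u) \<in> B.
              loc_cls R S ((a \<otimes>\<^bsub>R\<^esub> u) \<oplus>\<^bsub>R\<^esub> (b \<otimes>\<^bsub>R\<^esub> s)) (s \<otimes>\<^bsub>R\<^esub> u)) \<rparr>"

definition loc_at :: "('a, 'b) ring_scheme \<Rightarrow> 'a set \<Rightarrow> ('a \<times> 'a) set ring" where
  "loc_at R P = localization R (carrier R - P)"

definition ext_ideal :: "('a, 'b) ring_scheme \<Rightarrow> 'a set \<Rightarrow> 'a set \<Rightarrow> ('a \<times> 'a) set set" where
  "ext_ideal R P I = genideal (loc_at R P) ((\<lambda>a. loc_cls R (carrier R - P) a \<one>\<^bsub>R\<^esub>) ` I)"

text \<open>Length of a ring A as a module over itself: the supremum of the lengths n of strictly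
  increasing chains I_0 \<subset> I_1 \<subset> ... \<subset> I_n of ideals of A. For A = R_P / J R_P
  the ideals of A are exactly the R_P-submodules of R_P / J R_P, so this is
  \<ell>_{R_P}(R_P / J R_P).\<close>

definition ring_length :: "('a, 'b) ring_scheme \<Rightarrow> enat" where
  "ring_length A = Sup {enat n | n. \<exists>I :: nat \<Rightarrow> 'a set.
      (\<forall>i \<le> n. ideal (I i) A) \<and> (\<forall>i < n. I i \<subset> I (Suc i))}"

definition multiplicity_along :: "('a, 'b) ring_scheme \<Rightarrow> 'a set \<Rightarrow> 'a set \<Rightarrow> enat" where
  "multiplicity_along R J P = ring_length (loc_at R P Quot ext_ideal R P J)"

end

theory Submission
  imports Defs "HOL-Combinatorics.Multiset_Permutations"
begin

text \<open>
  Upper bound. Write \<open>f\<^sub>i = \<Sum> x\<^sub>i\<^sup>(\<^sup>j\<^sup>) T^j\<close>. For \<open>s \<le> t\<close> let \<open>Q(s)\<close> be generated by \<open>J\<close> and the variables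
  \<open>x\<^sub>i\<^sup>(\<^sup>j\<^sup>)\<close> with \<open>j < s\<^sub>i\<close>. Modulo \<open>Q(s)\<close> every \<open>f\<^sub>i\<close> is divisible by \<open>T^s\<^sub>i\<close>, so the generator of \<open>J\<close> of
  index \<open>\<Sum> s\<^sub>i\<close> says that the product of the elements \<open>x\<^sub>i\<^sup>(\<^sup>s\<^sub>i\<^sup>)\<close> vanishes. Those with \<open>s\<^sub>i = t\<^sub>i\<close> are units at
  \<open>P\<close>, and killing one of the others leads to \<open>Q(s + e\<^sub>i)\<close>. Hence the length of \<open>R\<^sub>P / Q(s)\<close> is at most the sum of
  the lengths of the \<open>R\<^sub>P / Q(s + e\<^sub>i)\<close>, which is the recursion of the multinomial coefficients; it produces
  an explicit filtration of \<open>R\<^sub>P / J\<close> indexed by lattice paths from \<open>0\<close> to \<open>t\<close>.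

  Lower bound. If a step of this filtration were not strict, substituting for \<open>f\<^sub>i\<close> a generic
  invertible power series over \<open>k\<close> times the generic monic polynomial \<open>w\<^sub>i\<close> of degree \<open>t\<^sub>i\<close> (as in Weierstrass
  preparation) would show that the algebra of factorizations \<open>\<Prod> w\<^sub>i = T^(m+1)\<close> has dimension smaller than
  the multinomial coefficient. But this algebra is graded, and deforming \<open>T^(m+1)\<close> to a product of distinct
  linear factors cannot increase the dimension and yields a scheme with that many points.
\<close>

text \<open>The obstacle in the lower bound is that strictness must be tested after inverting all of
  \<open>S\<close>. A failing step, however, is witnessed by a single multiplier q outside P, and q
  is nonzero at some point of the linear subspace cut out by P because k is infinite. Substituting
  at this point gives q a nonzero constant term; as the low order variables annihilate every step,
  only this constant acts, and localization is traded for linear algebra over k. The generic monic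
  factors reuse the low order variables as coefficients, so the same list of lattice path products
  filters both rings, position by position. One redundant position would leave a spanning set with
  fewer elements than there are words with t_i letters i, that is, points of the deformed scheme
  with roots 0, ..., m. To avoid computing with classes of fractions, ideals of the localized
  quotient are treated as ideals of R that contain J and are closed under cancelling elements of
  \<open>S\<close>.\<close>

definition subring_set :: "'a::comm_ring_1 set \<Rightarrow> bool" where
  "subring_set A \<longleftrightarrow> 0 \<in> A \<and> 1 \<in> A \<and> (\<forall>x\<in>A. - x \<in> A) \<and>
     (\<forall>x\<in>A. \<forall>y\<in>A. x + y \<in> A \<and> x * y \<in> A)"

lemma subring_setD:
  assumes "subring_set A"
  shows "0 \<in> A" "1 \<in> A" "x \<in> A \<Longrightarrow> - x \<in> A" "x \<in> A \<Longrightarrow> y \<in> A \<Longrightarrow> x + y \<in> A"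
    "x \<in> A \<Longrightarrow> y \<in> A \<Longrightarrow> x * y \<in> A" "x \<in> A \<Longrightarrow> y \<in> A \<Longrightarrow> x - y \<in> A"
proof -
  show "x \<in> A \<Longrightarrow> y \<in> A \<Longrightarrow> x - y \<in> A"
    using assms unfolding subring_set_def by (metis add_uminus_conv_diff)
qed (use assms in \<open>auto simp: subring_set_def\<close>)

lemma subring_set_sum:
  assumes "subring_set A" "\<And>i. i \<in> I \<Longrightarrow> f i \<in> A"
  shows "sum f I \<in> A"
  using assms(2) by (induction I rule: infinite_finite_induct) (auto intro: subring_setD[OF assms(1)])

lemma subring_set_prod:
  assumes "subring_set A" "\<And>i. i \<in> I \<Longrightarrow> f i \<in> A"
  shows "prod f I \<in> A"
  using assms(2) by (induction I rule: infinite_finite_induct) (auto intro: subring_setD[OF assms(1)])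

lemma subring_set_power:
  assumes "subring_set A" "x \<in> A"
  shows "x ^ n \<in> A"
  using assms(2) by (induction n) (auto intro: subring_setD[OF assms(1)])

section \<open>Ideals generated inside a subring\<close>

text \<open>Combinations grow by one generator at a time, so that statements about generators extend
  by rule induction. For a subring \<open>A\<close> this is the \<open>A\<close>-submodule generated
  by \<open>G\<close>, an ideal of \<open>A\<close> once \<open>G\<close> lies in
  \<open>A\<close>.\<close>

inductive_set idl :: "'a::comm_ring_1 set \<Rightarrow> 'a set \<Rightarrow> 'a set" for A G where
  zero: "0 \<in> idl A G"
| step: "x \<in> idl A G \<Longrightarrow> c \<in> A \<Longrightarrow> g \<in> G \<Longrightarrow> x + c * g \<in> idl A G"

lemma idl_add:
  assumes "x \<in> idl A G" "y \<in> idl A G" shows "x + y \<in> idl A G"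
  using assms(2,1) by induction (auto simp: add.assoc[symmetric] intro: idl.step)

lemma idl_mult:
  assumes "subring_set A" "x \<in> idl A G" "c \<in> A" shows "c * x \<in> idl A G"
  using assms(2)
proof induction
  case (step x d g)
  have "c * x + (c * d) * g \<in> idl A G"
    using step assms by (intro idl.step) (auto intro: subring_setD)
  then show ?case by (simp add: algebra_simps)
qed (simp add: idl.zero)

lemma idl_gen_mult: "c \<in> A \<Longrightarrow> g \<in> G \<Longrightarrow> c * g \<in> idl A G"
  using idl.step[OF idl.zero, of c A g G] by simp

lemma idl_gen: "subring_set A \<Longrightarrow> g \<in> G \<Longrightarrow> g \<in> idl A G"
  using idl_gen_mult[of 1 A g G] by (simp add: subring_setD)

lemma idl_uminus: "subring_set A \<Longrightarrow> x \<in> idl A G \<Longrightarrow> - x \<in> idl A G"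
  using idl_mult[of A x G "- 1"] by (simp add: subring_setD)

lemma idl_diff: "subring_set A \<Longrightarrow> x \<in> idl A G \<Longrightarrow> y \<in> idl A G \<Longrightarrow> x - y \<in> idl A G"
  using idl_add[of x A G "- y"] idl_uminus[of A y G] by simp

lemma idl_carrier:
  assumes "subring_set A" "G \<subseteq> A" shows "idl A G \<subseteq> A"
proof
  fix x assume "x \<in> idl A G" then show "x \<in> A"
    using assms(2) by induction (auto intro!: subring_setD[OF assms(1)])
qed

text \<open>The multiplier \<open>q\<close> is present because most containments below hold only up to an element
  that becomes a unit after localization.\<close>

lemma idl_transport:
  assumes "subring_set A" "x \<in> idl A G" "\<And>g. g \<in> G \<Longrightarrow> q * g \<in> idl A H"
  shows "q * x \<in> idl A H"
  using assms(2)
proof induction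
  case (step x c g)
  have "q * x + c * (q * g) \<in> idl A H"
    by (rule idl_add[OF step.IH idl_mult[OF assms(1) assms(3)[OF step.hyps(3)] step.hyps(2)]])
  then show ?case by (simp add: algebra_simps)
qed (simp add: idl.zero)

lemma idl_subset:
  assumes "subring_set A" "x \<in> idl A G" "\<And>g. g \<in> G \<Longrightarrow> g \<in> idl A H"
  shows "x \<in> idl A H"
  using idl_transport[of A x G 1 H] assms by simp

lemma idl_mono: "subring_set A \<Longrightarrow> x \<in> idl A G \<Longrightarrow> G \<subseteq> H \<Longrightarrow> x \<in> idl A H"
  by (erule idl_subset[rotated]) (blast intro: idl_gen)+

lemma idl_mult_Un:
  assumes "subring_set A" "q \<in> A" "\<And>g. g \<in> G \<Longrightarrow> q * g \<in> idl A H" "g \<in> G \<union> B" "H \<union> B \<subseteq> K"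
  shows "q * g \<in> idl A K"
proof (cases "g \<in> G")
  case True
  show ?thesis by (rule idl_mono[OF assms(1) assms(3)[OF True]]) (use assms(5) in auto)
next
  case False
  then show ?thesis using assms(2,4,5) by (intro idl_gen_mult) auto
qed

lemma idl_insertD:
  assumes "subring_set A" "x \<in> idl A (insert b G)"
  shows "\<exists>c\<in>A. \<exists>y\<in>idl A G. x = y + c * b"
  using assms(2)
proof induction
  case zero
  show ?case using assms(1) by (intro bexI[of _ 0]) (auto intro: subring_setD idl.zero)
next
  case (step x d g)
  then obtain c y where cy: "c \<in> A" "y \<in> idl A G" "x = y + c * b" by auto
  show ?case
  proof (cases "g = b")
    case True
    then show ?thesis using cy step(2) assms(1)
      by (intro bexI[of _ "c + d"] bexI[of _ y]) (auto intro: subring_setD simp: algebra_simps)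
  next
    case False
    then have "g \<in> G" using step by auto
    then show ?thesis using cy step(2)
      by (intro bexI[of _ c] bexI[of _ "y + d * g"]) (auto intro: idl.step simp: algebra_simps)
  qed
qed

lemma idl_hom:
  assumes "x \<in> idl A G" "\<And>u v. \<phi> (u + v) = \<phi> u + \<phi> v" "\<And>u v. \<phi> (u * v) = \<phi> u * \<phi> v" "\<phi> 0 = 0"
    and "\<And>c. c \<in> A \<Longrightarrow> \<phi> c \<in> B" "\<And>g. g \<in> G \<Longrightarrow> \<phi> g \<in> idl B H" "subring_set B"
  shows "\<phi> x \<in> idl B H"
  using assms(1) by induction (auto simp: assms idl.zero intro!: idl_add idl_mult)

section \<open>Filtrations with one-dimensional quotients\<close>

text \<open>With \<open>L\<^sub>i\<close> the ideal generated by \<open>G\<close> and the entries of \<open>bs\<close> from position \<open>i\<close> on,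
  the predicate says that, after inverting \<open>S\<close>, the chain \<open>L\<^sub>0 \<supseteq> L\<^sub>1 \<supseteq> \<dots>\<close> starts at the whole ring
  and every quotient \<open>L\<^sub>i / L\<^sub>i\<^sub>+\<^sub>1\<close> is generated by one element annihilated by \<open>P\<close>.\<close>

fun filt_steps :: "'a::comm_ring_1 set \<Rightarrow> 'a set \<Rightarrow> 'a set \<Rightarrow> 'a set \<Rightarrow> 'a list \<Rightarrow> bool" where
  "filt_steps A S P G [] \<longleftrightarrow> True"
| "filt_steps A S P G (b # bs) \<longleftrightarrow>
     (\<forall>p\<in>P. \<exists>q\<in>S. q * (p * b) \<in> idl A (G \<union> set bs)) \<and> filt_steps A S P G bs"

definition filtration :: "'a::comm_ring_1 set \<Rightarrow> 'a set \<Rightarrow> 'a set \<Rightarrow> 'a set \<Rightarrow> 'a list \<Rightarrow> bool" where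
  "filtration A S P G bs \<longleftrightarrow> (\<exists>q\<in>S. q \<in> idl A (G \<union> set bs)) \<and> filt_steps A S P G bs"

locale mult_subset =
  fixes A S :: "'a::comm_ring_1 set"
  assumes subring: "subring_set A" and S_sub: "S \<subseteq> A" and S_one: "1 \<in> S"
    and S_mult: "x \<in> S \<Longrightarrow> y \<in> S \<Longrightarrow> x * y \<in> S"
begin

lemmas A_closed = subring_setD[OF subring]

lemma S_A: "q \<in> S \<Longrightarrow> q \<in> A" using S_sub by auto

text \<open>Passing from \<open>G\<close> to \<open>H\<close> enlarges all ideals of the chain after
  localization, so \<open>P\<close> still annihilates the quotients. The factor \<open>q0\<close> is
  there because the relations yield the wanted products only up to units.\<close>

lemma filt_steps_mono:
  assumes "filt_steps A S P G bs" "q0 \<in> S" "\<And>g. g \<in> G \<Longrightarrow> q0 * g \<in> idl A H"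
  shows "filt_steps A S P H bs"
  using assms(1)
proof (induction bs)
  case (Cons b bs)
  have "\<exists>q\<in>S. q * (p * b) \<in> idl A (H \<union> set bs)" if p: "p \<in> P" for p
  proof -
    obtain q where q: "q \<in> S" "q * (p * b) \<in> idl A (G \<union> set bs)" using Cons p by auto
    have "q0 * (q * (p * b)) \<in> idl A (H \<union> set bs)"
      using subring q(2)
      by (rule idl_transport) (rule idl_mult_Un[OF subring S_A[OF assms(2)] assms(3)], auto)
    then show ?thesis using q assms(2)
      by (intro bexI[of _ "q0 * q"]) (auto simp: mult.assoc intro: S_mult)
  qed
  then show ?case using Cons by auto
qed auto

lemma filtration_mono:
  assumes "filtration A S P G bs" "q0 \<in> S" "\<And>g. g \<in> G \<Longrightarrow> q0 * g \<in> idl A H"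
  shows "filtration A S P H bs"
proof -
  obtain q where q: "q \<in> S" "q \<in> idl A (G \<union> set bs)" using assms(1) by (auto simp: filtration_def)
  have "q0 * q \<in> idl A (H \<union> set bs)"
    using subring q(2)
    by (rule idl_transport) (rule idl_mult_Un[OF subring S_A[OF assms(2)] assms(3)], auto)
  then show ?thesis using assms q filt_steps_mono[of P G bs q0 H]
    by (auto simp: filtration_def intro!: bexI[of _ "q0 * q"] S_mult)
qed

text \<open>Multiplication by \<open>v\<close> sends \<open>u\<close> to \<open>v * u\<close> and
  \<open>G\<close> into its own ideal, so it carries the conditions modulo \<open>u\<close> and
  \<open>G\<close> to conditions on the multiples of \<open>v\<close>.\<close>

lemma filt_steps_mult:
  assumes "filt_steps A S P (insert u G) cs" "v \<in> A"
  shows "filt_steps A S P (insert (v * u) G) (map ((*) v) cs)"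
  using assms(1)
proof (induction cs)
  case (Cons b bs)
  have "\<exists>q\<in>S. q * (p * (v * b)) \<in> idl A (insert (v * u) G \<union> set (map ((*) v) bs))" if p: "p \<in> P" for p
  proof -
    obtain q where q: "q \<in> S" "q * (p * b) \<in> idl A (insert u G \<union> set bs)" using Cons p by auto
    have "v * (q * (p * b)) \<in> idl A (insert (v * u) G \<union> set (map ((*) v) bs))"
      using subring q(2)
      by (rule idl_transport) (auto intro: idl_gen[OF subring] idl_gen_mult[OF assms(2)])
    then show ?thesis using q
      by (intro bexI[of _ q]) (auto simp: algebra_simps)
  qed
  then show ?case using Cons by auto
qed auto

text \<open>The chain for \<open>bs\<close> is known modulo \<open>v\<close>, and \<open>v\<close>
  lies, up to \<open>q0\<close>, in the ideal where the chain for \<open>cs\<close> starts; so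
  \<open>v\<close> may be replaced by the entries of \<open>cs\<close>.\<close>

lemma filt_steps_append:
  assumes "filt_steps A S P (insert v G) bs" "filt_steps A S P H cs"
    and "q0 \<in> S" "q0 * v \<in> idl A (H \<union> set cs)" "G \<subseteq> H"
  shows "filt_steps A S P H (bs @ cs)"
  using assms(1)
proof (induction bs)
  case (Cons b bs)
  have "\<exists>q\<in>S. q * (p * b) \<in> idl A (H \<union> set (bs @ cs))" if p: "p \<in> P" for p
  proof -
    obtain q where q: "q \<in> S" "q * (p * b) \<in> idl A (insert v G \<union> set bs)" using Cons p by auto
    have "q0 * (q * (p * b)) \<in> idl A (H \<union> set (bs @ cs))"
      using subring q(2)
    proof (rule idl_transport)
      fix g assume "g \<in> insert v G \<union> set bs"
      then show "q0 * g \<in> idl A (H \<union> set (bs @ cs))"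
        using assms(5) S_A[OF assms(3)] idl_mono[OF subring assms(4), of "H \<union> set (bs @ cs)"]
        by (cases "g = v") (auto intro: idl_gen_mult)
    qed
    then show ?thesis using q assms(3)
      by (intro bexI[of _ "q0 * q"]) (auto simp: mult.assoc intro: S_mult)
  qed
  then show ?case using Cons by auto
qed (use assms in auto)

text \<open>For ideals this is the exact sequence
  \<open>(v) / (v u) \<rightarrow> A / (v u) \<rightarrow> A / (v)\<close>, whose first term is a quotient of \<open>A / (u)\<close>.\<close>

lemma filtration_join:
  assumes v: "filtration A S P (insert v G) bs" and u: "filtration A S P (insert u G) cs"
    and "v \<in> A"
  shows "filtration A S P (insert (v * u) G) (bs @ map ((*) v) cs)"
proof -
  let ?H = "insert (v * u) G"
  obtain q0 where q0: "q0 \<in> S" "q0 \<in> idl A (insert u G \<union> set cs)" using u by (auto simp: filtration_def)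
  obtain q1 where q1: "q1 \<in> S" "q1 \<in> idl A (insert v G \<union> set bs)" using v by (auto simp: filtration_def)
  \<comment> \<open>Modulo \<open>u\<close> and \<open>G\<close> the entries of \<open>cs\<close>
    generate the unit ideal; after multiplication by \<open>v\<close> this says that
    \<open>v\<close> belongs to the lower part of the list.\<close>
  have vq: "v * q0 \<in> idl A (?H \<union> set (map ((*) v) cs))"
    using subring q0(2)
    by (rule idl_transport) (auto intro: idl_gen[OF subring] idl_gen_mult[OF assms(3)])
  have steps: "filt_steps A S P ?H (bs @ map ((*) v) cs)"
  proof (rule filt_steps_append)
    show "filt_steps A S P (insert v G) bs" using v by (simp add: filtration_def)
    show "filt_steps A S P ?H (map ((*) v) cs)"
      using u assms(3) by (intro filt_steps_mult) (simp_all add: filtration_def)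
    show "q0 * v \<in> idl A (?H \<union> set (map ((*) v) cs))" using vq by (simp add: mult.commute)
  qed (use q0 in auto)
  have "q0 * q1 \<in> idl A (?H \<union> set (bs @ map ((*) v) cs))"
    using subring q1(2)
  proof (rule idl_transport)
    fix g assume "g \<in> insert v G \<union> set bs"
    then show "q0 * g \<in> idl A (?H \<union> set (bs @ map ((*) v) cs))"
    proof (cases "g = v")
      case True
      have "v * q0 \<in> idl A (?H \<union> set (bs @ map ((*) v) cs))"
        by (rule idl_mono[OF subring vq]) auto
      then show ?thesis using True by (simp add: mult.commute)
    next
      case False
      then show ?thesis using S_A[OF q0(1)] \<open>g \<in> insert v G \<union> set bs\<close>
        by (intro idl_gen_mult) auto
    qed
  qed
  then show ?thesis using steps q0 q1 S_mult by (auto simp: filtration_def)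
qed

lemma filtration_unit: "q \<in> S \<Longrightarrow> q \<in> idl A G \<Longrightarrow> filtration A S P G []"
  by (auto simp: filtration_def)

end

section \<open>Generators indexed by lattice paths\<close>

text \<open>Generators modulo a product, assembled from generators modulo each factor by splitting
  off the first factor. The empty product is 1, modulo which nothing is left, hence the empty
  list.\<close>

fun join_gens :: "('a::comm_ring_1 \<times> 'a list) list \<Rightarrow> 'a list" where
  "join_gens [] = []"
| "join_gens ((v, bs) # vs) = bs @ map ((*) v) (join_gens vs)"

context mult_subset begin

lemma filtration_join_gens:
  assumes "\<forall>(v, bs) \<in> set vs. v \<in> A \<and> filtration A S P (insert v G) bs"
  shows "filtration A S P (insert (prod_list (map fst vs)) G) (join_gens vs)"
  using assms
proof (induction vs)
  case Nil
  then show ?case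
    by (auto intro!: filtration_unit[OF S_one] idl_gen subring)
next
  case (Cons vb vs)
  then show ?case by (cases vb) (auto intro!: filtration_join)
qed

end

text \<open>\<open>filt_gens r t d s X\<close> lists the generators obtained from the lattice paths from \<open>s\<close> to \<open>t\<close>,
  where \<open>d\<close> is the number of remaining steps and a step in direction \<open>i\<close> kills \<open>X i (s i)\<close>.\<close>

fun filt_gens :: "nat \<Rightarrow> (nat \<Rightarrow> nat) \<Rightarrow> nat \<Rightarrow> (nat \<Rightarrow> nat) \<Rightarrow> (nat \<Rightarrow> nat \<Rightarrow> 'a::comm_ring_1) \<Rightarrow> 'a list" where
  "filt_gens r t 0 s X = [1]"
| "filt_gens r t (Suc d) s X = join_gens (map (\<lambda>i. (X i (s i), filt_gens r t d (s(i := Suc (s i))) X))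
       (filter (\<lambda>i. s i < t i) [1..<Suc r]))"

lemma map_join_gens:
  assumes "\<And>u v. \<phi> (u * v) = \<phi> u * \<phi> v"
  shows "map \<phi> (join_gens vs) = join_gens (map (\<lambda>(v, bs). (\<phi> v, map \<phi> bs)) vs)"
proof (induction vs rule: join_gens.induct)
  case (2 v bs vs)
  have "map \<phi> (map ((*) v) (join_gens vs)) = map ((*) (\<phi> v)) (map \<phi> (join_gens vs))"
    by (simp add: assms)
  then show ?case using 2 by (simp del: map_map)
qed auto

lemma length_join_gens: "length (join_gens vs) = sum_list (map (\<lambda>(v, bs). length bs) vs)"
  by (induction vs rule: join_gens.induct) auto

text \<open>The entries are products of the \<open>X i j\<close>, so multiplicativity suffices. This
  matches the list in the jet ring with the specialized list, position by position.\<close>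

lemma map_filt_gens:
  assumes "\<And>u v. \<phi> (u * v) = \<phi> u * \<phi> v" "\<phi> 1 = 1"
  shows "map \<phi> (filt_gens r t d s X) = filt_gens r t d s (\<lambda>i j. \<phi> (X i j))"
proof (induction d arbitrary: s)
  case (Suc d)
  show ?case unfolding filt_gens.simps map_join_gens[where \<phi> = \<phi>, OF assms(1)]
    by (rule arg_cong[where f = join_gens]) (simp add: Suc fun_upd_def)
qed (auto simp: assms)

lemma filt_gens_in:
  assumes "subring_set A" "\<And>i j. i \<in> {1..r} \<Longrightarrow> j < t i \<Longrightarrow> X i j \<in> A"
  shows "set (filt_gens r t d s X) \<subseteq> A"
proof (induction d arbitrary: s)
  case (Suc d)
  have "set (join_gens vs) \<subseteq> A" if "\<forall>(v, bs)\<in>set vs. v \<in> A \<and> set bs \<subseteq> A" for vs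
    using that by (induction vs rule: join_gens.induct) (auto intro: subring_setD[OF assms(1)])
  then show ?case using Suc assms(2) by simp
qed (use assms in \<open>auto intro: subring_setD\<close>)

text \<open>A step in direction i divides the product of factorials by \<open>t i - s i\<close>, and
  these differences add up to \<open>Suc d\<close>: the multinomial recursion, cleared of
  denominators.\<close>

lemma length_filt_gens:
  assumes "\<forall>i\<in>{1..r}. s i \<le> t i" "(\<Sum>i=1..r. t i - s i) = d"
  shows "length (filt_gens r t d s X) * (\<Prod>i=1..r. fact (t i - s i)) = fact d"
  using assms
proof (induction d arbitrary: s)
  case 0
  then show ?case by auto
next
  case (Suc d)
  let ?N = "\<lambda>i. length (filt_gens r t d (s(i := Suc (s i))) X)"
  let ?F = "\<lambda>s. (\<Prod>i=1..r. fact (t i - s i)) :: nat"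
  have F: "?N i * ?F s = fact d * (t i - s i)" if i: "i \<in> {1..r}" "s i < t i" for i
  proof -
    let ?s = "s(i := Suc (s i))"
    have "(\<Sum>i=1..r. t i - ?s i) = (t i - Suc (s i)) + (\<Sum>l\<in>{1..r} - {i}. t l - s l)"
      using i by (subst sum.remove[of _ i]) auto
    moreover have "(\<Sum>i=1..r. t i - s i) = (t i - s i) + (\<Sum>l\<in>{1..r} - {i}. t l - s l)"
      using i by (subst sum.remove[of _ i]) auto
    ultimately have "?N i * ?F ?s = fact d"
      using Suc.prems i by (intro Suc.IH) auto
    moreover have "?F s = ?F ?s * (t i - s i)"
    proof -
      have "?F s = fact (t i - s i) * (\<Prod>l\<in>{1..r} - {i}. fact (t l - s l))"
        using i by (subst prod.remove[of _ i]) auto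
      moreover have "?F ?s = fact (t i - Suc (s i)) * (\<Prod>l\<in>{1..r} - {i}. fact (t l - s l))"
        using i by (subst prod.remove[of _ i]) auto
      moreover have "fact (t i - s i) = (t i - s i) * (fact (t i - Suc (s i)) :: nat)"
        using i by (metis Suc_diff_Suc fact_Suc of_nat_id)
      ultimately show ?thesis by simp
    qed
    ultimately show ?thesis by (simp flip: mult.assoc)
  qed
  have "length (filt_gens r t (Suc d) s X) = (\<Sum>i\<leftarrow>filter (\<lambda>i. s i < t i) [1..<Suc r]. ?N i)"
    by (simp add: length_join_gens o_def)
  also have "\<dots> = (\<Sum>i\<in>{i\<in>{1..r}. s i < t i}. ?N i)"
    by (subst sum_list_distinct_conv_sum_set) (auto intro!: sum.cong simp: atLeastLessThanSuc_atLeastAtMost)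
  finally have "length (filt_gens r t (Suc d) s X) * ?F s = (\<Sum>i\<in>{i\<in>{1..r}. s i < t i}. ?N i * ?F s)"
    by (simp add: sum_distrib_right)
  also have "\<dots> = (\<Sum>i\<in>{i\<in>{1..r}. s i < t i}. fact d * (t i - s i))"
    by (intro sum.cong refl F) auto
  also have "\<dots> = (\<Sum>i=1..r. fact d * (t i - s i))"
    by (rule sum.mono_neutral_left) auto
  also have "\<dots> = fact d * Suc d" using Suc.prems by (simp flip: sum_distrib_left)
  finally show ?case by simp
qed

text \<open>All that is specific to the ring sits in \<open>rel\<close>: the product over the
  unfinished directions vanishes up to a unit. The lemma thus serves both the jet ring and the
  algebra of factorizations.\<close>

lemma (in mult_subset) filtration_filt_gens:
  assumes X: "\<And>i j. i \<in> {1..r} \<Longrightarrow> j < t i \<Longrightarrow> X i j \<in> A"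
    and P: "P \<subseteq> idl A (G \<union> {X i j | i j. i \<in> {1..r} \<and> j < t i})"
    and rel: "\<And>s. (\<forall>i\<in>{1..r}. s i \<le> t i) \<Longrightarrow> (\<exists>i\<in>{1..r}. s i < t i) \<Longrightarrow>
       \<exists>q\<in>S. q * (\<Prod>i\<in>{i\<in>{1..r}. s i < t i}. X i (s i)) \<in> idl A (G \<union> {X i j | i j. i \<in> {1..r} \<and> j < s i})"
  assumes "\<forall>i\<in>{1..r}. s i \<le> t i" "(\<Sum>i=1..r. t i - s i) = d"
  shows "filtration A S P (G \<union> {X i j | i j. i \<in> {1..r} \<and> j < s i}) (filt_gens r t d s X)"
  using assms(4,5)
proof (induction d arbitrary: s)
  case 0
  let ?Q = "G \<union> {X i j | i j. i \<in> {1..r} \<and> j < s i}"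
  have "t i \<le> s i" if "i \<in> {1..r}" for i
    using 0(2) that by simp
  then have "{X i j | i j. i \<in> {1..r} \<and> j < t i} \<subseteq> {X i j | i j. i \<in> {1..r} \<and> j < s i}"
    by (blast intro: less_le_trans)
  then have sub: "G \<union> {X i j | i j. i \<in> {1..r} \<and> j < t i} \<subseteq> ?Q" by blast
  have "p \<in> idl A ?Q" if "p \<in> P" for p
    by (rule idl_mono[OF subring subsetD[OF P that] sub])
  moreover have "1 \<in> idl A (?Q \<union> {1})" by (rule idl_gen[OF subring]) simp
  ultimately show ?case unfolding filtration_def using S_one by (auto intro!: bexI[of _ 1 S])
next
  case (Suc d)
  let ?Q = "\<lambda>s. G \<union> {X i j | i j. i \<in> {1..r} \<and> j < s i}"
  let ?vs = "map (\<lambda>i. (X i (s i), filt_gens r t d (s(i := Suc (s i))) X)) (filter (\<lambda>i. s i < t i) [1..<Suc r])"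
  have "X i (s i) \<in> A \<and> filtration A S P (insert (X i (s i)) (?Q s)) (filt_gens r t d (s(i := Suc (s i))) X)"
    if i: "i \<in> {1..r}" "s i < t i" for i
  proof -
    let ?s = "s(i := Suc (s i))"
    have "(\<Sum>i=1..r. t i - ?s i) = (t i - Suc (s i)) + (\<Sum>l\<in>{1..r} - {i}. t l - s l)"
      using i by (subst sum.remove[of _ i]) auto
    moreover have "(\<Sum>i=1..r. t i - s i) = (t i - s i) + (\<Sum>l\<in>{1..r} - {i}. t l - s l)"
      using i by (subst sum.remove[of _ i]) auto
    ultimately have "filtration A S P (?Q ?s) (filt_gens r t d ?s X)"
      using Suc.prems i by (intro Suc.IH) auto
    moreover have "?Q ?s = insert (X i (s i)) (?Q s)"
    proof -
      have "{X l j | l j. l \<in> {1..r} \<and> j < ?s l} = insert (X i (s i)) {X l j | l j. l \<in> {1..r} \<and> j < s l}"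
      proof -
        have cond: "(l \<in> {1..r} \<and> j < ?s l) \<longleftrightarrow> (l = i \<and> j = s i) \<or> (l \<in> {1..r} \<and> j < s l)" for l j
          using i by auto
        show ?thesis unfolding cond by auto
      qed
      then show ?thesis by simp
    qed
    ultimately show ?thesis using X i by simp
  qed
  then have "\<forall>(v, bs) \<in> set ?vs. v \<in> A \<and> filtration A S P (insert v (?Q s)) bs" by auto
  from filtration_join_gens[OF this]
  have 1: "filtration A S P (insert (\<Prod>i\<leftarrow>filter (\<lambda>i. s i < t i) [1..<Suc r]. X i (s i)) (?Q s))
    (filt_gens r t (Suc d) s X)" by (simp add: o_def)
  have pl: "(\<Prod>i\<leftarrow>filter (\<lambda>i. s i < t i) [1..<Suc r]. X i (s i)) = (\<Prod>i\<in>{i\<in>{1..r}. s i < t i}. X i (s i))"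
    by (subst prod.distinct_set_conv_list[symmetric]) (auto intro!: prod.cong simp: atLeastLessThanSuc_atLeastAtMost)
  have "\<exists>i\<in>{1..r}. s i < t i"
  proof (rule ccontr)
    assume "\<not> ?thesis"
    then have "(\<Sum>i=1..r. t i - s i) = 0" by auto
    then show False using Suc.prems by simp
  qed
  from rel[OF Suc.prems(1) this] obtain q where
    q: "q \<in> S" "q * (\<Prod>i\<in>{i\<in>{1..r}. s i < t i}. X i (s i)) \<in> idl A (?Q s)" by auto
  show ?case
  proof (rule filtration_mono[OF 1 q(1)])
    fix g assume "g \<in> insert (\<Prod>i\<leftarrow>filter (\<lambda>i. s i < t i) [1..<Suc r]. X i (s i)) (?Q s)"
    then show "q * g \<in> idl A (?Q s)"
      using q S_A unfolding pl by (auto intro: idl_gen_mult)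
  qed
qed

section \<open>Substitution into polynomials\<close>

abbreviation "keys \<equiv> Poly_Mapping.keys"
abbreviation "lookup \<equiv> Poly_Mapping.lookup"
abbreviation "single \<equiv> Poly_Mapping.single"

definition monom_eval :: "('v \<Rightarrow> 'b::comm_ring_1) \<Rightarrow> ('v \<Rightarrow>\<^sub>0 nat) \<Rightarrow> 'b" where
  "monom_eval \<sigma> mu = (\<Prod>v\<in>keys mu. \<sigma> v ^ lookup mu v)"

lemma monom_eval_superset:
  assumes "finite V" "keys mu \<subseteq> V"
  shows "monom_eval \<sigma> mu = (\<Prod>v\<in>V. \<sigma> v ^ lookup mu v)"
  unfolding monom_eval_def using assms by (intro prod.mono_neutral_left) (auto simp: in_keys_iff)

lemma monom_eval_0 [simp]: "monom_eval \<sigma> 0 = 1"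
  by (simp add: monom_eval_def)

lemma monom_eval_add: "monom_eval \<sigma> (a + b) = monom_eval \<sigma> a * monom_eval \<sigma> b"
proof -
  let ?V = "keys a \<union> keys b"
  have "monom_eval \<sigma> (a + b) = (\<Prod>v\<in>?V. \<sigma> v ^ lookup (a + b) v)"
    by (rule monom_eval_superset) (use keys_add[of a b] in auto)
  also have "\<dots> = monom_eval \<sigma> a * monom_eval \<sigma> b"
    by (simp add: monom_eval_superset[of ?V] lookup_add power_add prod.distrib)
  finally show ?thesis .
qed

lemma monom_eval_single [simp]: "monom_eval \<sigma> (single v n) = \<sigma> v ^ n"
  by (cases "n = 0") (auto simp: monom_eval_def)

text \<open>The map on coefficients is a parameter because three targets occur: the field for
  evaluation, polynomials via \<open>mconst\<close> for substitution, and univariate polynomials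
  over them for the grading.\<close>

definition psubst :: "('k::comm_ring_1 \<Rightarrow> 'b::comm_ring_1) \<Rightarrow> ('v \<Rightarrow> 'b) \<Rightarrow> (('v \<Rightarrow>\<^sub>0 nat) \<Rightarrow>\<^sub>0 'k) \<Rightarrow> 'b" where
  "psubst c \<sigma> p = (\<Sum>mu\<in>keys p. c (lookup p mu) * monom_eval \<sigma> mu)"

lemma mpoly_sum_single: "p = (\<Sum>mu\<in>keys p. single mu (lookup p mu))"
  by (rule poly_mapping_eqI) (auto simp: lookup_sum lookup_single when_def in_keys_iff)

locale coeff_hom =
  fixes c :: "'k::comm_ring_1 \<Rightarrow> 'b::comm_ring_1"
  assumes c_0 [simp]: "c 0 = 0" and c_1 [simp]: "c 1 = 1"
    and c_add: "c (x + y) = c x + c y" and c_mult: "c (x * y) = c x * c y"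
begin

lemma psubst_superset:
  assumes "finite M" "keys p \<subseteq> M"
  shows "psubst c \<sigma> p = (\<Sum>mu\<in>M. c (lookup p mu) * monom_eval \<sigma> mu)"
  unfolding psubst_def using assms by (intro sum.mono_neutral_left) (auto simp: in_keys_iff)

lemma psubst_0 [simp]: "psubst c \<sigma> 0 = 0"
  by (simp add: psubst_def)

lemma psubst_single [simp]: "psubst c \<sigma> (single mu a) = c a * monom_eval \<sigma> mu"
  by (cases "a = 0") (auto simp: psubst_def)

lemma psubst_add: "psubst c \<sigma> (p + q) = psubst c \<sigma> p + psubst c \<sigma> q"
proof -
  let ?M = "keys p \<union> keys q"
  have "psubst c \<sigma> (p + q) = (\<Sum>mu\<in>?M. c (lookup (p + q) mu) * monom_eval \<sigma> mu)"
    by (rule psubst_superset) (use keys_add[of p q] in auto)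
  also have "\<dots> = psubst c \<sigma> p + psubst c \<sigma> q"
    by (simp add: psubst_superset[of ?M] lookup_add c_add distrib_right sum.distrib)
  finally show ?thesis .
qed

lemma psubst_sum: "psubst c \<sigma> (sum f I) = (\<Sum>i\<in>I. psubst c \<sigma> (f i))"
  by (induction I rule: infinite_finite_induct) (auto simp: psubst_add)

lemma psubst_mult: "psubst c \<sigma> (p * q) = psubst c \<sigma> p * psubst c \<sigma> q"
proof -
  have "p * q = (\<Sum>a\<in>keys p. \<Sum>b\<in>keys q. single (a + b) (lookup p a * lookup q b))"
    by (subst (1) mpoly_sum_single[of p], subst (1) mpoly_sum_single[of q])
       (simp add: sum_product mult_single)
  then have "psubst c \<sigma> (p * q) =
      (\<Sum>a\<in>keys p. \<Sum>b\<in>keys q. c (lookup p a * lookup q b) * monom_eval \<sigma> (a + b))"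
    by (simp add: psubst_sum)
  also have "\<dots> = psubst c \<sigma> p * psubst c \<sigma> q"
    by (simp add: psubst_def sum_product c_mult monom_eval_add algebra_simps)
  finally show ?thesis .
qed

lemma psubst_1 [simp]: "psubst c \<sigma> 1 = 1"
  using psubst_single[of \<sigma> 0 1] by (simp del: psubst_single)

lemma psubst_uminus: "psubst c \<sigma> (- p) = - psubst c \<sigma> p"
  using psubst_add[of \<sigma> p "- p"] by (simp add: minus_unique)

lemma psubst_diff: "psubst c \<sigma> (p - q) = psubst c \<sigma> p - psubst c \<sigma> q"
  using psubst_add[of \<sigma> p "- q"] by (simp add: psubst_uminus)

lemma psubst_prod: "psubst c \<sigma> (prod f I) = (\<Prod>i\<in>I. psubst c \<sigma> (f i))"
  by (induction I rule: infinite_finite_induct) (auto simp: psubst_mult)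

end

lemma psubst_var: "coeff_hom c \<Longrightarrow> psubst c \<sigma> (var i j) = \<sigma> (i, j)"
  by (simp add: var_def coeff_hom.psubst_single coeff_hom.c_1)

section \<open>Polynomial rings in a set of variables\<close>

definition mpolys :: "'v set \<Rightarrow> (('v \<Rightarrow>\<^sub>0 nat) \<Rightarrow>\<^sub>0 'k::comm_ring_1) set" where
  "mpolys V = {p. \<forall>mu \<in> keys p. keys mu \<subseteq> V}"

abbreviation mconst :: "'k \<Rightarrow> ('v \<Rightarrow>\<^sub>0 nat) \<Rightarrow>\<^sub>0 'k::comm_ring_1" where
  "mconst \<equiv> single 0"

lemma coeff_hom_mconst: "coeff_hom mconst"
  by unfold_locales (auto simp: single_add mult_single)

lemma coeff_hom_id: "coeff_hom (\<lambda>x. x)"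
  by unfold_locales auto

lemma subring_mpolys: "subring_set (mpolys V :: (('v \<Rightarrow>\<^sub>0 nat) \<Rightarrow>\<^sub>0 'k::comm_ring_1) set)"
proof -
  have "p * q \<in> mpolys V" if "p \<in> mpolys V" "q \<in> mpolys V" for p q :: "('v \<Rightarrow>\<^sub>0 nat) \<Rightarrow>\<^sub>0 'k"
    unfolding mpolys_def
  proof (clarify)
    fix mu v assume "mu \<in> keys (p * q)" "v \<in> keys mu"
    moreover then obtain a b where "mu = a + b" "a \<in> keys p" "b \<in> keys q"
      using keys_mult[of p q] by blast
    ultimately show "v \<in> V" using that keys_add[of a b] unfolding mpolys_def by blast
  qed
  moreover have "p + q \<in> mpolys V" if "p \<in> mpolys V" "q \<in> mpolys V" for p q :: "('v \<Rightarrow>\<^sub>0 nat) \<Rightarrow>\<^sub>0 'k"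
    using that keys_add[of p q] unfolding mpolys_def by blast
  moreover have "- p \<in> mpolys V" if "p \<in> mpolys V" for p :: "('v \<Rightarrow>\<^sub>0 nat) \<Rightarrow>\<^sub>0 'k"
    using that by (auto simp: mpolys_def in_keys_iff)
  moreover have "(0 :: ('v \<Rightarrow>\<^sub>0 nat) \<Rightarrow>\<^sub>0 'k) \<in> mpolys V" "(1 :: ('v \<Rightarrow>\<^sub>0 nat) \<Rightarrow>\<^sub>0 'k) \<in> mpolys V"
    by (simp_all add: mpolys_def)
  ultimately show ?thesis unfolding subring_set_def by blast
qed

lemma single_in_mpolys: "keys mu \<subseteq> V \<Longrightarrow> single mu a \<in> mpolys V"
  by (auto simp: mpolys_def split: if_splits)

lemma mconst_in_mpolys [simp]: "mconst a \<in> mpolys V"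
  by (rule single_in_mpolys) simp

lemma var_in_mpolys: "(i, j) \<in> V \<Longrightarrow> var i j \<in> mpolys V"
  unfolding var_def by (rule single_in_mpolys) simp

lemma (in coeff_hom) psubst_in:
  assumes "subring_set B" "p \<in> mpolys V" "\<And>a. c a \<in> B" "\<And>v. v \<in> V \<Longrightarrow> \<sigma> v \<in> B"
  shows "psubst c \<sigma> p \<in> B"
  unfolding psubst_def monom_eval_def using assms(2)
  by (intro subring_set_sum subring_set_prod subring_set_power subring_setD[OF assms(1)] assms(1,3,4))
     (auto simp: mpolys_def)

lemma psubst_mconst_self:
  assumes "p \<in> mpolys V" "\<And>v. v \<in> V \<Longrightarrow> \<sigma> v = single (single v 1) (1::'k::comm_ring_1)"
  shows "psubst mconst \<sigma> p = p"
proof -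
  have pow: "single (single v 1) (1::'k) ^ n = single (single v n) 1" for v :: 'a and n
    by (induction n) (auto simp: mult_single simp flip: single_add)
  have prd: "(\<Prod>v\<in>W. single (single v (lookup mu v)) (1::'k)) = single (\<Sum>v\<in>W. single v (lookup mu v)) 1" for W and mu :: "'a \<Rightarrow>\<^sub>0 nat"
    by (induction W rule: infinite_finite_induct) (auto simp: mult_single)
  have sm: "(\<Sum>v\<in>keys mu. single v (lookup mu v)) = mu" for mu :: "'a \<Rightarrow>\<^sub>0 nat"
    by (rule mpoly_sum_single[symmetric, where ?'a = 'a])
  have "monom_eval \<sigma> mu = single mu 1" if "mu \<in> keys p" for mu
  proof -
    have "monom_eval \<sigma> mu = (\<Prod>v\<in>keys mu. single (single v (lookup mu v)) 1)"
      unfolding monom_eval_def using assms that by (intro prod.cong) (auto simp: mpolys_def pow subset_iff simp del: One_nat_def)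
    then show ?thesis by (simp add: prd sm)
  qed
  then show ?thesis
    by (subst (2) mpoly_sum_single[of p]) (simp add: psubst_def mult_single)
qed

definition monom_weight :: "('v \<Rightarrow> nat) \<Rightarrow> ('v \<Rightarrow>\<^sub>0 nat) \<Rightarrow> nat" where
  "monom_weight e mu = (\<Sum>v\<in>keys mu. lookup mu v * e v)"

lemma monom_weight_superset:
  "finite V \<Longrightarrow> keys mu \<subseteq> V \<Longrightarrow> monom_weight e mu = (\<Sum>v\<in>V. lookup mu v * e v)"
  unfolding monom_weight_def by (intro sum.mono_neutral_left) (auto simp: in_keys_iff)

text \<open>Positional notation: a new variable gets a weight \<open>B\<close> above every total
  reached on \<open>M\<close> by the earlier ones, so its exponent is a quotient by \<open>B\<close>
  and the earlier total the remainder.\<close>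

lemma exists_separating_weight:
  assumes "finite V" "finite M"
  shows "\<exists>e::'v \<Rightarrow> nat. \<forall>a\<in>M. \<forall>b\<in>M. (\<Sum>v\<in>V. lookup (a::'v \<Rightarrow>\<^sub>0 nat) v * e v) = (\<Sum>v\<in>V. lookup b v * e v) \<longrightarrow>
    (\<forall>v\<in>V. lookup a v = lookup b v)"
  using assms(1)
proof (induction V rule: finite_induct)
  case (insert w V)
  then obtain e where e: "\<And>a b. a \<in> M \<Longrightarrow> b \<in> M \<Longrightarrow>
      (\<Sum>v\<in>V. lookup a v * e v) = (\<Sum>v\<in>V. lookup b v * e v) \<Longrightarrow> \<forall>v\<in>V. lookup a v = lookup b v"
    by metis
  define B where "B = Suc (\<Sum>a\<in>M. \<Sum>v\<in>V. lookup a v * e v)"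
  have B: "(\<Sum>v\<in>V. lookup a v * e v) < B" if "a \<in> M" for a
    unfolding B_def using member_le_sum[of a M "\<lambda>a. \<Sum>v\<in>V. lookup a v * e v"] that assms(2)
    by (simp add: less_Suc_eq_le)
  let ?e = "e(w := B)"
  have s: "(\<Sum>v\<in>insert w V. lookup a v * ?e v) = lookup a w * B + (\<Sum>v\<in>V. lookup a v * e v)" for a
    using insert by (subst sum.insert) (auto intro!: sum.cong)
  show ?case
  proof (intro exI[of _ ?e] ballI impI)
    fix a b v assume ab: "a \<in> M" "b \<in> M" and v: "v \<in> insert w V"
      and eq: "(\<Sum>v\<in>insert w V. lookup a v * ?e v) = (\<Sum>v\<in>insert w V. lookup b v * ?e v)"
    have "lookup a w = (lookup a w * B + (\<Sum>v\<in>V. lookup a v * e v)) div B"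
      using B[OF ab(1)] by simp
    also have "\<dots> = (lookup b w * B + (\<Sum>v\<in>V. lookup b v * e v)) div B"
      using eq unfolding s by simp
    also have "\<dots> = lookup b w" using B[OF ab(2)] by simp
    finally have "lookup a w = lookup b w" .
    moreover from this have "\<forall>v\<in>V. lookup a v = lookup b v"
      using eq unfolding s by (intro e ab) simp
    ultimately show "lookup a v = lookup b v" using v by auto
  qed
qed auto

text \<open>Kronecker substitution \<open>x\<^sub>v \<mapsto> T^(e v)\<close> with separating weights \<open>e\<close> keeps the polynomials nonzero.\<close>

lemma exists_nonvanishing_point:
  fixes F :: "(('v \<Rightarrow>\<^sub>0 nat) \<Rightarrow>\<^sub>0 'k::{field,ring_char_0}) set"
  assumes "finite F" "\<And>p. p \<in> F \<Longrightarrow> \<exists>mu\<in>keys p. keys mu \<inter> Z = {}"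
  shows "\<exists>y. (\<forall>v. y v \<noteq> 0) \<and> (\<forall>p\<in>F. psubst (\<lambda>x. x) (\<lambda>v. if v \<in> Z then 0 else y v) p \<noteq> 0)"
proof -
  define M where "M = (\<Union>p\<in>F. keys p)"
  define V where "V = (\<Union>mu\<in>M. keys mu)"
  have fin: "finite M" "finite V" unfolding M_def V_def using assms(1) by auto
  obtain e :: "'v \<Rightarrow> nat" where e: "\<And>a b. a \<in> M \<Longrightarrow> b \<in> M \<Longrightarrow>
      (\<Sum>v\<in>V. lookup a v * e v) = (\<Sum>v\<in>V. lookup b v * e v) \<Longrightarrow> \<forall>v\<in>V. lookup a v = lookup b v"
    using exists_separating_weight[OF fin(2,1)] by metis
  have inj: "a = b" if "a \<in> M" "b \<in> M" "monom_weight e a = monom_weight e b" for a b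
  proof (rule poly_mapping_eqI)
    fix v
    have "keys a \<subseteq> V" "keys b \<subseteq> V" using that by (auto simp: V_def)
    then have "\<forall>v\<in>V. lookup a v = lookup b v"
      using that fin by (intro e) (simp_all add: monom_weight_superset)
    then show "lookup a v = lookup b v"
      using \<open>keys a \<subseteq> V\<close> \<open>keys b \<subseteq> V\<close> by (metis in_keys_iff subsetD)
  qed
  \<comment> \<open>Only the monomials free of \<open>Z\<close> survive the substitution, and the
    separating weights keep them from cancelling.\<close>
  define K where "K p = (\<Sum>mu\<in>{mu\<in>keys p. keys mu \<inter> Z = {}}. monom (lookup p mu) (monom_weight e mu))"
    for p :: "('v \<Rightarrow>\<^sub>0 nat) \<Rightarrow>\<^sub>0 'k"
  have K_nz: "K p \<noteq> 0" if p: "p \<in> F" for p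
  proof -
    obtain mu where mu: "mu \<in> keys p" "keys mu \<inter> Z = {}" using assms(2)[OF p] by auto
    have "coeff (K p) (monom_weight e mu) =
        (\<Sum>a\<in>{a\<in>keys p. keys a \<inter> Z = {}}. if a = mu then lookup p a else 0)"
      unfolding K_def coeff_sum coeff_monom
      by (intro sum.cong) (use inj p mu in \<open>auto simp: M_def\<close>)
    also have "\<dots> = lookup p mu" using mu by (simp add: sum.delta)
    finally show ?thesis using mu by (metis coeff_0 in_keys_iff)
  qed
  have ev: "psubst (\<lambda>x. x) (\<lambda>v. if v \<in> Z then 0 else x ^ e v) p = poly (K p) x" for p x
  proof -
    have "monom_eval (\<lambda>v. if v \<in> Z then 0 else x ^ e v) mu =
        (if keys mu \<inter> Z = {} then x ^ monom_weight e mu else 0)" for mu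
    proof (cases "keys mu \<inter> Z = {}")
      case True
      then show ?thesis unfolding monom_eval_def monom_weight_def power_sum
        by (auto intro!: prod.cong simp: mult.commute simp flip: power_mult)
    next
      case False
      then show ?thesis unfolding monom_eval_def
        by (auto intro!: prod_zero simp: in_keys_iff zero_power)
    qed
    then show ?thesis
      by (auto simp: psubst_def K_def poly_sum poly_monom sum.inter_filter intro!: sum.cong)
  qed
  \<comment> \<open>The extra factor excludes 0, so that all coordinates \<open>x ^ e v\<close> of
    the point are nonzero.\<close>
  have "(\<Prod>p\<in>F. K p) * [:0, 1:] \<noteq> 0" using K_nz assms(1) by auto
  then have "finite {x. poly ((\<Prod>p\<in>F. K p) * [:0, 1:]) x = 0}" by (rule poly_roots_finite)
  then obtain x where x: "poly ((\<Prod>p\<in>F. K p) * [:0, 1:]) x \<noteq> 0"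
    using ex_new_if_finite[OF infinite_UNIV_char_0] by blast
  then have "\<forall>p\<in>F. poly (K p) x \<noteq> 0" "x \<noteq> 0"
    using assms(1) by (auto simp: poly_prod)
  then show ?thesis by (intro exI[of _ "\<lambda>v. x ^ e v"]) (auto simp: ev)
qed

section \<open>A lower bound for the dimension of a graded quotient\<close>

text \<open>Independent against spanning sets in the quotient by \<open>U\<close>, done in the space
  itself: representatives \<open>f s\<close> in the span of \<open>B\<close> inherit independence,
  since replacing \<open>s\<close> by \<open>f s\<close> changes a combination by an element of
  \<open>U\<close>.\<close>

lemma (in vector_space) card_le_of_independent_mod:
  assumes U: "subspace U" and fin: "finite S" "finite B"
    and ind: "\<And>c. (\<Sum>s\<in>S. c s *s s) \<in> U \<Longrightarrow> \<forall>s\<in>S. c s = 0"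
    and span: "\<And>s. s \<in> S \<Longrightarrow> \<exists>b\<in>span B. s - b \<in> U"
  shows "card S \<le> card B"
proof -
  obtain f where f: "\<And>s. s \<in> S \<Longrightarrow> f s \<in> span B" "\<And>s. s \<in> S \<Longrightarrow> s - f s \<in> U"
    using span by metis
  have indf: "\<forall>s\<in>S. c s = 0" if "(\<Sum>s\<in>S. c s *s f s) = 0" for c
  proof (rule ind)
    have "(\<Sum>s\<in>S. c s *s s) = (\<Sum>s\<in>S. c s *s (s - f s)) + (\<Sum>s\<in>S. c s *s f s)"
      by (simp add: scale_right_diff_distrib sum_subtractf)
    then show "(\<Sum>s\<in>S. c s *s s) \<in> U"
      using that by (auto intro!: subspace_sum subspace_scale U f)
  qed
  have inj: "inj_on f S"
  proof (rule inj_onI, rule ccontr)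
    fix a b assume ab: "a \<in> S" "b \<in> S" "f a = f b" "a \<noteq> b"
    let ?c = "\<lambda>s. if s = a then 1 else if s = b then - 1 else (0 :: 'a)"
    have "(\<Sum>s\<in>S. ?c s *s f s) = (\<Sum>s\<in>{a, b}. ?c s *s f s)"
      using ab fin by (intro sum.mono_neutral_right) auto
    also have "\<dots> = 0" using ab by simp
    finally have "\<forall>s\<in>S. ?c s = 0" using indf[of ?c] by blast
    then show False using ab(1) by auto
  qed
  have "independent (f ` S)"
  proof (rule independent_if_scalars_zero)
    fix c y assume "(\<Sum>x\<in>f ` S. c x *s x) = 0" "y \<in> f ` S"
    then show "c y = 0" using indf[of "c \<circ> f"] inj by (auto simp: sum.reindex)
  qed (use fin in auto)
  then have "card (f ` S) \<le> card B"
    using f fin by (intro conjunct2[OF independent_span_bound]) auto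
  then show ?thesis using inj by (simp add: card_image)
qed

interpretation mpoly_vs: vector_space "\<lambda>(c::'k::field) p. mconst c * (p :: ('v \<Rightarrow>\<^sub>0 nat) \<Rightarrow>\<^sub>0 'k)"
  by unfold_locales (auto simp: algebra_simps single_add mult_single simp flip: mult.assoc)

lemma subspace_idl: "mpoly_vs.subspace (idl (mpolys V) G)"
  by (rule mpoly_vs.subspaceI) (auto intro: idl.zero idl_add idl_mult subring_mpolys)

lemma monom_prod: "(\<Prod>i\<in>I. monom (f i) (n i)) = monom (\<Prod>i\<in>I. f i) (\<Sum>i\<in>I. n i)"
  by (induction I rule: infinite_finite_induct) (auto simp: mult_monom)

lemma monom_eval_monom: "monom_eval (\<lambda>v. monom (x v) (w v)) mu = monom (monom_eval x mu) (monom_weight w mu)"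
  unfolding monom_eval_def monom_weight_def monom_power monom_prod by (simp add: mult.commute)

lemma monom_eval_vars: "monom_eval (\<lambda>v. single (single v 1) (1::'k::comm_ring_1)) mu = single mu 1"
proof -
  have "psubst mconst (\<lambda>v. single (single v 1) (1::'k)) (single mu 1) = single mu 1"
    by (rule psubst_mconst_self[where V = UNIV]) (auto simp: mpolys_def)
  then show ?thesis by (simp add: coeff_hom.psubst_single[OF coeff_hom_mconst])
qed

text \<open>\<open>grading w p\<close> collects the weighted homogeneous components of \<open>p\<close> as the coefficients of a
  univariate polynomial, so that the multiplicativity of the grading comes for free.\<close>

definition grading :: "('v \<Rightarrow> nat) \<Rightarrow> (('v \<Rightarrow>\<^sub>0 nat) \<Rightarrow>\<^sub>0 'k::comm_ring_1) \<Rightarrow> (('v \<Rightarrow>\<^sub>0 nat) \<Rightarrow>\<^sub>0 'k) poly" where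
  "grading w = psubst (\<lambda>x. [:mconst x:]) (\<lambda>v. monom (single (single v 1) 1) (w v))"

lemma coeff_hom_grading: "coeff_hom (\<lambda>x. [:mconst x:])"
  by unfold_locales (auto simp: single_add mult_single mult.commute)

lemmas grading_add = coeff_hom.psubst_add[OF coeff_hom_grading, where \<sigma> = "\<lambda>v. monom (single (single v 1) 1) (w v)" for w, folded grading_def]
  and grading_mult = coeff_hom.psubst_mult[OF coeff_hom_grading, where \<sigma> = "\<lambda>v. monom (single (single v 1) 1) (w v)" for w, folded grading_def]
  and grading_sum = coeff_hom.psubst_sum[OF coeff_hom_grading, where \<sigma> = "\<lambda>v. monom (single (single v 1) 1) (w v)" for w, folded grading_def]
  and grading_prod = coeff_hom.psubst_prod[OF coeff_hom_grading, where \<sigma> = "\<lambda>v. monom (single (single v 1) 1) (w v)" for w, folded grading_def]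
  and grading_diff = coeff_hom.psubst_diff[OF coeff_hom_grading, where \<sigma> = "\<lambda>v. monom (single (single v 1) 1) (w v)" for w, folded grading_def]
  and grading_0 = coeff_hom.psubst_0[OF coeff_hom_grading, where \<sigma> = "\<lambda>v. monom (single (single v 1) 1) (w v)" for w, folded grading_def]

lemma grading_1: "grading w 1 = 1"
  by (simp add: grading_def coeff_hom.psubst_1[OF coeff_hom_grading])

lemma grading_single: "grading w (single mu a) = monom (single mu a) (monom_weight w mu)"
proof -
  have "grading w (single mu a) = [:mconst a:] * monom (single mu 1) (monom_weight w mu)"
    unfolding grading_def coeff_hom.psubst_single[OF coeff_hom_grading] monom_eval_monom monom_eval_vars ..
  then show ?thesis by (simp add: mult_single smult_monom)
qed

lemma coeff_grading_scale: "coeff (grading w (mconst a * p)) d = mconst a * coeff (grading w p) d"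
  by (simp add: grading_mult grading_single monom_weight_def monom_0)

lemma coeff_grading:
  "coeff (grading w p) d = (\<Sum>mu\<in>{mu\<in>keys p. monom_weight w mu = d}. single mu (lookup p mu))"
proof -
  have "coeff (grading w p) d = (\<Sum>mu\<in>keys p. if monom_weight w mu = d then single mu (lookup p mu) else 0)"
    by (subst (1) mpoly_sum_single[of p]) (simp add: grading_sum grading_single coeff_sum)
  then show ?thesis by (simp add: sum.inter_filter)
qed

abbreviation peval :: "('v \<Rightarrow> 'k) \<Rightarrow> (('v \<Rightarrow>\<^sub>0 nat) \<Rightarrow>\<^sub>0 'k::comm_ring_1) \<Rightarrow> 'k" where
  "peval \<equiv> psubst (\<lambda>x. x)"

lemmas peval_add = coeff_hom.psubst_add[OF coeff_hom_id]
  and peval_mult = coeff_hom.psubst_mult[OF coeff_hom_id]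
  and peval_sum = coeff_hom.psubst_sum[OF coeff_hom_id]
  and peval_prod = coeff_hom.psubst_prod[OF coeff_hom_id]
  and peval_diff = coeff_hom.psubst_diff[OF coeff_hom_id]
  and peval_0 = coeff_hom.psubst_0[OF coeff_hom_id]
  and peval_1 = coeff_hom.psubst_1[OF coeff_hom_id]

lemma peval_mconst [simp]: "peval y (mconst a) = a"
  by (simp add: coeff_hom.psubst_single[OF coeff_hom_id])

lemma peval_var [simp]: "peval y (single (single v (Suc 0)) 1) = y v"
  by (simp add: coeff_hom.psubst_single[OF coeff_hom_id])

text \<open>The points lie on a deformation of the scheme cut out by the weighted homogeneous elements
  of \<open>E\<close>, obtained by changing these elements by constants. Monomials spanning the graded quotient
  also span the deformed one, by induction on the weight, and hence separate the points.\<close>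

lemma card_points_le_graded_dimension:
  fixes E :: "(('v \<Rightarrow>\<^sub>0 nat) \<Rightarrow>\<^sub>0 'k::field) set" and \<Omega> :: "('v \<Rightarrow> 'k) set"
  assumes hom: "\<And>g. g \<in> E \<Longrightarrow> \<exists>d>0. grading w g = monom g d"
    and ev: "\<And>g. g \<in> E \<Longrightarrow> \<exists>\<gamma>. \<forall>y\<in>\<Omega>. peval y g = \<gamma>"
    and fin: "finite \<Omega>" "finite B"
    and sep: "\<And>x y. x \<in> \<Omega> \<Longrightarrow> y \<in> \<Omega> \<Longrightarrow> x \<noteq> y \<Longrightarrow> \<exists>v\<in>V. x v \<noteq> y v"
    and span: "\<And>x. x \<in> mpolys V \<Longrightarrow> \<exists>b\<in>mpoly_vs.span B. x - b \<in> idl (mpolys V) E"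
  shows "card \<Omega> \<le> card B"
proof -
  let ?U = "idl (mpolys V) E"
  let ?sc = "\<lambda>c p. mconst c * (p :: ('v \<Rightarrow>\<^sub>0 nat) \<Rightarrow>\<^sub>0 'k)"
  \<comment> \<open>The elements of \<open>B\<close> need not be homogeneous, while the induction on
    the weight needs a span closed under taking components. So \<open>B\<close> gives way to a
    maximal set of monomials independent modulo the graded ideal.\<close>
  define Mon :: "(('v \<Rightarrow>\<^sub>0 nat) \<Rightarrow>\<^sub>0 'k) set" where "Mon = {single mu (1::'k) | mu. keys mu \<subseteq> V}"
  define indep where "indep S \<longleftrightarrow> finite S \<and> S \<subseteq> Mon \<and>
    (\<forall>c. (\<Sum>s\<in>S. ?sc (c s) s) \<in> ?U \<longrightarrow> (\<forall>s\<in>S. c s = 0))" for S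
  have Mon_in: "x \<in> mpolys V" if "x \<in> Mon" for x using that by (auto simp: Mon_def intro: single_in_mpolys)
  have bound: "card S \<le> card B" if "indep S" for S
    using that fin span Mon_in subspace_idl[of V E]
    by (intro mpoly_vs.card_le_of_independent_mod[of ?U]) (auto simp: indep_def)
  have "indep {}" by (simp add: indep_def)
  then obtain S where S: "indep S" and max: "\<And>T. indep T \<Longrightarrow> card T \<le> card S"
    using ex_has_greatest_nat[of indep "{}" card "Suc (card B)"] bound by (metis le_imp_less_Suc)
  have finS: "finite S" using S by (simp add: indep_def)
  have spanS: "\<exists>b\<in>mpoly_vs.span S. x - b \<in> ?U" if x: "x \<in> Mon" for x
  proof (cases "x \<in> S")
    case True
    then show ?thesis by (intro bexI[of _ x]) (auto intro: mpoly_vs.span_base idl.zero)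
  next
    case False
    then have "\<not> indep (insert x S)" using max[of "insert x S"] finS by auto
    then obtain c where c: "(\<Sum>s\<in>insert x S. ?sc (c s) s) \<in> ?U" "\<exists>s\<in>insert x S. c s \<noteq> 0"
      using S x by (auto simp: indep_def)
    have sum: "(\<Sum>s\<in>insert x S. ?sc (c s) s) = ?sc (c x) x + (\<Sum>s\<in>S. ?sc (c s) s)"
      using False finS by simp
    have cx: "c x \<noteq> 0"
    proof
      assume "c x = 0"
      then show False using c S unfolding sum indep_def by auto
    qed
    let ?b = "- ?sc (inverse (c x)) (\<Sum>s\<in>S. ?sc (c s) s)"
    have "?sc (inverse (c x)) (\<Sum>s\<in>insert x S. ?sc (c s) s) \<in> ?U"
      by (rule idl_mult[OF subring_mpolys c(1)]) simp
    also have "?sc (inverse (c x)) (\<Sum>s\<in>insert x S. ?sc (c s) s) = x - ?b"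
      using cx by (simp add: sum distrib_left mult_single flip: mult.assoc)
    finally have "x - ?b \<in> ?U" .
    moreover have "?b \<in> mpoly_vs.span S"
      by (intro mpoly_vs.span_neg mpoly_vs.span_scale mpoly_vs.span_sum mpoly_vs.span_base)
    ultimately show ?thesis by blast
  qed
  \<comment> \<open>\<open>W\<close> takes the place of the ideal of the deformed scheme; the aim is
    that the span of \<open>S\<close> and \<open>W\<close> together exhaust
    \<open>mpolys V\<close>.\<close>
  define W where "W = {x :: ('v \<Rightarrow>\<^sub>0 nat) \<Rightarrow>\<^sub>0 'k. \<forall>y\<in>\<Omega>. peval y x = 0}"
  have W: "mpoly_vs.subspace W"
    by (rule mpoly_vs.subspaceI) (auto simp: W_def peval_add peval_mult peval_0)
  define N where "N = {b + u | b u. b \<in> mpoly_vs.span S \<and> u \<in> W}"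
  have N: "mpoly_vs.subspace N"
    unfolding N_def by (rule mpoly_vs.subspace_sums[OF mpoly_vs.subspace_span W])
  have SN: "x \<in> N" if "x \<in> mpoly_vs.span S" for x
    using that mpoly_vs.subspace_0[OF W] unfolding N_def by force
  have WN: "x \<in> N" if "x \<in> W" for x
    using that mpoly_vs.span_zero unfolding N_def by force
  have deg: "single mu (1::'k) \<in> N" if "monom_weight w mu = d" "keys mu \<subseteq> V" for mu d
    using that
  proof (induction d arbitrary: mu rule: less_induct)
    case (less d)
    have low: "coeff (grading w c) d' \<in> N" if "c \<in> mpolys V" "d' < d" for c d'
    proof -
      have "single mu (lookup c mu) \<in> N" if "mu \<in> keys c" "monom_weight w mu = d'" for mu
      proof -
        have "?sc (lookup c mu) (single mu 1) \<in> N"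
          using that \<open>c \<in> mpolys V\<close> \<open>d' < d\<close>
          by (intro mpoly_vs.subspace_scale[OF N] less.IH) (auto simp: mpolys_def)
        then show ?thesis by (simp add: mult_single)
      qed
      then show ?thesis unfolding coeff_grading by (auto intro!: mpoly_vs.subspace_sum[OF N])
    qed
    \<comment> \<open>Modulo \<open>W\<close> a generator \<open>g\<close> equals the constant
      \<open>\<gamma>\<close>. Its degree \<open>d0\<close> is positive, so the component of the
      cofactor in degree \<open>d - d0\<close> is covered by the induction hypothesis.\<close>
    have U: "coeff (grading w u) d \<in> N" if "u \<in> ?U" for u
      using that
    proof induction
      case zero
      show ?case by (simp add: grading_0 mpoly_vs.subspace_0[OF N])
    next
      case (step u c g)
      obtain d0 where d0: "d0 > 0" "grading w g = monom g d0" using hom step(3) by blast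
      obtain \<gamma> where \<gamma>: "\<And>y. y \<in> \<Omega> \<Longrightarrow> peval y g = \<gamma>" using ev step(3) by blast
      have "coeff (grading w (c * g)) d \<in> N"
      proof (cases "d < d0")
        case True
        then show ?thesis
          unfolding grading_mult d0 mult.commute[of "grading w c"] coeff_monom_mult
          by (simp add: mpoly_vs.subspace_0[OF N])
      next
        case False
        let ?h = "coeff (grading w c) (d - d0)"
        have "?h \<in> N" using step(2) False d0 by (intro low) auto
        then have "?sc \<gamma> ?h \<in> N" by (rule mpoly_vs.subspace_scale[OF N])
        moreover have "?h * (g - mconst \<gamma>) \<in> N"
          by (rule WN) (auto simp: W_def peval_mult peval_diff \<gamma>)
        ultimately have "?sc \<gamma> ?h + ?h * (g - mconst \<gamma>) \<in> N"
          by (rule mpoly_vs.subspace_add[OF N])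
        moreover have "coeff (grading w (c * g)) d = ?h * g"
          unfolding grading_mult d0 mult.commute[of "grading w c"] coeff_monom_mult
          using False by (simp add: mult.commute)
        moreover have "?sc \<gamma> ?h + ?h * (g - mconst \<gamma>) = ?h * g"
          by (simp add: algebra_simps)
        ultimately show ?thesis by simp
      qed
      then show ?case using step by (simp add: grading_add mpoly_vs.subspace_add[OF N])
    qed
    let ?x = "single mu (1::'k)"
    obtain b where b: "b \<in> mpoly_vs.span S" "?x - b \<in> ?U"
      using spanS[of ?x] less.prems by (auto simp: Mon_def)
    obtain c where c: "b = (\<Sum>s\<in>S. ?sc (c s) s)"
      using b(1) by (auto simp: mpoly_vs.span_finite[OF finS])
    \<comment> \<open>A component of a monomial is the monomial itself or 0, so components stay in
      the span of \<open>S\<close>.\<close>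
    have "coeff (grading w s) d \<in> mpoly_vs.span S" if sS: "s \<in> S" for s
    proof -
      obtain nu where "s = single nu 1" using S sS unfolding indep_def Mon_def by blast
      then show ?thesis using sS
        by (auto simp: grading_single intro: mpoly_vs.span_base mpoly_vs.span_zero)
    qed
    then have "coeff (grading w b) d \<in> mpoly_vs.span S"
      unfolding c grading_sum coeff_sum coeff_grading_scale
      by (intro mpoly_vs.span_sum mpoly_vs.span_scale)
    then have "coeff (grading w b) d + coeff (grading w (?x - b)) d \<in> N"
      by (intro mpoly_vs.subspace_add[OF N] SN U b)
    then show ?case using less.prems by (simp add: grading_diff grading_single)
  qed
  have all: "x \<in> N" if "x \<in> mpolys V" for x
  proof -
    have "(\<Sum>mu\<in>keys x. ?sc (lookup x mu) (single mu 1)) \<in> N"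
      using that by (intro mpoly_vs.subspace_sum[OF N] mpoly_vs.subspace_scale[OF N] deg[OF refl])
        (auto simp: mpolys_def)
    then show ?thesis using mpoly_sum_single[of x] by (simp add: mult_single)
  qed
  obtain v where v: "\<And>x y. x \<in> \<Omega> \<Longrightarrow> y \<in> \<Omega> \<Longrightarrow> x \<noteq> y \<Longrightarrow> v x y \<in> V \<and> x (v x y) \<noteq> y (v x y)"
    using sep by metis
  \<comment> \<open>Unnormalized Lagrange interpolation: nonzero at \<open>x\<close> and zero at the
    other points, hence independent modulo \<open>W\<close>.\<close>
  define L where "L x = (\<Prod>y\<in>\<Omega> - {x}. single (single (v x y) 1) 1 - mconst (y (v x y)))" for x
  have L_in: "L x \<in> mpolys V" if "x \<in> \<Omega>" for x
    unfolding L_def using that v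
    by (intro subring_set_prod subring_setD[OF subring_mpolys] subring_mpolys single_in_mpolys) auto
  have L_self: "peval x (L x) \<noteq> 0" if "x \<in> \<Omega>" for x
    unfolding L_def peval_prod using that v fin by (auto simp: peval_diff)
  have L_other: "peval y (L x) = 0" if "x \<in> \<Omega>" "y \<in> \<Omega>" "x \<noteq> y" for x y
    unfolding L_def peval_prod using that fin
    by (intro prod_zero) (auto simp: peval_diff intro!: bexI[of _ y])
  have inj: "inj_on L \<Omega>"
    by (rule inj_onI) (metis L_self L_other)
  have "card (L ` \<Omega>) \<le> card S"
  proof (rule mpoly_vs.card_le_of_independent_mod[OF W])
    fix c assume "(\<Sum>s\<in>L ` \<Omega>. ?sc (c s) s) \<in> W"
    then have sum: "(\<Sum>x\<in>\<Omega>. ?sc (c (L x)) (L x)) \<in> W" using inj by (simp add: sum.reindex)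
    show "\<forall>s\<in>L ` \<Omega>. c s = 0"
    proof clarify
      fix x assume x: "x \<in> \<Omega>"
      have "0 = peval x (\<Sum>z\<in>\<Omega>. ?sc (c (L z)) (L z))" using sum x by (simp add: W_def)
      also have "\<dots> = (\<Sum>z\<in>\<Omega>. if z = x then c (L x) * peval x (L x) else 0)"
        unfolding peval_sum using x L_other by (intro sum.cong) (auto simp: peval_mult)
      also have "\<dots> = c (L x) * peval x (L x)" using x fin by simp
      finally show "c (L x) = 0" using L_self[OF x] by simp
    qed
  next
    fix s assume "s \<in> L ` \<Omega>"
    then obtain b u where "b \<in> mpoly_vs.span S" "u \<in> W" "s = b + u"
      using all L_in unfolding N_def by blast
    then show "\<exists>b\<in>mpoly_vs.span S. s - b \<in> W" by (intro bexI[of _ b]) auto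
  qed (use fin finS in auto)
  then show ?thesis using bound[OF S] inj by (simp add: card_image)
qed

section \<open>Factorizations of a monic polynomial\<close>

text \<open>The formula for g_k with an arbitrary array in place of the variables. The generators of
  J, their specializations and the relations of the algebra of factorizations are instances.\<close>

definition prod_coeff :: "nat \<Rightarrow> (nat \<Rightarrow> nat \<Rightarrow> 'a::comm_ring_1) \<Rightarrow> nat \<Rightarrow> 'a" where
  "prod_coeff r X k = (\<Sum>f \<in> {f \<in> {1..r} \<rightarrow>\<^sub>E {0..k}. (\<Sum>l=1..r. f l) = k}. \<Prod>l=1..r. X l (f l))"

lemma jet_gen_eq: "jet_gen r k = prod_coeff r var k"
  by (simp add: jet_gen_def prod_coeff_def)

lemma finite_prod_coeff_index: "finite {f \<in> {1..r::nat} \<rightarrow>\<^sub>E {0..k::nat}. (\<Sum>l=1..r. f l) = k}"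
  by (rule finite_subset[of _ "{1..r} \<rightarrow>\<^sub>E {0..k}"]) (auto intro: finite_PiE)

lemma prod_coeff_cong:
  "(\<And>l j. l \<in> {1..r} \<Longrightarrow> j \<le> k \<Longrightarrow> X l j = Y l j) \<Longrightarrow> prod_coeff r X k = prod_coeff r Y k"
  unfolding prod_coeff_def by (intro sum.cong prod.cong refl) (auto simp: PiE_def Pi_def)

lemma prod_coeff_hom:
  assumes "\<And>(I :: (nat \<Rightarrow> nat) set) f. \<phi> (sum f I) = (\<Sum>i\<in>I. \<phi> (f i))"
    and "\<And>(I :: nat set) f. \<phi> (prod f I) = (\<Prod>i\<in>I. \<phi> (f i))"
  shows "\<phi> (prod_coeff r X k) = prod_coeff r (\<lambda>l j. \<phi> (X l j)) k"
  unfolding prod_coeff_def assms ..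

lemma coeff_prod_eq_prod_coeff:
  "coeff (\<Prod>l=1..r. p l) k = prod_coeff r (\<lambda>l. coeff (p l)) k"
proof (induction r arbitrary: k)
  case 0
  have "{f \<in> {1..0::nat} \<rightarrow>\<^sub>E {0..k}. (\<Sum>l=1..0. f l) = k} = (if k = 0 then {\<lambda>_. undefined} else {})"
    by auto
  then show ?case by (simp add: prod_coeff_def)
next
  case (Suc r)
  let ?F = "\<lambda>r k. {f \<in> {1..r} \<rightarrow>\<^sub>E {0..k}. (\<Sum>l=1..r. f l) = k}"
  have upd: "(\<Sum>l=1..r. (f(Suc r := j)) l) = (\<Sum>l=1..r. f l)" for f :: "nat \<Rightarrow> nat" and j
    by (intro sum.cong) auto
  have "coeff (\<Prod>l=1..Suc r. p l) k = (\<Sum>j\<le>k. coeff (p (Suc r)) j * prod_coeff r (\<lambda>l. coeff (p l)) (k - j))"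
  proof -
    have "(\<Prod>l=1..Suc r. p l) = p (Suc r) * (\<Prod>l=1..r. p l)" by (simp add: mult.commute)
    then show ?thesis by (simp only: coeff_mult Suc)
  qed
  also have "\<dots> = (\<Sum>(j, f)\<in>Sigma {..k} (\<lambda>j. ?F r (k - j)). coeff (p (Suc r)) j * (\<Prod>l=1..r. coeff (p l) (f l)))"
    unfolding prod_coeff_def sum_distrib_left by (rule sum.Sigma) (auto simp: finite_prod_coeff_index simp del: One_nat_def)
  also have "\<dots> = (\<Sum>f\<in>?F (Suc r) k. \<Prod>l=1..Suc r. coeff (p l) (f l))"
  proof (rule sum.reindex_bij_witness[where i = "\<lambda>f. (f (Suc r), f(Suc r := undefined))" and j = "\<lambda>(j, f). f(Suc r := j)"], goal_cases)
    case (1 a)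
    then obtain j f where a: "a = (j, f)" "j \<le> k" "f \<in> ?F r (k - j)" by auto
    then have "f (Suc r) = undefined" by (auto simp: PiE_def extensional_def)
    then show ?case using a by auto
  next
    case (2 a)
    then obtain j f where a: "a = (j, f)" "j \<le> k" "f \<in> ?F r (k - j)" by auto
    have "f l \<le> k - j" if "l \<in> {1..r}" for l using a that by (auto simp: PiE_def Pi_def)
    then show ?case using a upd[of f j]
      by (auto simp: PiE_def Pi_def extensional_def)
         (metis atLeastAtMost_iff diff_le_self le_Suc_eq le_trans One_nat_def)
  next
    case (3 f)
    then show ?case by auto
  next
    case (4 f)
    have s: "(\<Sum>l=1..r. f l) = k - f (Suc r)" "f (Suc r) \<le> k" using 4 by auto
    have "f l \<le> k - f (Suc r)" if "l \<in> {1..r}" for l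
      using member_le_sum[of l "{1..r}" f] that s by auto
    then show ?case using s 4 upd[of f undefined] by (auto simp: PiE_def Pi_def extensional_def)
  next
    case (5 a)
    then obtain j f where a: "a = (j, f)" by (cases a)
    have "(\<Prod>l=1..r. coeff (p l) ((f(Suc r := j)) l)) = (\<Prod>l=1..r. coeff (p l) (f l))"
      by (intro prod.cong) auto
    then show ?case using a by (simp add: mult.commute)
  qed
  finally show ?case by (simp only: prod_coeff_def)
qed

definition low_vars :: "nat \<Rightarrow> (nat \<Rightarrow> nat) \<Rightarrow> (nat \<times> nat) set" where
  "low_vars r t = {(i, j). i \<in> {1..r} \<and> j < t i}"

text \<open>The generic monic polynomial w_l of degree \<open>t l\<close>, with the low order
  variables themselves as its unknown coefficients.\<close>

definition monic_coeff :: "(nat \<Rightarrow> nat) \<Rightarrow> nat \<Rightarrow> nat \<Rightarrow> 'k::field mpoly" where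
  "monic_coeff t l j = (if j < t l then var l j else if j = t l then 1 else 0)"

text \<open>If T has weight 1, these weights make w_l homogeneous of weight \<open>t l\<close>.
  Above the degree the coefficient is 0, so truncated subtraction does no harm.\<close>

lemma grading_monic_coeff:
  "grading (\<lambda>(i, j). t i - j) (monic_coeff t l j) = monom (monic_coeff t l j) (t l - j)"
proof -
  have "monom_weight (\<lambda>(i, j). t i - j) (single (l, j) (Suc 0)) = t l - j"
    by (simp add: monom_weight_def)
  then show ?thesis
    by (simp add: monic_coeff_def grading_1 grading_0 var_def grading_single monom_0)
qed

lemma grading_prod_coeff_monic:
  fixes t :: "nat \<Rightarrow> nat"
  defines "a \<equiv> (monic_coeff t :: nat \<Rightarrow> nat \<Rightarrow> 'k::field mpoly)"
  assumes "k < (\<Sum>i=1..r. t i)"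
  shows "grading (\<lambda>(i, j). t i - j) (prod_coeff r a k) =
    monom (prod_coeff r a k) ((\<Sum>i=1..r. t i) - k)"
proof -
  let ?F = "{f \<in> {1..r} \<rightarrow>\<^sub>E {0..k}. (\<Sum>l=1..r. f l) = k}"
  let ?M = "(\<Sum>i=1..r. t i)"
  have gr: "grading (\<lambda>(i, j). t i - j) (a l j) = monom (a l j) (t l - j)" for l j
    unfolding a_def by (rule grading_monic_coeff)
  have "grading (\<lambda>(i, j). t i - j) (prod_coeff r a k) =
      (\<Sum>f\<in>?F. monom (\<Prod>l=1..r. a l (f l)) (\<Sum>l=1..r. t l - f l))"
    by (simp add: prod_coeff_def grading_sum grading_prod gr monom_prod)
  also have "\<dots> = (\<Sum>f\<in>?F. monom (\<Prod>l=1..r. a l (f l)) (?M - k))"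
  proof (rule sum.cong[OF refl])
    fix f assume f: "f \<in> ?F"
    show "monom (\<Prod>l=1..r. a l (f l)) (\<Sum>l=1..r. t l - f l) =
        monom (\<Prod>l=1..r. a l (f l)) (?M - k)"
    proof (cases "\<forall>l\<in>{1..r}. f l \<le> t l")
      case True
      then have "(\<Sum>l=1..r. t l - f l) = ?M - (\<Sum>l=1..r. f l)"
        by (intro sum_subtractf_nat) auto
      then show ?thesis using f by auto
    next
      case False
      then have "(\<Prod>l=1..r. a l (f l)) = 0"
        by (intro prod_zero) (auto simp: a_def monic_coeff_def intro!: bexI)
      then show ?thesis by simp
    qed
  qed
  also have "\<dots> = monom (prod_coeff r a k) (?M - k)"
    by (rule poly_eqI) (simp add: prod_coeff_def coeff_sum)
  finally show ?thesis .
qed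

text \<open>A word with \<open>t i\<close> letters \<open>i\<close> distributes the roots \<open>0, 1, \<dots>\<close> of a split polynomial over
  factors of degree \<open>t i\<close>.\<close>

definition root_factor :: "nat list \<Rightarrow> nat \<Rightarrow> 'k::field poly" where
  "root_factor xs i = (\<Prod>p\<in>{p. p < length xs \<and> xs ! p = i}. [:- of_nat p, 1:])"

lemma root_factor_monic:
  "degree (root_factor xs i :: 'k::field poly) = count (mset xs) i"
  "lead_coeff (root_factor xs i :: 'k poly) = 1"
proof -
  have "card {p. p < length xs \<and> xs ! p = i} = count (mset xs) i"
    unfolding count_mset count_list_eq_length_filter length_filter_conv_card by (rule arg_cong[where f = card]) auto
  then show "degree (root_factor xs i :: 'k poly) = count (mset xs) i"
    unfolding root_factor_def by (subst degree_prod_eq_sum_degree) auto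
  show "lead_coeff (root_factor xs i :: 'k poly) = 1"
    unfolding root_factor_def by (simp add: lead_coeff_prod)
qed

lemma poly_root_factor: 
  "poly (root_factor xs i) (of_nat p :: 'k::field_char_0) = 0 \<longleftrightarrow> p < length xs \<and> xs ! p = i"
  unfolding root_factor_def poly_prod by (subst prod_zero_iff) auto

lemma prod_root_factor:
  assumes "set xs \<subseteq> {1..r}"
  shows "(\<Prod>i=1..r. root_factor xs i) = (\<Prod>p<length xs. [:- of_nat p, 1:])"
proof -
  have "(!) xs ` {..<length xs} \<subseteq> {1..r}" using assms by (auto simp: subset_iff)
  from prod.group[OF _ _ this, of "\<lambda>p. [:- of_nat p, 1:]"]
  show ?thesis unfolding root_factor_def by simp
qed

section \<open>Counting words and the points they define\<close>

definition block_word_mset :: "nat \<Rightarrow> (nat \<Rightarrow> nat) \<Rightarrow> nat multiset" where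
  "block_word_mset r t = (\<Sum>i\<in>{1..r}. replicate_mset (t i) i)"

lemma count_block_word_mset: "count (block_word_mset r t) i = (if i \<in> {1..r} then t i else 0)"
proof -
  have "count (block_word_mset r t) i = (\<Sum>l\<in>{1..r}. if l = i then t l else 0)"
    unfolding block_word_mset_def count_sum by (intro sum.cong) auto
  then show ?thesis by (simp only: sum.delta finite_atLeastAtMost)
qed

lemma card_block_words:
  "card (permutations_of_multiset (block_word_mset r t)) * (\<Prod>i=1..r. fact (t i)) = fact (\<Sum>i=1..r. t i)"
proof -
  have "size (block_word_mset r t) = (\<Sum>i=1..r. t i)"
    by (simp add: block_word_mset_def)
  moreover have "(\<Prod>x\<in>set_mset (block_word_mset r t). fact (count (block_word_mset r t) x)) = (\<Prod>i=1..r. fact (t i) :: nat)"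
  proof -
    have "set_mset (block_word_mset r t) \<subseteq> {1..r}"
      using count_block_word_mset[of r t] by (auto simp flip: count_greater_zero_iff split: if_splits)
    then have "(\<Prod>x\<in>set_mset (block_word_mset r t). fact (count (block_word_mset r t) x) :: nat) =
        (\<Prod>x\<in>{1..r}. fact (count (block_word_mset r t) x))"
      by (intro prod.mono_neutral_left) (auto simp: not_in_iff)
    then show ?thesis by (simp add: count_block_word_mset)
  qed
  ultimately show ?thesis
    using card_permutations_of_multiset[of "block_word_mset r t"]
      card_permutations_of_multiset_aux[of "block_word_mset r t"] by (simp add: mult.commute)
qed

text \<open>With M the sum of the \<open>t i\<close>, the product of the factors is made equal to
  the product of all T - p with p < M instead of T^M. This changes the relations, homogeneous of
  positive weight, only by constants, and the words give distinct solutions.\<close>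

theorem multinomial_le_card_spanning_set:
  fixes B :: "'k::field_char_0 mpoly set"
  assumes "finite B"
    and span: "\<And>x. x \<in> mpolys (low_vars r t) \<Longrightarrow> \<exists>b\<in>mpoly_vs.span B.
      x - b \<in> idl (mpolys (low_vars r t)) {prod_coeff r (monic_coeff t) k | k. k < (\<Sum>i=1..r. t i)}"
  shows "fact (\<Sum>i=1..r. t i) \<le> card B * (\<Prod>i=1..r. fact (t i))"
proof -
  let ?P = "permutations_of_multiset (block_word_mset r t)"
  let ?E = "{prod_coeff r (monic_coeff t) k | k. k < (\<Sum>i=1..r. t i)} :: 'k mpoly set"
  define pt where "pt xs = (\<lambda>(i, j). coeff (root_factor xs i :: 'k poly) j)" for xs
  have P: "length xs = (\<Sum>i=1..r. t i)" "set xs \<subseteq> {1..r}" "\<And>i. i \<in> {1..r} \<Longrightarrow> count (mset xs) i = t i"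
    if "xs \<in> ?P" for xs
  proof -
    have xs: "mset xs = block_word_mset r t" using that by (rule permutations_of_multisetD)
    then have "length xs = size (block_word_mset r t)" by (metis size_mset)
    then show "length xs = (\<Sum>i=1..r. t i)" by (simp add: block_word_mset_def)
    have "i \<in> {1..r}" if "i \<in> set xs" for i
    proof (rule ccontr)
      assume "i \<notin> {1..r}"
      then have "count (mset xs) i = 0" unfolding xs count_block_word_mset by (rule if_not_P)
      then show False using that by (simp add: count_eq_zero_iff)
    qed
    then show "set xs \<subseteq> {1..r}" by blast
    show "count (mset xs) i = t i" if "i \<in> {1..r}" for i
      using that unfolding xs count_block_word_mset by simp
  qed
  have ev: "peval (pt xs) (monic_coeff t l j) = coeff (root_factor xs l) j" if "xs \<in> ?P" "l \<in> {1..r}" for xs l j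
  proof -
    have deg: "degree (root_factor xs l :: 'k poly) = t l" using root_factor_monic(1) P(3) that by metis
    moreover have "coeff (root_factor xs l :: 'k poly) (t l) = 1" using root_factor_monic(2) deg by metis
    ultimately show ?thesis
      by (auto simp: monic_coeff_def pt_def psubst_var[OF coeff_hom_id] peval_1 peval_0 coeff_eq_0)
  qed
  have sep: "xs = ys" if xy: "xs \<in> ?P" "ys \<in> ?P" and eq: "\<And>v. v \<in> low_vars r t \<Longrightarrow> pt xs v = pt ys v" for xs ys
  proof (rule nth_equalityI)
    show "length xs = length ys" using P xy by metis
    fix p assume p: "p < length xs"
    then have l: "xs ! p \<in> {1..r}" using P(2)[OF xy(1)] by (meson nth_mem subsetD)
    have "coeff (root_factor xs (xs ! p) :: 'k poly) j = coeff (root_factor ys (xs ! p)) j" for j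
    proof (cases "j < t (xs ! p)")
      case True
      then show ?thesis using eq[of "(xs ! p, j)"] l by (simp add: low_vars_def pt_def)
    next
      case False
      then show ?thesis using ev[OF xy(1) l, of j] ev[OF xy(2) l, of j]
        by (simp add: monic_coeff_def peval_1 peval_0 split: if_splits)
    qed
    \<comment> \<open>The letter at \<open>p\<close> is recovered as the index of the factor with
      root \<open>p\<close>; in characteristic zero the roots are distinct.\<close>
    then have "root_factor xs (xs ! p) = (root_factor ys (xs ! p) :: 'k poly)" by (rule poly_eqI)
    then show "xs ! p = ys ! p"
      using poly_root_factor[where 'k = 'k, of xs "xs ! p" p] poly_root_factor[where 'k = 'k, of ys "xs ! p" p] p by simp
  qed
  have "card (pt ` ?P) \<le> card B"
  proof (rule card_points_le_graded_dimension[where E = ?E and w = "\<lambda>(i, j). t i - j" and V = "low_vars r t"])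
    fix g assume "g \<in> ?E"
    then obtain k where k: "k < (\<Sum>i=1..r. t i)" "g = prod_coeff r (monic_coeff t) k" by auto
    show "\<exists>d>0. grading (\<lambda>(i, j). t i - j) g = monom g d"
      using grading_prod_coeff_monic[OF k(1)] k by (intro exI[of _ "(\<Sum>i=1..r. t i) - k"]) simp
    \<comment> \<open>The value is independent of the word, because the factors of every word have
      the same product.\<close>
    have "peval (pt xs) g = coeff (\<Prod>p<(\<Sum>i=1..r. t i). [:- of_nat p, 1:]) k" if "xs \<in> ?P" for xs
    proof -
      have "peval (pt xs) g = prod_coeff r (\<lambda>l j. peval (pt xs) (monic_coeff t l j)) k"
        unfolding k by (rule prod_coeff_hom) (simp_all add: peval_sum peval_prod)
      also have "\<dots> = prod_coeff r (\<lambda>l. coeff (root_factor xs l)) k"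
        by (rule prod_coeff_cong) (simp add: ev that)
      also have "\<dots> = coeff (\<Prod>l=1..r. root_factor xs l) k"
        by (simp only: coeff_prod_eq_prod_coeff)
      finally show ?thesis unfolding prod_root_factor[OF P(2)[OF that]] P(1)[OF that] .
    qed
    then show "\<exists>\<gamma>. \<forall>y\<in>pt ` ?P. peval y g = \<gamma>" by blast
  next
    fix x y assume "x \<in> pt ` ?P" "y \<in> pt ` ?P" "x \<noteq> y"
    then show "\<exists>v\<in>low_vars r t. x v \<noteq> y v" using sep by blast
  qed (use assms in auto)
  moreover have "inj_on pt ?P" by (rule inj_onI) (auto intro: sep)
  ultimately have "card ?P \<le> card B" by (simp add: card_image)
  then have "card ?P * (\<Prod>i=1..r. fact (t i)) \<le> card B * (\<Prod>i=1..r. fact (t i))" by simp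
  then show ?thesis by (simp only: card_block_words)
qed

section \<open>Chains of saturated ideals\<close>

text \<open>These are the contractions to \<open>A\<close> of the ideals of the localization that
  contain \<open>G\<close>; their chains compute the length of the localized quotient without
  forming it.\<close>

definition sat_ideal :: "'a::comm_ring_1 set \<Rightarrow> 'a set \<Rightarrow> 'a set \<Rightarrow> 'a set \<Rightarrow> bool" where
  "sat_ideal A S G I \<longleftrightarrow> I \<subseteq> A \<and> 0 \<in> I \<and> (\<forall>x\<in>I. \<forall>y\<in>I. x + y \<in> I) \<and> (\<forall>a\<in>A. \<forall>x\<in>I. a * x \<in> I) \<and>
     G \<subseteq> I \<and> (\<forall>x\<in>A. \<forall>q\<in>S. q * x \<in> I \<longrightarrow> x \<in> I)"

context mult_subset begin

lemma filt_steps_split: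
  assumes "filt_steps A S P G (us @ b # vs)" "p \<in> P"
  shows "\<exists>q\<in>S. q * (p * b) \<in> idl A (G \<union> set vs)"
  using assms by (induction us) auto

text \<open>A generator lying in the next ideal up to a unit is redundant: earlier conditions that
  used it get the extra multiplier \<open>q0\<close>. This shortens the list when a step fails to be
  strict.\<close>

lemma filt_steps_drop:
  assumes "filt_steps A S P G (us @ b # vs)" "q0 \<in> S" "q0 * b \<in> idl A (G \<union> set vs)"
  shows "filt_steps A S P G (us @ vs)"
  using assms(1)
proof (induction us)
  case (Cons u us)
  have "\<exists>q\<in>S. q * (p * u) \<in> idl A (G \<union> set (us @ vs))" if pP: "p \<in> P" for p
  proof -
    obtain q where q: "q \<in> S" "q * (p * u) \<in> idl A (G \<union> set (us @ b # vs))" using Cons pP by auto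
    have "q0 * (q * (p * u)) \<in> idl A (G \<union> set (us @ vs))"
      using subring q(2)
    proof (rule idl_transport)
      fix g assume g: "g \<in> G \<union> set (us @ b # vs)"
      show "q0 * g \<in> idl A (G \<union> set (us @ vs))"
      proof (cases "g = b")
        case True
        show ?thesis unfolding True by (rule idl_mono[OF subring assms(3)]) auto
      next
        case False
        then show ?thesis using g S_A[OF assms(2)] by (intro idl_gen_mult) auto
      qed
    qed
    then show ?thesis using q assms(2)
      by (intro bexI[of _ "q0 * q"]) (auto simp: mult.assoc intro: S_mult)
  qed
  then show ?case using Cons by auto
qed simp

lemma sat_ideal_idl:
  assumes "sat_ideal A S G I" "x \<in> idl A G" shows "x \<in> I"
  using assms(2)
proof induction
  case (step x c g)
  then have "g \<in> I" using assms(1) by (auto simp: sat_ideal_def)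
  then have "c * g \<in> I" using assms(1) step by (auto simp: sat_ideal_def)
  then show ?case using assms(1) step by (auto simp: sat_ideal_def)
qed (use assms(1) in \<open>simp add: sat_ideal_def\<close>)

lemma sat_ideal_uminus:
  assumes "sat_ideal A S G I" "x \<in> I" shows "- x \<in> I"
proof -
  have "- 1 * x \<in> I" using assms A_closed(2) A_closed(3)[OF A_closed(2)] unfolding sat_ideal_def by blast
  then show ?thesis by simp
qed

text \<open>The positions of the filtration at which an ideal contributes to the associated graded
  module; an inclusion of saturated ideals with the same positions is an equality.\<close>

definition jumps :: "'a set \<Rightarrow> 'a list \<Rightarrow> 'a set \<Rightarrow> nat set" where
  "jumps G bs I = {i. i < length bs \<and>
     (\<exists>q\<in>S. \<exists>x\<in>I. q * bs ! i - x \<in> idl A (G \<union> set (drop (Suc i) bs)))}"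

lemma jumps_mono: "I \<subseteq> J \<Longrightarrow> jumps G bs I \<subseteq> jumps G bs J"
  unfolding jumps_def by blast

text \<open>Backward induction along the list. For x in \<open>J\<close> in the i-th ideal, a
  coefficient of \<open>bs ! i\<close> in \<open>P\<close> moves a multiple of x to the next ideal;
  a coefficient in \<open>S\<close> makes i a jump of \<open>J\<close>, hence of \<open>I\<close>,
  and an element of \<open>I\<close> cancels the term. Saturation removes the multipliers.\<close>

lemma sat_ideal_eq_if_jumps_eq:
  assumes filt: "filtration A S P G bs" and cover: "A \<subseteq> P \<union> S"
    and I: "sat_ideal A S G I" and J: "sat_ideal A S G J" and IJ: "I \<subseteq> J"
    and eq: "jumps G bs I = jumps G bs J" and bs: "set bs \<subseteq> A"
  shows "J \<subseteq> I"
proof -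
  have mem: "x \<in> J \<Longrightarrow> x \<in> idl A (G \<union> set (drop i bs)) \<Longrightarrow> x \<in> I" if "i \<le> length bs" for i x
    using that
  proof (induction i arbitrary: x rule: inc_induct)
    case base
    then show ?case using sat_ideal_idl[OF I] by simp
  next
    case (step i)
    let ?L = "idl A (G \<union> set (drop (Suc i) bs))"
    have drop: "drop i bs = bs ! i # drop (Suc i) bs" using step by (simp add: Cons_nth_drop_Suc)
    obtain c l where cl: "c \<in> A" "l \<in> ?L" "x = l + c * bs ! i"
      using idl_insertD[OF subring, of x "bs ! i" "G \<union> set (drop (Suc i) bs)"] step.prems(2)
      unfolding drop by auto
    have xA: "x \<in> A" using J step.prems(1) by (auto simp: sat_ideal_def)
    have satI: "q * x \<in> I \<Longrightarrow> q \<in> S \<Longrightarrow> x \<in> I" for q using I xA unfolding sat_ideal_def by blast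
    show ?case
    proof (cases "c \<in> P")
      case True
      have "filt_steps A S P G (take i bs @ bs ! i # drop (Suc i) bs)"
        using filt step.hyps by (simp add: filtration_def flip: id_take_nth_drop)
      from filt_steps_split[OF this True] obtain q where
        q: "q \<in> S" "q * (c * bs ! i) \<in> ?L" by blast
      have "q * l + q * (c * bs ! i) \<in> ?L"
        by (rule idl_add[OF idl_mult[OF subring cl(2) S_A[OF q(1)]] q(2)])
      then have "q * x \<in> ?L" using cl by (simp add: algebra_simps)
      moreover have "q * x \<in> J" using J q S_A step.prems(1) by (auto simp: sat_ideal_def)
      ultimately show ?thesis using step.IH satI q by blast
    next
      case False
      then have cS: "c \<in> S" using cl cover by auto
      have "c * bs ! i - x = - l" using cl by simp
      then have "c * bs ! i - x \<in> ?L" using idl_uminus[OF subring cl(2)] by simp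
      then have "i \<in> jumps G bs J" using cS step by (auto simp: jumps_def)
      then have "i \<in> jumps G bs I" unfolding eq .
      then obtain q y where q: "q \<in> S" "y \<in> I" "q * bs ! i - y \<in> ?L" unfolding jumps_def by blast
      have cyI: "c * y \<in> I" using I q cl by (auto simp: sat_ideal_def)
      have "q * l + c * (q * bs ! i - y) \<in> ?L"
        using q S_A cl by (intro idl_add idl_mult subring) auto
      then have 1: "q * x - c * y \<in> ?L" using cl by (simp add: algebra_simps)
      have "q * x + - (c * y) \<in> J"
        using J q S_A step.prems(1) sat_ideal_uminus[OF J, of "c * y"] cyI IJ
        unfolding sat_ideal_def by blast
      then have "q * x - c * y \<in> J" by simp
      then have "q * x - c * y \<in> I" using step.IH 1 by blast
      then have "(q * x - c * y) + c * y \<in> I" using I cyI unfolding sat_ideal_def by blast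
      then show ?thesis using satI q by simp
    qed
  qed
  obtain q where q: "q \<in> S" "q \<in> idl A (G \<union> set bs)" using filt by (auto simp: filtration_def)
  show ?thesis
  proof
    fix x assume x: "x \<in> J"
    then have xA: "x \<in> A" using J by (auto simp: sat_ideal_def)
    have "x * q \<in> idl A (G \<union> set (drop 0 bs))" using q xA by (auto intro: idl_mult subring)
    moreover have "q * x \<in> J" using J q S_A x by (auto simp: sat_ideal_def)
    ultimately have "q * x \<in> I" using mem[of 0 "q * x"] by (simp add: mult.commute)
    then show "x \<in> I" using I xA q unfolding sat_ideal_def by blast
  qed
qed

text \<open>Every strict inclusion adds a jump, and jumps are positions in the list.\<close>

lemma chain_length_le:
  assumes "filtration A S P G bs" "A \<subseteq> P \<union> S" "set bs \<subseteq> A"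
    and I: "\<And>i. i \<le> n \<Longrightarrow> sat_ideal A S G (I i)" and strict: "\<And>i. i < n \<Longrightarrow> I i \<subset> I (Suc i)"
  shows "n \<le> length bs"
proof -
  have fin: "finite (jumps G bs K)" for K by (simp add: jumps_def)
  have "i \<le> card (jumps G bs (I i))" if "i \<le> n" for i
    using that
  proof (induction i)
    case (Suc i)
    have "jumps G bs (I i) \<noteq> jumps G bs (I (Suc i))"
    proof
      assume eq: "jumps G bs (I i) = jumps G bs (I (Suc i))"
      have "I (Suc i) \<subseteq> I i"
        by (rule sat_ideal_eq_if_jumps_eq[OF assms(1,2) I I _ eq assms(3)])
           (use Suc.prems strict[of i] in auto)
      then show False using strict[of i] Suc.prems by auto
    qed
    then have "jumps G bs (I i) \<subset> jumps G bs (I (Suc i))"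
      using jumps_mono[of "I i" "I (Suc i)"] strict[of i] Suc.prems by auto
    then have "card (jumps G bs (I i)) < card (jumps G bs (I (Suc i)))"
      by (intro psubset_card_mono fin)
    then show ?case using Suc by simp
  qed simp
  from this[of n] have "n \<le> card (jumps G bs (I n))" by simp
  also have "\<dots> \<le> card {..<length bs}" by (rule card_mono) (auto simp: jumps_def)
  finally show ?thesis by simp
qed

definition saturation :: "'a set \<Rightarrow> 'a set" where
  "saturation G = {x \<in> A. \<exists>q\<in>S. q * x \<in> idl A G}"

lemma sat_ideal_saturation:
  assumes "G \<subseteq> H" "H \<subseteq> A"
  shows "sat_ideal A S G (saturation H)"
  unfolding sat_ideal_def
proof (intro conjI ballI impI)
  show "saturation H \<subseteq> A" by (auto simp: saturation_def)
  show "0 \<in> saturation H" using S_one A_closed(1) by (auto simp: saturation_def intro!: bexI[of _ 1] idl.zero)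
  show "G \<subseteq> saturation H" using S_one assms by (auto simp: saturation_def intro!: bexI[of _ 1] idl_gen subring)
next
  fix x y assume "x \<in> saturation H" "y \<in> saturation H"
  then obtain p q where pq: "x \<in> A" "y \<in> A" "p \<in> S" "q \<in> S" "p * x \<in> idl A H" "q * y \<in> idl A H"
    by (auto simp: saturation_def)
  have "q * (p * x) + p * (q * y) \<in> idl A H" 
    by (intro idl_add[OF idl_mult[OF subring pq(5) S_A[OF pq(4)]] idl_mult[OF subring pq(6) S_A[OF pq(3)]]])
  then have "(p * q) * (x + y) \<in> idl A H" by (simp add: algebra_simps)
  then show "x + y \<in> saturation H"
    using pq S_mult A_closed(4) unfolding saturation_def by blast
next
  fix a x assume "a \<in> A" "x \<in> saturation H"
  then obtain p where p: "a \<in> A" "x \<in> A" "p \<in> S" "p * x \<in> idl A H" by (auto simp: saturation_def)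
  have "a * (p * x) \<in> idl A H" by (rule idl_mult[OF subring p(4,1)])
  then have "p * (a * x) \<in> idl A H" by (simp add: algebra_simps)
  then show "a * x \<in> saturation H" using p A_closed(5) unfolding saturation_def by blast
next
  fix x q assume x: "x \<in> A" "q \<in> S" "q * x \<in> saturation H"
  then obtain p where "p \<in> S" "p * (q * x) \<in> idl A H" by (auto simp: saturation_def)
  then have "p * q \<in> S" "(p * q) * x \<in> idl A H" using x S_mult by (auto simp: mult.assoc)
  then show "x \<in> saturation H" using x by (auto simp: saturation_def)
qed

lemma chain_exists:
  assumes "G \<subseteq> A" "set bs \<subseteq> A"
    and strict: "\<And>i q. i < length bs \<Longrightarrow> q \<in> S \<Longrightarrow> q * bs ! i \<notin> idl A (G \<union> set (drop (Suc i) bs))"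
  shows "\<exists>I. (\<forall>i\<le>length bs. sat_ideal A S G (I i)) \<and> (\<forall>i<length bs. I i \<subset> I (Suc i))"
proof -
  define L where "L i = saturation (G \<union> set (drop i bs))" for i
  have L: "sat_ideal A S G (L i)" for i
    unfolding L_def using assms(1,2) set_drop_subset[of i bs] by (intro sat_ideal_saturation) auto
  have "L (Suc i) \<subset> L i" if i: "i < length bs" for i
  proof -
    have sub: "G \<union> set (drop (Suc i) bs) \<subseteq> G \<union> set (drop i bs)"
      using set_drop_subset_set_drop[of i "Suc i" bs] by auto
    have "L (Suc i) \<subseteq> L i"
      unfolding L_def saturation_def using idl_mono[OF subring _ sub] by blast
    moreover have "bs ! i \<in> L i"
    proof -
      have "bs ! i \<in> set (drop i bs)" using i by (metis Cons_nth_drop_Suc list.set_intros(1))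
      then have "1 * bs ! i \<in> idl A (G \<union> set (drop i bs))" by (simp add: idl_gen subring)
      moreover have "bs ! i \<in> A" using i assms(2) by auto
      ultimately show ?thesis unfolding L_def saturation_def using S_one by blast
    qed
    moreover have "bs ! i \<notin> L (Suc i)" unfolding L_def saturation_def using strict[OF i] by blast
    ultimately show ?thesis by blast
  qed
  \<comment> \<open>The ideals \<open>L i\<close> decrease, so the indices are reversed.\<close>
  then have "L (length bs - i) \<subset> L (length bs - Suc i)" if "i < length bs" for i
    using that Suc_diff_Suc[OF that] by (metis diff_less length_greater_0_conv list.size(3) not_less_zero zero_less_Suc)
  then show ?thesis using L by (intro exI[of _ "\<lambda>i. L (length bs - i)"]) auto
qed

end

lemma idl_sum: "(\<And>i. i \<in> I \<Longrightarrow> f i \<in> idl A G) \<Longrightarrow> sum f I \<in> idl A G"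
  by (induction I rule: infinite_finite_induct) (auto intro: idl.zero idl_add)

text \<open>Among the tuples with the same total as \<open>s\<close>, each one other than
  \<open>s\<close> is smaller in some coordinate, so its product contains a generator of the
  ideal.\<close>

lemma prod_coeff_mod:
  assumes A: "subring_set A" and X: "\<And>l j. l \<in> {1..r} \<Longrightarrow> j \<le> (\<Sum>l=1..r. s l) \<Longrightarrow> X l j \<in> A"
  shows "prod_coeff r X (\<Sum>l=1..r. s l) - (\<Prod>l=1..r. X l (s l)) \<in> idl A {X i j | i j. i \<in> {1..r} \<and> j < s i}"
proof -
  let ?k = "\<Sum>l=1..r. s l"
  let ?F = "{f \<in> {1..r} \<rightarrow>\<^sub>E {0..?k}. (\<Sum>l=1..r. f l) = ?k}"
  let ?I = "idl A {X i j | i j. i \<in> {1..r} \<and> j < s i}"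
  define g where "g = restrict s {1..r}"
  have g: "g \<in> ?F"
    by (auto simp: g_def intro!: member_le_sum)
  have "prod_coeff r X ?k = (\<Prod>l=1..r. X l (g l)) + (\<Sum>f\<in>?F - {g}. \<Prod>l=1..r. X l (f l))"
    unfolding prod_coeff_def by (rule sum.remove[OF finite_prod_coeff_index g])
  moreover have "(\<Prod>l=1..r. X l (g l)) = (\<Prod>l=1..r. X l (s l))" by (rule prod.cong) (auto simp: g_def)
  moreover have "(\<Sum>f\<in>?F - {g}. \<Prod>l=1..r. X l (f l)) \<in> ?I"
  proof -
    have "(\<Prod>l=1..r. X l (f l)) \<in> ?I" if f: "f \<in> ?F - {g}" for f
    proof -
      have fb: "f l \<le> ?k" if "l \<in> {1..r}" for l using f that by (auto simp: PiE_def Pi_def)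
      have "\<exists>l\<in>{1..r}. f l < s l"
      proof (rule ccontr)
        assume "\<not> ?thesis"
        then have le: "\<And>l. l \<in> {1..r} \<Longrightarrow> s l \<le> f l" by (auto simp: not_less)
        have "f l = s l" if l: "l \<in> {1..r}" for l
        proof (rule ccontr)
          assume "f l \<noteq> s l"
          then have "s l < f l" using le[OF l] by simp
          then have "?k < (\<Sum>l=1..r. f l)" using le l by (intro sum_strict_mono_ex1) auto
          then show False using f by simp
        qed
        then have "f = g" using f g by (intro PiE_ext[of f "{1..r}" "\<lambda>_. {0..?k}"]) (auto simp: g_def)
        then show False using f by simp
      qed
      then obtain l where l: "l \<in> {1..r}" "f l < s l" by auto
      have "(\<Prod>l=1..r. X l (f l)) = (\<Prod>i\<in>{1..r} - {l}. X i (f i)) * X l (f l)"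
        using l by (subst prod.remove[of _ l]) (auto simp: mult.commute)
      moreover have "(\<Prod>i\<in>{1..r} - {l}. X i (f i)) \<in> A"
        using fb by (intro subring_set_prod A X) auto
      ultimately show ?thesis using l by (auto intro!: idl_gen_mult)
    qed
    then show ?thesis
      by (rule idl_sum)
  qed
  ultimately show ?thesis by simp
qed

lemma psubst_cong:
  assumes "p \<in> mpolys V" "\<And>v. v \<in> V \<Longrightarrow> \<sigma> v = \<sigma>' v"
  shows "psubst c \<sigma> p = psubst c \<sigma>' p"
  unfolding psubst_def monom_eval_def using assms
  by (intro sum.cong refl arg_cong2[where f = "(*)"] prod.cong) (auto simp: mpolys_def subset_iff)

lemma peval_power: "peval y (p ^ n) = peval y p ^ n"
  by (induction n) (simp_all add: peval_1 peval_mult)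

lemma peval_psubst: "peval z (psubst mconst \<tau> p) = peval (\<lambda>v. peval z (\<tau> v)) p"
  unfolding psubst_def[of mconst \<tau> p] psubst_def[of "\<lambda>x. x" "\<lambda>v. peval z (\<tau> v)" p] monom_eval_def
  by (simp add: peval_sum peval_mult peval_prod peval_power)

lemma peval_zero:
  fixes p :: "('v \<Rightarrow>\<^sub>0 nat) \<Rightarrow>\<^sub>0 'k::comm_ring_1"
  shows "peval (\<lambda>_. 0) p = lookup p 0"
proof -
  have "monom_eval (\<lambda>_. 0 :: 'k) mu = (if mu = 0 then 1 else 0)" for mu :: "'v \<Rightarrow>\<^sub>0 nat"
  proof (cases "mu = 0")
    case False
    then have "keys mu \<noteq> {}" by simp
    then obtain v where v: "v \<in> keys mu" by blast
    then have "(0::'k) ^ lookup mu v = 0" by (simp add: in_keys_iff zero_power)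
    then have "monom_eval (\<lambda>_. 0 :: 'k) mu = 0"
      unfolding monom_eval_def using v by (intro prod_zero) auto
    then show ?thesis using False by simp
  qed simp
  then have "peval (\<lambda>_. 0) p = (\<Sum>mu\<in>keys p. if mu = 0 then lookup p mu else 0)"
    unfolding psubst_def by (intro sum.cong) auto
  also have "\<dots> = lookup p 0" by (simp add: in_keys_iff)
  finally show ?thesis .
qed

lemma mconst_mult: "mconst (a * b) = mconst a * mconst b"
  by (simp add: mult_single)

lemma mconst_prod: "mconst (prod f T) = (\<Prod>i\<in>T. mconst (f i))"
  by (induction T rule: infinite_finite_induct) (simp_all add: mconst_mult)

section \<open>The prime ideal of the low order variables\<close>

definition low_gens :: "nat \<Rightarrow> (nat \<Rightarrow> nat) \<Rightarrow> 'k::field mpoly set" where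
  "low_gens r t = {var i j | i j. i \<in> {1..r} \<and> j < t i}"

text \<open>An ideal generated by variables is a monomial ideal. An element outside it has a
  monomial free of low order variables, which survives where these vanish.\<close>

lemma in_low_ideal:
  fixes p :: "'k::field mpoly"
  assumes p: "p \<in> mpolys V" "\<And>mu. mu \<in> keys p \<Longrightarrow> keys mu \<inter> low_vars r t \<noteq> {}"
  shows "p \<in> idl (mpolys V) (low_gens r t)"
proof -
  have "single mu (lookup p mu) \<in> idl (mpolys V) (low_gens r t)" if mu: "mu \<in> keys p" for mu
  proof -
    obtain i j where ij: "(i, j) \<in> keys mu" "(i, j) \<in> low_vars r t" using p(2)[OF mu] by auto
    let ?nu = "mu - single (i, j) 1"
    have eq: "mu = ?nu + single (i, j) 1"
      by (rule poly_mapping_eqI) (use ij in \<open>auto simp: lookup_add lookup_minus lookup_single when_def in_keys_iff\<close>)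
    have "keys ?nu \<subseteq> keys mu"
      by (auto simp: in_keys_iff lookup_minus)
    then have "keys ?nu \<subseteq> V" using p(1) mu by (auto simp: mpolys_def)
    then have "single ?nu (lookup p mu) * var i j \<in> idl (mpolys V) (low_gens r t)"
      using ij by (intro idl_gen_mult single_in_mpolys) (auto simp: low_gens_def low_vars_def)
    also have "single ?nu (lookup p mu) * var i j = single mu (lookup p mu)"
      unfolding var_def mult_single eq[symmetric] by simp
    finally show ?thesis .
  qed
  then have "(\<Sum>mu\<in>keys p. single mu (lookup p mu)) \<in> idl (mpolys V) (low_gens r t)"
    by (rule idl_sum)
  then show ?thesis by (simp flip: mpoly_sum_single)
qed

lemma peval_low_ideal:
  assumes "x \<in> idl A (low_gens r t)" "\<And>v. v \<in> low_vars r t \<Longrightarrow> y v = 0"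
  shows "peval y x = 0"
  using assms(1)
proof induction
  case (step x c g)
  then obtain i j where "g = var i j" "(i, j) \<in> low_vars r t" by (auto simp: low_gens_def low_vars_def)
  then show ?case using step assms(2) by (simp add: peval_add peval_mult psubst_var[OF coeff_hom_id])
qed (simp add: peval_0)

text \<open>In the ring on the low order variables alone, these generate the ideal of the origin,
  whose residue field is k.\<close>

lemma sub_const_in_low_ideal:
  assumes "x \<in> mpolys (low_vars r t)"
  shows "x - mconst (peval (\<lambda>_. 0) x) \<in> idl (mpolys (low_vars r t)) (low_gens r t)"
proof (rule in_low_ideal)
  show 1: "x - mconst (peval (\<lambda>_. 0) x) \<in> mpolys (low_vars r t)"
    using assms by (intro subring_setD[OF subring_mpolys]) auto
  fix mu assume mu: "mu \<in> keys (x - mconst (peval (\<lambda>_. 0) x))"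
  then have "mu \<noteq> 0" by (auto simp: in_keys_iff lookup_minus peval_zero)
  then have "keys mu \<noteq> {}" by simp
  then show "keys mu \<inter> low_vars r t \<noteq> {}" using 1 mu unfolding mpolys_def by blast
qed

lemma prod_mod_idl:
  assumes A: "subring_set A" and "\<And>i. i \<in> T \<Longrightarrow> a i \<in> A" "\<And>i. i \<in> T \<Longrightarrow> b i \<in> A"
    "\<And>i. i \<in> T \<Longrightarrow> a i - b i \<in> idl A G"
  shows "prod a T - prod b T \<in> idl A G"
  using assms(2-)
proof (induction T rule: infinite_finite_induct)
  case (insert x T)
  have "prod b T \<in> A" using insert by (intro subring_set_prod A) auto
  moreover have "a x - b x \<in> idl A G" "prod a T - prod b T \<in> idl A G" "a x \<in> A" using insert by auto
  ultimately have "a x * (prod a T - prod b T) + prod b T * (a x - b x) \<in> idl A G"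
    using A by (blast intro: idl_add idl_mult)
  then show ?case using insert by (simp add: algebra_simps)
qed (auto intro: idl.zero)

lemma mconst_cancel:
  assumes "mconst a * x \<in> idl (mpolys V) G" "a \<noteq> (0::'k::field)" shows "x \<in> idl (mpolys V) G"
proof -
  have "mconst (inverse a) * (mconst a * x) \<in> idl (mpolys V) G"
    by (rule idl_mult[OF subring_mpolys assms(1) mconst_in_mpolys])
  moreover have "mconst (inverse a) * (mconst a * x) = x"
    using assms(2) by (simp add: mult.assoc[symmetric] mult_single)
  ultimately show ?thesis by (simp only:)
qed

text \<open>The ideal of the origin annihilates each quotient, so the coefficient of its generator
  may be replaced by a constant term: over k one element spans the quotient.\<close>

lemma filt_steps_span:
  fixes E :: "'k::field mpoly set" and r :: nat and t :: "nat \<Rightarrow> nat"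
  defines "C \<equiv> mpolys (low_vars r t)"
  assumes "filt_steps C {mconst a | a. a \<noteq> 0} (idl C (low_gens r t)) E cs" "x \<in> idl C (E \<union> set cs)"
  shows "\<exists>b\<in>mpoly_vs.span (set cs). x - b \<in> idl C E"
  using assms(2,3)
proof (induction cs arbitrary: x)
  case Nil
  then show ?case by (auto intro!: bexI[of _ 0])
next
  case (Cons b cs)
  have sub: "subring_set C" unfolding C_def by (rule subring_mpolys)
  obtain c y where x: "c \<in> C" "y \<in> idl C (E \<union> set cs)" "x = y + c * b"
    using idl_insertD[OF sub, of x b "E \<union> set cs"] Cons.prems by auto
  define c0 where "c0 = peval (\<lambda>_. 0) c"
  have "c - mconst c0 \<in> idl C (low_gens r t)"
    using x(1) unfolding c0_def C_def by (rule sub_const_in_low_ideal)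
  then obtain a where "a \<noteq> 0" "mconst a * ((c - mconst c0) * b) \<in> idl C (E \<union> set cs)"
    using Cons.prems(1) by auto
  then have "(c - mconst c0) * b \<in> idl C (E \<union> set cs)" unfolding C_def by (rule mconst_cancel[rotated])
  then have "y + (c - mconst c0) * b \<in> idl C (E \<union> set cs)" using x by (intro idl_add)
  then obtain d where d: "d \<in> mpoly_vs.span (set cs)" "y + (c - mconst c0) * b - d \<in> idl C E"
    using Cons by auto
  have "d + mconst c0 * b \<in> mpoly_vs.span (set (b # cs))"
  proof (intro mpoly_vs.span_add mpoly_vs.span_scale)
    show "d \<in> mpoly_vs.span (set (b # cs))"
      using d(1) mpoly_vs.span_mono[of "set cs" "set (b # cs)"] by auto
    show "b \<in> mpoly_vs.span (set (b # cs))" by (rule mpoly_vs.span_base) simp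
  qed
  moreover have "x - (d + mconst c0 * b) = y + (c - mconst c0) * b - d"
    using x by (simp add: algebra_simps)
  ultimately show ?case using d(2) by metis
qed

lemma filtration_span:
  fixes E :: "'k::field mpoly set" and r :: nat and t :: "nat \<Rightarrow> nat"
  defines "C \<equiv> mpolys (low_vars r t)"
  assumes "filtration C {mconst a | a. a \<noteq> 0} (idl C (low_gens r t)) E cs" "x \<in> C"
  shows "\<exists>b\<in>mpoly_vs.span (set cs). x - b \<in> idl C E"
proof -
  obtain a where "a \<noteq> 0" "mconst a \<in> idl C (E \<union> set cs)"
    using assms(2) by (auto simp: filtration_def)
  moreover from this have "x * mconst a \<in> idl C (E \<union> set cs)"
    using assms(3) unfolding C_def by (intro idl_mult subring_mpolys)
  ultimately have "x \<in> idl C (E \<union> set cs)"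
    unfolding C_def using mconst_cancel[of a x] by (simp add: mult.commute)
  then show ?thesis using assms(2) unfolding C_def filtration_def by (intro filt_steps_span) auto
qed

lemma (in mult_subset) filtration_drop:
  assumes "filtration A S P G (us @ b # vs)" "q0 \<in> S" "q0 * b \<in> idl A (G \<union> set vs)"
  shows "filtration A S P G (us @ vs)"
proof -
  obtain q where q: "q \<in> S" "q \<in> idl A (G \<union> set (us @ b # vs))" using assms(1) by (auto simp: filtration_def)
  have "q0 * q \<in> idl A (G \<union> set (us @ vs))"
    using subring q(2)
  proof (rule idl_transport)
    fix g assume g: "g \<in> G \<union> set (us @ b # vs)"
    show "q0 * g \<in> idl A (G \<union> set (us @ vs))"
    proof (cases "g = b")
      case True
      show ?thesis unfolding True by (rule idl_mono[OF subring assms(3)]) auto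
    next
      case False
      then show ?thesis using g S_A[OF assms(2)] by (intro idl_gen_mult) auto
    qed
  qed
  then show ?thesis using q(1) assms filt_steps_drop[of P G us b vs q0] S_mult
    unfolding filtration_def by blast
qed

lemma filt_gens_cong:
  assumes "\<And>i j. i \<in> {1..r} \<Longrightarrow> X i j = Y i j"
  shows "filt_gens r t d s X = filt_gens r t d s Y"
proof (induction d arbitrary: s)
  case (Suc d)
  show ?case unfolding filt_gens.simps
    by (intro arg_cong[where f = join_gens] map_cong refl) (use Suc assms in \<open>auto simp: fun_upd_def\<close>)
qed simp

section \<open>The jet ring and its filtration at P\<close>

locale jet_setup =
  fixes n m r :: nat and t :: "nat \<Rightarrow> nat"
  assumes rn: "r \<le> n" and sum_t: "(\<Sum>i=1..r. t i) = m + 1"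
begin

lemma t_le: "i \<in> {1..r} \<Longrightarrow> t i \<le> m + 1"
  using member_le_sum[of i "{1..r}" t] sum_t by simp

abbreviation A where "A \<equiv> mpolys (jet_vars n m)"
abbreviation P where "P \<equiv> idl A (low_gens r t)"
abbreviation S where "S \<equiv> A - P"
abbreviation J where "J \<equiv> {jet_gen r k | k. k \<le> m}"
abbreviation C where "C \<equiv> mpolys (low_vars r t)"
text \<open>\<open>C\<close> modulo \<open>E\<close> is the algebra of factorizations of T^(m+1):
  the non-leading coefficients of the product are set to zero.\<close>

abbreviation E where "E \<equiv> {prod_coeff r (monic_coeff t) k | k. k < (\<Sum>i=1..r. t i)}"
abbreviation units where "units \<equiv> {mconst a | a. a \<noteq> 0}"

lemma var_in_A: "i \<in> {1..r} \<Longrightarrow> j \<le> m \<Longrightarrow> var i j \<in> A"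
  using rn by (intro var_in_mpolys) (auto simp: jet_vars_def)

lemma low_gens_A: "(low_gens r t :: 'k::field mpoly set) \<subseteq> A"
proof
  fix x :: "'k mpoly" assume "x \<in> low_gens r t"
  then obtain i j where "x = var i j" "i \<in> {1..r}" "j < t i" by (auto simp: low_gens_def)
  then show "x \<in> A" using var_in_A[of i j] t_le[of i] by auto
qed

text \<open>The zero locus of \<open>P\<close> is a linear subspace; over an infinite field,
  finitely many polynomials outside \<open>P\<close> are simultaneously nonzero at one of its
  points.\<close>

lemma low_point:
  fixes F :: "'k::field_char_0 mpoly set"
  assumes "finite F" "F \<subseteq> S"
  shows "\<exists>y. (\<forall>v. y v \<noteq> 0) \<and> (\<forall>p\<in>F. peval (\<lambda>v. if v \<in> low_vars r t then 0 else y v) p \<noteq> 0)"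
proof (rule exists_nonvanishing_point)
  fix p assume "p \<in> F"
  then have "p \<in> A" "p \<notin> P" using assms by auto
  then show "\<exists>mu\<in>keys p. keys mu \<inter> low_vars r t = {}"
    using in_low_ideal[of p "jet_vars n m" r t] by blast
qed (fact assms(1))

lemma notin_P: "peval (\<lambda>v. if v \<in> low_vars r t then 0 else y v) p \<noteq> 0 \<Longrightarrow> p \<notin> P"
  using peval_low_ideal[of p A r t "\<lambda>v. if v \<in> low_vars r t then 0 else y v"] by auto

lemma mult_subset_S: "mult_subset A (S :: 'k::field_char_0 mpoly set)"
proof
  show "subring_set (A :: 'k mpoly set)" by (rule subring_mpolys)
  show "(1 :: 'k mpoly) \<in> S"
    using notin_P[of "\<lambda>_. 1" 1] by (simp add: peval_1 subring_setD[OF subring_mpolys])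
  fix p q :: "'k mpoly" assume pq: "p \<in> S" "q \<in> S"
  \<comment> \<open>\<open>P\<close> is prime: at a common point where neither factor vanishes, the
    product does not vanish either.\<close>
  obtain y where y: "\<forall>x\<in>{p, q}. peval (\<lambda>v. if v \<in> low_vars r t then 0 else y v) x \<noteq> 0"
    using low_point[of "{p, q}"] pq by blast
  then have "p * q \<notin> P" by (intro notin_P[of y]) (simp add: peval_mult)
  then show "p * q \<in> S" using pq by (auto intro: subring_setD[OF subring_mpolys])
qed auto

lemma mult_subset_units: "mult_subset C (units :: 'k::field_char_0 mpoly set)"
proof
  show "subring_set (C :: 'k mpoly set)" by (rule subring_mpolys)
  show "(1 :: 'k mpoly) \<in> units" by (auto intro!: exI[of _ 1])
  fix x y :: "'k mpoly" assume "x \<in> units" "y \<in> units"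
  then show "x * y \<in> units" by (force simp: mult_single)
qed auto

lemma sum_less: "\<forall>i\<in>{1..r}. s i \<le> t i \<Longrightarrow> \<exists>i\<in>{1..r}. s i < t i \<Longrightarrow> (\<Sum>i=1..r. s i) \<le> m"
  using sum_strict_mono_ex1[of "{1..r}" s t] sum_t by simp

lemma split_prod:
  fixes X :: "nat \<Rightarrow> nat \<Rightarrow> 'a::comm_ring_1"
  assumes "\<forall>i\<in>{1..r}. s i \<le> t i"
  shows "(\<Prod>i=1..r. X i (s i)) =
    (\<Prod>i\<in>{i\<in>{1..r}. s i = t i}. X i (t i)) * (\<Prod>i\<in>{i\<in>{1..r}. s i < t i}. X i (s i))"
proof -
  let ?A = "{i\<in>{1..r}. s i = t i}" and ?B = "{i\<in>{1..r}. s i < t i}"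
  have "?A \<union> ?B = {1..r}" using assms by force
  moreover have "(\<Prod>i\<in>?A \<union> ?B. X i (s i)) = (\<Prod>i\<in>?A. X i (s i)) * (\<Prod>i\<in>?B. X i (s i))"
    by (rule prod.union_disjoint) auto
  moreover have "(\<Prod>i\<in>?A. X i (s i)) = (\<Prod>i\<in>?A. X i (t i))" by (rule prod.cong) auto
  ultimately show ?thesis by simp
qed

abbreviation gens where "gens \<equiv> filt_gens r t (m + 1) (\<lambda>_. 0)"

lemma length_gens: "length (gens X) * (\<Prod>i=1..r. fact (t i)) = fact (m + 1)"
  using length_filt_gens[of r "\<lambda>_. 0" t "m + 1" X] sum_t by simp

lemma filtration_S:
  "filtration A S P J (gens (var :: nat \<Rightarrow> nat \<Rightarrow> 'k::field_char_0 mpoly))"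
proof -
  interpret mult_subset A "S :: 'k mpoly set" by (rule mult_subset_S)
  let ?X = "var :: nat \<Rightarrow> nat \<Rightarrow> 'k mpoly"
  have "filtration A S P (J \<union> {?X i j | i j. i \<in> {1..r} \<and> j < (\<lambda>_. 0) i}) (gens ?X)"
  proof (rule filtration_filt_gens)
    fix i j assume "i \<in> {1..r}" "j < t i"
    then show "?X i j \<in> A" using t_le[of i] by (intro var_in_A) auto
  next
    show "P \<subseteq> idl A (J \<union> {?X i j | i j. i \<in> {1..r} \<and> j < t i})"
      using idl_mono[OF subring, of _ "low_gens r t" "J \<union> {?X i j | i j. i \<in> {1..r} \<and> j < t i}"]
      by (auto simp: low_gens_def)
  next
    fix s assume s: "\<forall>i\<in>{1..r}. s i \<le> t i" "\<exists>i\<in>{1..r}. s i < t i"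
    let ?Q = "J \<union> {?X i j | i j. i \<in> {1..r} \<and> j < s i}"
    let ?k = "\<Sum>i=1..r. s i"
    have k: "?k \<le> m" by (rule sum_less[OF s])
    \<comment> \<open>If \<open>t i = m + 1\<close>, the ring has no variable of order
      \<open>t i\<close>; this bound ensures that \<open>s i\<close> is then still below
      \<open>t i\<close>.\<close>
    have si: "s i \<le> m" if "i \<in> {1..r}" for i using member_le_sum[of i "{1..r}" s] that k by simp
    have "prod_coeff r ?X ?k - (\<Prod>i=1..r. ?X i (s i)) \<in> idl A {?X i j | i j. i \<in> {1..r} \<and> j < s i}"
      by (rule prod_coeff_mod[OF subring]) (use k in \<open>auto intro!: var_in_A\<close>)
    then have "prod_coeff r ?X ?k - (\<Prod>i=1..r. ?X i (s i)) \<in> idl A ?Q"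
      by (rule idl_mono[OF subring]) auto
    moreover have "prod_coeff r ?X ?k \<in> idl A ?Q"
      using k by (intro idl_gen[OF subring]) (auto simp: jet_gen_eq)
    ultimately have "prod_coeff r ?X ?k - (prod_coeff r ?X ?k - (\<Prod>i=1..r. ?X i (s i))) \<in> idl A ?Q"
      by (rule idl_diff[OF subring, rotated])
    then have all: "(\<Prod>i=1..r. ?X i (s i)) \<in> idl A ?Q" by simp
    let ?q = "\<Prod>i\<in>{i\<in>{1..r}. s i = t i}. ?X i (t i)"
    have "?q \<in> A"
    proof (intro subring_set_prod subring var_in_A)
      fix i assume "i \<in> {i\<in>{1..r}. s i = t i}"
      then show "i \<in> {1..r}" "t i \<le> m" using si[of i] by auto
    qed
    \<comment> \<open>The factors have order exactly \<open>t i\<close>, so they are not low order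
      variables and take the value 1 at the chosen point.\<close>
    moreover have "?q \<notin> P"
      by (rule notin_P[of "\<lambda>_. 1"]) (simp add: peval_prod psubst_var[OF coeff_hom_id] low_vars_def)
    ultimately show "\<exists>q\<in>S. q * (\<Prod>i\<in>{i\<in>{1..r}. s i < t i}. ?X i (s i)) \<in> idl A ?Q"
      using all unfolding split_prod[OF s(1)] by blast
  qed (use sum_t in auto)
  then show ?thesis by simp
qed

end

text \<open>At a point \<open>y\<close> of the linear subspace where the low order variables vanish, each
  \<open>x\<^sub>i\<^sup>(\<^sup>0\<^sup>) + x\<^sub>i\<^sup>(\<^sup>1\<^sup>) T + \<dots>\<close> is replaced by the product of the generic monic polynomial of
  degree \<open>t i\<close> with the power series whose coefficients are the values of \<open>y\<close>.\<close>

definition weierstrass_coeff :: "nat \<Rightarrow> (nat \<Rightarrow> nat) \<Rightarrow> (nat \<times> nat \<Rightarrow> 'k::field) \<Rightarrow> nat \<Rightarrow> nat \<Rightarrow> 'k mpoly" where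
  "weierstrass_coeff m t y i = coeff
     ((\<Sum>j\<le>m. monom (mconst (y (i, t i + j))) j) * (\<Sum>j\<le>t i. monom (monic_coeff t i j) j))"

text \<open>Variables with first index outside \<open>{1..r}\<close> are absent from the generators
  of J; they become their values at the point, so the image involves low order variables
  only.\<close>

definition specialize :: "nat \<Rightarrow> nat \<Rightarrow> (nat \<Rightarrow> nat) \<Rightarrow> (nat \<times> nat \<Rightarrow> 'k::field) \<Rightarrow> 'k mpoly \<Rightarrow> 'k mpoly" where
  "specialize m r t y = psubst mconst
     (\<lambda>(i, j). if i \<in> {1..r} then weierstrass_coeff m t y i j else mconst (y (i, j)))"

lemma coeff_sum_monom: "coeff (\<Sum>j\<le>d. monom (a j) j) k = (if k \<le> d then a k else 0)"
  by (simp add: coeff_sum)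

lemma coeff_monic_poly: "coeff (\<Sum>j\<le>t i. monom (monic_coeff t i j) j) k = monic_coeff t i k"
  by (simp add: coeff_sum_monom monic_coeff_def)

lemma coeff_monic_poly_fun: "coeff (\<Sum>j\<le>t i. monom (monic_coeff t i j) j) = monic_coeff t i"
  by (rule ext) (rule coeff_monic_poly)

text \<open>Up to order \<open>m\<close> the truncation of the power series is invisible.\<close>

lemma weierstrass_coeff_eq:
  assumes "j \<le> m"
  shows "weierstrass_coeff m t y i j = (\<Sum>l\<le>j. monic_coeff t i l * mconst (y (i, t i + (j - l))))"
  unfolding weierstrass_coeff_def mult.commute[of "\<Sum>j\<le>m. _ j"] coeff_mult coeff_monic_poly coeff_sum_monom
  using assms by (intro sum.cong) auto

section \<open>Specialization to the algebra of factorizations\<close>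

context jet_setup begin

context
  fixes y :: "nat \<times> nat \<Rightarrow> 'k::field_char_0"
  assumes y: "\<And>v. y v \<noteq> 0"
begin

abbreviation "X \<equiv> weierstrass_coeff m t y"

lemma monic_coeff_in: "i \<in> {1..r} \<Longrightarrow> monic_coeff t i j \<in> C"
  by (auto simp: monic_coeff_def subring_setD[OF subring_mpolys] low_vars_def intro!: var_in_mpolys)

lemma X_in: "i \<in> {1..r} \<Longrightarrow> X i j \<in> C"
  unfolding weierstrass_coeff_def coeff_mult coeff_monic_poly coeff_sum_monom
  by (intro subring_set_sum subring_mpolys subring_setD[OF subring_mpolys])
     (auto intro: monic_coeff_in subring_setD[OF subring_mpolys])

lemma specialize_hom:
  "specialize m r t y (p + q) = specialize m r t y p + specialize m r t y q"
  "specialize m r t y (p * q) = specialize m r t y p * specialize m r t y q"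
  "specialize m r t y 0 = 0" "specialize m r t y 1 = 1"
  unfolding specialize_def
  by (simp_all add: coeff_hom.psubst_add[OF coeff_hom_mconst] coeff_hom.psubst_mult[OF coeff_hom_mconst]
      coeff_hom.psubst_0[OF coeff_hom_mconst] coeff_hom.psubst_1[OF coeff_hom_mconst])

lemma specialize_in: "specialize m r t y p \<in> C"
  unfolding specialize_def
proof (rule coeff_hom.psubst_in[OF coeff_hom_mconst subring_mpolys, where V = UNIV])
  show "p \<in> mpolys UNIV" by (simp add: mpolys_def)
  fix v :: "nat \<times> nat"
  show "(case v of (i, j) \<Rightarrow> if i \<in> {1..r} then X i j else mconst (y (i, j))) \<in> C"
    by (cases v) (simp add: X_in)
qed simp

lemma specialize_var: "i \<in> {1..r} \<Longrightarrow> specialize m r t y (var i j) = X i j"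
  by (simp add: specialize_def psubst_var[OF coeff_hom_mconst])

lemma specialize_jet_gen: "specialize m r t y (jet_gen r k) = prod_coeff r X k"
proof -
  have "specialize m r t y (jet_gen r k) = prod_coeff r (\<lambda>l j. specialize m r t y (var l j)) k"
    unfolding jet_gen_eq
    by (rule prod_coeff_hom)
       (simp_all add: specialize_def coeff_hom.psubst_sum[OF coeff_hom_mconst] coeff_hom.psubst_prod[OF coeff_hom_mconst])
  also have "\<dots> = prod_coeff r X k" by (rule prod_coeff_cong) (simp add: specialize_var)
  finally show ?thesis .
qed

lemma peval_X: "i \<in> {1..r} \<Longrightarrow> j \<le> m \<Longrightarrow> peval (\<lambda>_. 0) (X i j) = (if j < t i then 0 else y (i, j))"
proof -
  assume ij: "i \<in> {1..r}" "j \<le> m"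
  have "peval (\<lambda>_. 0) (X i j) = (\<Sum>l\<le>j. if l = t i then y (i, t i + (j - l)) else 0)"
    unfolding weierstrass_coeff_eq[OF ij(2)] peval_sum peval_mult
    by (intro sum.cong) (auto simp: monic_coeff_def psubst_var[OF coeff_hom_id] peval_1 peval_0)
  then show ?thesis by simp
qed

text \<open>At the origin w_i becomes T^(t i), which gives back the point with low order coordinates
  zero. So a polynomial nonzero there acquires a nonzero constant term.\<close>

lemma peval_specialize:
  assumes "p \<in> A"
  shows "peval (\<lambda>_. 0) (specialize m r t y p) = peval (\<lambda>v. if v \<in> low_vars r t then 0 else y v) p"
  unfolding specialize_def peval_psubst
proof (rule psubst_cong[OF assms])
  fix v assume "v \<in> jet_vars n m"
  then obtain i j where v: "v = (i, j)" "j \<le> m" by (auto simp: jet_vars_def)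
  show "peval (\<lambda>_. 0) (case v of (i, j) \<Rightarrow> if i \<in> {1..r} then X i j else mconst (y (i, j))) =
      (if v \<in> low_vars r t then 0 else y v)"
  proof (cases "i \<in> {1..r}")
    case True
    then show ?thesis using v by (simp add: peval_X low_vars_def)
  next
    case False
    then show ?thesis using v by (auto simp: low_vars_def)
  qed
qed

text \<open>The product of the series splits into that of the power series and that of the w_i, and
  up to order \<open>m\<close> every coefficient of the latter belongs to \<open>E\<close>.\<close>

lemma prod_coeff_X:
  assumes "k \<le> m" shows "prod_coeff r X k \<in> idl C E"
proof -
  let ?u = "\<lambda>i. \<Sum>j\<le>m. monom (mconst (y (i, t i + j)) :: 'k mpoly) j"
  let ?w = "\<lambda>i. \<Sum>j\<le>t i. monom (monic_coeff t i j :: 'k mpoly) j"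
  have "prod_coeff r X k = coeff (\<Prod>i=1..r. ?u i * ?w i) k"
    unfolding coeff_prod_eq_prod_coeff weierstrass_coeff_def ..
  also have "\<dots> = (\<Sum>j\<le>k. coeff (\<Prod>i=1..r. ?u i) j * coeff (\<Prod>i=1..r. ?w i) (k - j))"
    by (simp add: prod.distrib coeff_mult)
  also have "\<dots> = (\<Sum>j\<le>k. coeff (\<Prod>i=1..r. ?u i) j * prod_coeff r (monic_coeff t) (k - j))"
    by (simp only: coeff_prod_eq_prod_coeff coeff_monic_poly_fun)
  also have "\<dots> \<in> idl C E"
  proof (intro idl_sum idl_gen_mult)
    fix j assume "j \<in> {..k}"
    show "coeff (\<Prod>i=1..r. ?u i) j \<in> C"
      unfolding coeff_prod_eq_prod_coeff prod_coeff_def coeff_sum_monom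
      by (intro subring_set_sum subring_set_prod subring_mpolys) (auto intro: subring_setD[OF subring_mpolys])
    show "prod_coeff r (monic_coeff t) (k - j) \<in> E"
      using assms sum_t by (intro CollectI exI[of _ "k - j"]) auto
  qed
  finally show ?thesis .
qed

text \<open>The coefficients below order \<open>t i\<close> form a triangular linear system in the
  low order variables, with nonzero diagonal entry \<open>y (i, t i)\<close>.\<close>

lemma var_in_X_ideal:
  assumes "i \<in> {1..r}" "j < t i"
  shows "var i j \<in> idl C {X i l | l. l < t i}"
  using assms(2)
proof (induction j rule: less_induct)
  case (less j)
  let ?I = "idl C {X i l | l. l < t i}"
  let ?c = "y (i, t i)"
  have jm: "j \<le> m" using less.prems t_le[OF assms(1)] by simp
  have "X i j = (\<Sum>l<j. monic_coeff t i l * mconst (y (i, t i + (j - l)))) + var i j * mconst ?c"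
    unfolding weierstrass_coeff_eq[OF jm] using less.prems
    by (simp add: monic_coeff_def flip: lessThan_Suc_atMost)
  moreover have "(\<Sum>l<j. monic_coeff t i l * mconst (y (i, t i + (j - l)))) \<in> ?I"
  proof (rule idl_sum)
    fix l assume "l \<in> {..<j}"
    then have "mconst (y (i, t i + (j - l))) * var i l \<in> ?I"
      using less by (intro idl_mult subring_mpolys) auto
    then show "monic_coeff t i l * mconst (y (i, t i + (j - l))) \<in> ?I"
      using \<open>l \<in> {..<j}\<close> less.prems by (simp add: monic_coeff_def mult.commute)
  qed
  moreover have "X i j \<in> ?I" using less.prems by (intro idl_gen subring_mpolys) auto
  ultimately have "mconst ?c * var i j \<in> ?I"
    using idl_diff[OF subring_mpolys, of "X i j" _ _ "\<Sum>l<j. monic_coeff t i l * mconst (y (i, t i + (j - l)))"]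
    by (simp add: mult.commute)
  then have "mconst (inverse ?c) * (mconst ?c * var i j) \<in> ?I"
    by (rule idl_mult[OF subring_mpolys _ mconst_in_mpolys])
  moreover have "mconst (inverse ?c) * (mconst ?c * var i j) = var i j"
    by (simp add: mult.assoc[symmetric] mult_single y)
  ultimately show ?case by (simp only:)
qed

text \<open>The leading coefficient 1 of w_i contributes \<open>y (i, t i)\<close>, and all other
  terms contain a low order variable.\<close>

lemma X_unit_mod:
  assumes "i \<in> {1..r}" "t i \<le> m"
  shows "X i (t i) - mconst (y (i, t i)) \<in> idl C {X i l | l. l < t i}"
proof -
  have "X i (t i) - mconst (y (i, t i)) = (\<Sum>l<t i. mconst (y (i, t i + (t i - l))) * var i l)"
    unfolding weierstrass_coeff_eq[OF assms(2)]
    by (simp add: monic_coeff_def mult.commute flip: lessThan_Suc_atMost)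
  also have "\<dots> \<in> idl C {X i l | l. l < t i}"
    using var_in_X_ideal[OF assms(1)] by (intro idl_sum idl_mult subring_mpolys) auto
  finally show ?thesis .
qed

lemma filtration_units: "filtration C units (idl C (low_gens r t)) E (gens X)"
proof -
  interpret mult_subset C "units :: 'k mpoly set" by (rule mult_subset_units)
  have "filtration C units (idl C (low_gens r t)) (E \<union> {X i j | i j. i \<in> {1..r} \<and> j < (\<lambda>_. 0) i}) (gens X)"
  proof (rule filtration_filt_gens)
    show "idl C (low_gens r t) \<subseteq> idl C (E \<union> {X i j | i j. i \<in> {1..r} \<and> j < t i})"
    proof
      fix x :: "'k mpoly" assume x: "x \<in> idl C (low_gens r t)"
      show "x \<in> idl C (E \<union> {X i j | i j. i \<in> {1..r} \<and> j < t i})"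
      proof (rule idl_subset[OF subring x])
        fix g :: "'k mpoly" assume "g \<in> low_gens r t"
        then obtain i j where ij: "g = var i j" "i \<in> {1..r}" "j < t i" by (auto simp: low_gens_def)
        show "g \<in> idl C (E \<union> {X i j | i j. i \<in> {1..r} \<and> j < t i})"
          unfolding ij(1) by (rule idl_mono[OF subring var_in_X_ideal[OF ij(2,3)]]) (use ij in auto)
      qed
    qed
  next
    fix s assume s: "\<forall>i\<in>{1..r}. s i \<le> t i" "\<exists>i\<in>{1..r}. s i < t i"
    let ?Q = "E \<union> {X i j | i j. i \<in> {1..r} \<and> j < s i}"
    let ?k = "\<Sum>i=1..r. s i"
    have k: "?k \<le> m" by (rule sum_less[OF s])
    have si: "s i \<le> m" if "i \<in> {1..r}" for i using member_le_sum[of i "{1..r}" s] that k by simp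
    have "prod_coeff r X ?k - (\<Prod>i=1..r. X i (s i)) \<in> idl C {X i j | i j. i \<in> {1..r} \<and> j < s i}"
      by (rule prod_coeff_mod[OF subring]) (rule X_in)
    then have "prod_coeff r X ?k - (\<Prod>i=1..r. X i (s i)) \<in> idl C ?Q"
      by (rule idl_mono[OF subring]) auto
    moreover have "prod_coeff r X ?k \<in> idl C ?Q"
      by (rule idl_mono[OF subring prod_coeff_X[OF k]]) auto
    ultimately have "prod_coeff r X ?k - (prod_coeff r X ?k - (\<Prod>i=1..r. X i (s i))) \<in> idl C ?Q"
      by (rule idl_diff[OF subring, rotated])
    then have all: "(\<Prod>i=1..r. X i (s i)) \<in> idl C ?Q" by simp
    let ?T = "{i\<in>{1..r}. s i = t i}"
    let ?q = "\<Prod>i\<in>?T. mconst (y (i, t i)) :: 'k mpoly"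
    let ?p = "\<Prod>i\<in>{i\<in>{1..r}. s i < t i}. X i (s i)"
    \<comment> \<open>Only constants are inverted in \<open>C\<close>. The factors with
      \<open>s i = t i\<close> are congruent to constants, since for those i all
      \<open>X i l\<close> with \<open>l < t i\<close> already belong to the ideal.\<close>
    have "(\<Prod>i\<in>?T. X i (t i)) - ?q \<in> idl C ?Q"
    proof (rule prod_mod_idl[OF subring])
      fix i assume "i \<in> ?T"
      then have i: "i \<in> {1..r}" "s i = t i" by auto
      show "X i (t i) - mconst (y (i, t i)) \<in> idl C ?Q"
      proof (rule idl_mono[OF subring X_unit_mod])
        show "{X i l | l. l < t i} \<subseteq> ?Q" unfolding i(2)[symmetric] using i(1) by blast
      qed (use i si[of i] in auto)
    qed (auto intro: X_in)
    then have "?p * ((\<Prod>i\<in>?T. X i (t i)) - ?q) \<in> idl C ?Q"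
      by (rule idl_mult[OF subring]) (auto intro!: subring_set_prod subring X_in)
    then have "(\<Prod>i\<in>?T. X i (t i)) * ?p - ?p * ((\<Prod>i\<in>?T. X i (t i)) - ?q) \<in> idl C ?Q"
      using all unfolding split_prod[OF s(1)] by (rule idl_diff[OF subring, rotated])
    then have "?q * ?p \<in> idl C ?Q" by (simp add: algebra_simps)
    moreover have "?q \<in> units"
    proof -
      have "?q = mconst (\<Prod>i\<in>?T. y (i, t i))"
        by (rule mconst_prod[symmetric])
      then show ?thesis using y by auto
    qed
    ultimately show "\<exists>q\<in>units. q * ?p \<in> idl C ?Q" by blast
  qed (use sum_t X_in in auto)
  then show ?thesis by simp
qed

end

text \<open>A failing step is specialized to the algebra of factorizations. There the corresponding
  generator becomes redundant, and the shortened list is too short to span.\<close>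

lemma gens_strict:
  fixes q :: "'k::field_char_0 mpoly"
  notes filt_gens.simps(2) [simp del]
  assumes i: "i < length (gens var :: 'k mpoly list)" and q: "q \<in> S"
  shows "q * gens var ! i \<notin> idl A (J \<union> set (drop (Suc i) (gens var)))"
proof
  let ?bs = "gens var :: 'k mpoly list"
  assume mem: "q * ?bs ! i \<in> idl A (J \<union> set (drop (Suc i) ?bs))"
  obtain y where y: "\<And>v. y v \<noteq> 0" "peval (\<lambda>v. if v \<in> low_vars r t then 0 else y v) q \<noteq> 0"
    using low_point[of "{q}"] q by auto
  let ?\<phi> = "specialize m r t y"
  let ?X = "weierstrass_coeff m t y"
  let ?cs = "gens ?X"
  let ?I = "idl C (E \<union> set (drop (Suc i) ?cs))"
  interpret U: mult_subset C "units :: 'k mpoly set" by (rule mult_subset_units)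
  have cs: "?cs = map ?\<phi> ?bs"
  proof -
    have "map ?\<phi> ?bs = gens (\<lambda>i j. ?\<phi> (var i j))"
      by (rule map_filt_gens) (simp_all add: specialize_hom[OF y(1)])
    also have "\<dots> = ?cs" by (rule filt_gens_cong) (simp add: specialize_var[OF y(1)])
    finally show ?thesis ..
  qed
  have ic: "i < length ?cs" using i by (simp only: cs length_map)
  have "?\<phi> (q * ?bs ! i) \<in> ?I"
    using mem
  proof (rule idl_hom)
    fix g assume "g \<in> J \<union> set (drop (Suc i) ?bs)"
    then show "?\<phi> g \<in> ?I"
    proof
      assume "g \<in> J"
      then obtain k where k: "k \<le> m" "g = jet_gen r k" by auto
      show ?thesis unfolding k(2) specialize_jet_gen[OF y(1)]
        by (rule idl_mono[OF U.subring prod_coeff_X[OF y(1) k(1)]]) simp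
    next
      assume "g \<in> set (drop (Suc i) ?bs)"
      then have "?\<phi> g \<in> set (drop (Suc i) ?cs)" unfolding cs drop_map set_map by (rule imageI)
      then show ?thesis by (intro idl_gen[OF U.subring]) (rule UnI2)
    qed
  qed (simp_all add: specialize_hom[OF y(1)] specialize_in[OF y(1)] U.subring)
  then have 1: "?\<phi> q * ?cs ! i \<in> ?I" unfolding cs nth_map[OF i] specialize_hom[OF y(1)] .
  define c0 where "c0 = peval (\<lambda>_. 0) (?\<phi> q)"
  have c0: "c0 \<noteq> 0" using y(2) q by (simp add: c0_def peval_specialize[OF y(1)])
  have split: "take i ?cs @ ?cs ! i # drop (Suc i) ?cs = ?cs" using ic by (simp flip: id_take_nth_drop)
  have filt: "filtration C units (idl C (low_gens r t)) E (take i ?cs @ ?cs ! i # drop (Suc i) ?cs)"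
    unfolding split by (rule filtration_units[OF y(1)])
  \<comment> \<open>This difference annihilates the i-th quotient, on which \<open>q\<close>
    therefore acts as the nonzero constant \<open>c0\<close>.\<close>
  have "?\<phi> q - mconst c0 \<in> idl C (low_gens r t)"
    unfolding c0_def by (rule sub_const_in_low_ideal[OF specialize_in[OF y(1)]])
  then obtain a where "a \<noteq> 0" "mconst a * ((?\<phi> q - mconst c0) * ?cs ! i) \<in> ?I"
    using U.filt_steps_split[of "idl C (low_gens r t)" E "take i ?cs" "?cs ! i" "drop (Suc i) ?cs"] filt
    unfolding filtration_def by blast
  then have "(?\<phi> q - mconst c0) * ?cs ! i \<in> ?I" by (rule mconst_cancel[rotated])
  with 1 have "?\<phi> q * ?cs ! i - (?\<phi> q - mconst c0) * ?cs ! i \<in> ?I" by (rule idl_diff[OF U.subring])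
  then have "mconst c0 * ?cs ! i \<in> ?I" by (simp add: algebra_simps)
  then have filt': "filtration C units (idl C (low_gens r t)) E (take i ?cs @ drop (Suc i) ?cs)"
    using c0 by (intro U.filtration_drop[OF filt, of "mconst c0"]) auto
  let ?B = "set (take i ?cs @ drop (Suc i) ?cs)"
  have "fact (\<Sum>i=1..r. t i) \<le> card ?B * (\<Prod>i=1..r. fact (t i))"
    by (rule multinomial_le_card_spanning_set[OF finite_set filtration_span[OF filt']])
  also have "\<dots> \<le> (length ?cs - 1) * (\<Prod>i=1..r. fact (t i))"
    using card_length[of "take i ?cs @ drop (Suc i) ?cs"] ic by (intro mult_right_mono) auto
  also have "\<dots> < length ?cs * (\<Prod>i=1..r. fact (t i))"
    using ic by (intro mult_strict_right_mono) (auto intro: prod_pos)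
  also have "\<dots> = fact (\<Sum>i=1..r. t i)" using length_gens[of ?X] sum_t by simp
  finally show False by simp
qed

lemma gens_in_A: "set (gens var) \<subseteq> (A :: 'k::field mpoly set)"
  by (rule filt_gens_in[OF subring_mpolys]) (use t_le in \<open>force intro: var_in_A\<close>)

lemma J_in_A: "J \<subseteq> (A :: 'k::field mpoly set)"
proof clarify
  fix k assume k: "k \<le> m"
  have "var l (f l) \<in> A" if "f \<in> {1..r} \<rightarrow>\<^sub>E {0..k}" "l \<in> {1..r}" for f l
    using that k by (intro var_in_A) (auto simp: PiE_def Pi_def intro: le_trans)
  then show "(jet_gen r k :: 'k mpoly) \<in> A"
    unfolding jet_gen_def by (intro subring_set_sum subring_set_prod subring_mpolys) auto
qed

text \<open>The filtration bounds all chains and, being strict, provides one of maximal length;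
  shorter ones come from truncation. The division is exact by \<open>length_gens\<close>.\<close>

theorem sat_chain_iff:
  "(\<exists>I. (\<forall>i\<le>d. sat_ideal A S (J :: 'k::field_char_0 mpoly set) (I i)) \<and> (\<forall>i<d. I i \<subset> I (Suc i)))
    \<longleftrightarrow> d \<le> fact (m + 1) div (\<Prod>i=1..r. fact (t i))" (is "?chain d \<longleftrightarrow> _")
proof -
  let ?bs = "gens var :: 'k mpoly list"
  interpret mult_subset A "S :: 'k mpoly set" by (rule mult_subset_S)
  have len: "fact (m + 1) div (\<Prod>i=1..r. fact (t i)) = length ?bs"
    unfolding length_gens[of "var :: nat \<Rightarrow> nat \<Rightarrow> 'k mpoly", symmetric] by (rule nonzero_mult_div_cancel_right) (simp add: prod_zero_iff)
  have "d \<le> length ?bs" if "?chain d"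
    using that chain_length_le[OF filtration_S _ gens_in_A] by blast
  moreover have "?chain d" if "d \<le> length ?bs"
  proof -
    have "?chain (length ?bs)"
      by (rule chain_exists[OF J_in_A gens_in_A gens_strict])
    then obtain I :: "nat \<Rightarrow> 'k mpoly set"
      where I: "\<forall>i\<le>length ?bs. sat_ideal A S J (I i)" "\<forall>i<length ?bs. I i \<subset> I (Suc i)"
      by (elim exE conjE)
    show ?thesis using I that by (intro exI[of _ I]) (meson le_trans less_le_trans)
  qed
  ultimately show ?thesis unfolding len by blast
qed

end

section \<open>Localization\<close>

lemma (in cring) idealI_mult_closed:
  assumes "I \<subseteq> carrier R" "\<zero> \<in> I" "\<And>a b. a \<in> I \<Longrightarrow> b \<in> I \<Longrightarrow> a \<oplus> b \<in> I"
    and mult: "\<And>a x. a \<in> I \<Longrightarrow> x \<in> carrier R \<Longrightarrow> x \<otimes> a \<in> I"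
  shows "ideal I R"
proof (rule idealI)
  show "subgroup I (add_monoid R)"
  proof (rule add.subgroupI)
    show "\<ominus> a \<in> I" if "a \<in> I" for a
    proof -
      have "a \<in> carrier R" using that assms by auto
      then have "(\<ominus> \<one>) \<otimes> a = \<ominus> a" by (simp add: l_minus)
      then show ?thesis using mult[OF that, of "\<ominus> \<one>"] by simp
    qed
  qed (use assms in auto)
  show "a \<otimes> x \<in> I" if "a \<in> I" "x \<in> carrier R" for a x
    using mult[OF that] that assms(1) by (simp add: m_comm subset_iff)
qed (use ring_axioms mult in auto)

text \<open>A bridge from subsets of a ring type to structures with a carrier; the jet ring is
  literally of this form.\<close>

definition class_ring :: "'a::comm_ring_1 set \<Rightarrow> 'a ring" where
  "class_ring A = \<lparr> carrier = A, monoid.mult = (*), one = 1, zero = 0, add = (+) \<rparr>"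

lemma class_ring_simps [simp]:
  "carrier (class_ring A) = A" "x \<otimes>\<^bsub>class_ring A\<^esub> y = x * y" "\<one>\<^bsub>class_ring A\<^esub> = 1"
  "\<zero>\<^bsub>class_ring A\<^esub> = 0" "x \<oplus>\<^bsub>class_ring A\<^esub> y = x + y"
  by (simp_all add: class_ring_def)

lemma cring_class_ring:
  assumes "subring_set A" shows "cring (class_ring A)"
proof (rule cringI)
  show "abelian_group (class_ring A)"
    by (rule abelian_groupI)
       (auto intro: subring_setD[OF assms] simp: algebra_simps intro!: bexI[of _ "- x" A for x])
  show "comm_monoid (class_ring A)"
    by (rule comm_monoidI) (auto intro: subring_setD[OF assms] simp: algebra_simps)
qed (simp add: algebra_simps)

lemma a_minus_class_ring:
  assumes "subring_set A" "x \<in> A" "y \<in> A" shows "x \<ominus>\<^bsub>class_ring A\<^esub> y = x - y"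
proof -
  interpret cring "class_ring A" by (rule cring_class_ring[OF assms(1)])
  have "\<ominus>\<^bsub>class_ring A\<^esub> y = - y"
    using minus_equality[of "- y" y] assms subring_setD(3)[OF assms(1)] by simp
  then show ?thesis by (simp add: a_minus_def)
qed

lemma genideal_class_ring:
  assumes A: "subring_set A" and G: "G \<subseteq> A" shows "genideal (class_ring A) G = idl A G"
proof -
  interpret cring "class_ring A" by (rule cring_class_ring[OF A])
  have "ideal (idl A G) (class_ring A)"
    using idl_carrier[OF A G]
    by (intro idealI_mult_closed) (auto intro: idl.zero idl_add idl_mult[OF A])
  then have "genideal (class_ring A) G \<subseteq> idl A G"
    by (rule genideal_minimal) (auto intro: idl_gen[OF A])
  moreover have "idl A G \<subseteq> genideal (class_ring A) G"
  proof
    interpret I: ideal "genideal (class_ring A) G" "class_ring A"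
      using G by (intro genideal_ideal) simp
    fix x assume "x \<in> idl A G"
    then show "x \<in> genideal (class_ring A) G"
    proof induction
      case zero
      show ?case using I.zero_closed by simp
    next
      case (step x c g)
      have "g \<in> genideal (class_ring A) G" using genideal_self[of G] G step(3) by auto
      then have "c * g \<in> genideal (class_ring A) G" using I.I_l_closed[of g c] step(2) by simp
      then show ?case using I.a_closed[OF step.IH] by simp
    qed
  qed
  ultimately show ?thesis by blast
qed

text \<open>A ring in which \<open>S\<close> becomes invertible and every element is a fraction. The
  localization and its quotient are both instances, so the comparison of ideals is done
  once.\<close>

locale fraction_hom = mult_subset A S + cring Q
  for A S :: "'a::comm_ring_1 set" and Q :: "('c, 'd) ring_scheme" (structure) +
  fixes \<psi> :: "'a \<Rightarrow> 'c"
  assumes psi_closed: "x \<in> A \<Longrightarrow> \<psi> x \<in> carrier Q"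
    and psi_add: "x \<in> A \<Longrightarrow> y \<in> A \<Longrightarrow> \<psi> (x + y) = \<psi> x \<oplus> \<psi> y"
    and psi_mult: "x \<in> A \<Longrightarrow> y \<in> A \<Longrightarrow> \<psi> (x * y) = \<psi> x \<otimes> \<psi> y"
    and psi_one: "\<psi> 1 = \<one>"
    and psi_unit: "s \<in> S \<Longrightarrow> \<exists>w\<in>carrier Q. \<psi> s \<otimes> w = \<one>"
    and psi_frac: "q \<in> carrier Q \<Longrightarrow> \<exists>x\<in>A. \<exists>s\<in>S. q \<otimes> \<psi> s = \<psi> x"
begin

lemma psi_zero: "\<psi> 0 = \<zero>"
proof -
  have "\<psi> 0 \<oplus> \<psi> 0 = \<zero> \<oplus> \<psi> 0"
    using psi_add[of 0 0] A_closed(1) psi_closed[of 0] by simp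
  then show ?thesis using psi_closed[of 0] A_closed(1) by (simp only: add.right_cancel zero_closed)
qed

lemma psi_cancel:
  assumes "ideal I Q" "s \<in> S" "q \<in> carrier Q" "q \<otimes> \<psi> s \<in> I" shows "q \<in> I"
proof -
  interpret I: ideal I Q by fact
  obtain w where w: "w \<in> carrier Q" "\<psi> s \<otimes> w = \<one>" using psi_unit assms by blast
  have "(q \<otimes> \<psi> s) \<otimes> w \<in> I" by (rule I.I_r_closed[OF assms(4) w(1)])
  also have "(q \<otimes> \<psi> s) \<otimes> w = q" using w assms psi_closed S_A by (simp add: m_assoc)
  finally show ?thesis .
qed

definition contraction where "contraction I = {x \<in> A. \<psi> x \<in> I}"

definition extension where
  "extension K = {q \<in> carrier Q. \<exists>x\<in>K. \<exists>s\<in>S. q \<otimes> \<psi> s = \<psi> x}"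

lemma extensionI:
  "q \<in> carrier Q \<Longrightarrow> x \<in> K \<Longrightarrow> s \<in> S \<Longrightarrow> q \<otimes> \<psi> s = \<psi> x \<Longrightarrow> q \<in> extension K"
  unfolding extension_def by blast

lemma sat_ideal_contraction:
  assumes I: "ideal I Q" and G: "G \<subseteq> A" "\<And>x. x \<in> G \<Longrightarrow> \<psi> x = \<zero>"
  shows "sat_ideal A S G (contraction I)"
proof -
  interpret I: ideal I Q by fact
  show ?thesis unfolding sat_ideal_def contraction_def
  proof (intro conjI ballI impI; (elim CollectE conjE)?)
    show "0 \<in> {x \<in> A. \<psi> x \<in> I}" using A_closed(1) psi_zero I.zero_closed by simp
    show "G \<subseteq> {x \<in> A. \<psi> x \<in> I}" using G I.zero_closed by auto
    fix x y assume "x \<in> A" "\<psi> x \<in> I" "y \<in> A" "\<psi> y \<in> I"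
    then show "x + y \<in> {x \<in> A. \<psi> x \<in> I}" using A_closed(4) psi_add I.a_closed by simp
  next
    fix a x assume "a \<in> A" "x \<in> A" "\<psi> x \<in> I"
    then show "a * x \<in> {x \<in> A. \<psi> x \<in> I}" using A_closed(5) psi_mult psi_closed I.I_l_closed by simp
  next
    fix x q assume x: "x \<in> A" "q \<in> S" "\<psi> (q * x) \<in> I"
    then have "\<psi> x \<otimes> \<psi> q \<in> I" using psi_mult S_A psi_closed by (simp add: m_comm)
    then show "x \<in> {x \<in> A. \<psi> x \<in> I}" using psi_cancel[OF I] x psi_closed by blast
  qed blast
qed

lemma contraction_strict:
  assumes I: "ideal I Q" and I': "ideal I' Q" and "I \<subset> I'" shows "contraction I \<subset> contraction I'"
proof -
  interpret I': ideal I' Q by fact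
  obtain q where q: "q \<in> I'" "q \<notin> I" using assms by blast
  then have qQ: "q \<in> carrier Q" using I'.a_subset by blast
  obtain x s where x: "x \<in> A" "s \<in> S" "q \<otimes> \<psi> s = \<psi> x" using psi_frac[OF qQ] by blast
  have "\<psi> x \<in> I'" using I'.I_r_closed[OF q(1), of "\<psi> s"] x psi_closed S_A by simp
  moreover have "\<psi> x \<notin> I" using psi_cancel[OF I x(2) qQ] q x by auto
  ultimately show ?thesis using x assms(3) unfolding contraction_def by blast
qed

lemma ideal_extension:
  assumes K: "K \<subseteq> A" "0 \<in> K" "\<And>x y. x \<in> K \<Longrightarrow> y \<in> K \<Longrightarrow> x + y \<in> K"
    "\<And>a x. a \<in> A \<Longrightarrow> x \<in> K \<Longrightarrow> a * x \<in> K"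
  shows "ideal (extension K) Q"
proof (rule idealI_mult_closed)
  show "\<zero> \<in> extension K"
  proof -
    have "\<zero> \<otimes> \<psi> 1 = \<psi> 0" using psi_zero psi_one by simp
    then show ?thesis unfolding extension_def using K(2) S_one by blast
  qed
next
  fix a b assume "a \<in> extension K" "b \<in> extension K"
  then obtain x s y u where x: "a \<in> carrier Q" "x \<in> K" "s \<in> S" "a \<otimes> \<psi> s = \<psi> x"
    and y: "b \<in> carrier Q" "y \<in> K" "u \<in> S" "b \<otimes> \<psi> u = \<psi> y" by (auto simp: extension_def)
  have A: "x \<in> A" "y \<in> A" "s \<in> A" "u \<in> A" using x y K S_A by auto
  have "(a \<oplus> b) \<otimes> \<psi> (s * u) = \<psi> u \<otimes> (a \<otimes> \<psi> s) \<oplus> \<psi> s \<otimes> (b \<otimes> \<psi> u)"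
    using x(1) y(1) A psi_closed by (simp add: psi_mult l_distr r_distr m_ac)
  also have "\<dots> = \<psi> (u * x + s * y)" using A A_closed(5) by (simp add: x y psi_mult psi_add)
  finally show "a \<oplus> b \<in> extension K"
    by (rule extensionI[rotated 3])
       (use x(1) y(1) in \<open>auto intro!: K(3,4) S_mult A x(2,3) y(2,3)\<close>)
next
  fix a q assume "a \<in> extension K" and q: "q \<in> carrier Q"
  then obtain x s where x: "a \<in> carrier Q" "x \<in> K" "s \<in> S" "a \<otimes> \<psi> s = \<psi> x" by (auto simp: extension_def)
  obtain y u where y: "y \<in> A" "u \<in> S" "q \<otimes> \<psi> u = \<psi> y" using psi_frac[OF q] by blast
  have A: "x \<in> A" "s \<in> A" "u \<in> A" using x y K S_A by auto
  have "(q \<otimes> a) \<otimes> \<psi> (u * s) = (q \<otimes> \<psi> u) \<otimes> (a \<otimes> \<psi> s)"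
    using x(1) q A psi_closed by (simp add: psi_mult m_ac)
  also have "\<dots> = \<psi> (y * x)" using A y by (simp add: x y psi_mult)
  finally show "q \<otimes> a \<in> extension K"
    by (rule extensionI[rotated 3])
       (use x(1) q in \<open>auto intro!: K(4) S_mult x(2,3) y(1,2)\<close>)
qed (auto simp: extension_def)

text \<open>If \<open>\<psi> x\<close> came from \<open>K\<close>, some \<open>s * x - y\<close>
  with y in \<open>K\<close> would lie in the kernel; by \<open>ker\<close> a multiple of it is in
  the ideal of \<open>G\<close>, hence in \<open>K\<close>, and saturation puts \<open>x\<close>
  into \<open>K\<close>.\<close>

lemma extension_strict:
  assumes K: "sat_ideal A S G K" and K': "sat_ideal A S G K'" and sub: "K \<subset> K'"
    and ker: "\<And>x. x \<in> A \<Longrightarrow> \<psi> x = \<zero> \<Longrightarrow> \<exists>s\<in>S. s * x \<in> idl A G"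
  shows "extension K \<subset> extension K'"
proof -
  obtain x where x: "x \<in> K'" "x \<notin> K" using sub by blast
  have xA: "x \<in> A" using x K' by (auto simp: sat_ideal_def)
  have sat: "s * x \<in> K \<Longrightarrow> s \<in> S \<Longrightarrow> x \<in> K" for s using K xA unfolding sat_ideal_def by blast
  have "\<psi> x \<in> extension K'"
  proof -
    have "\<psi> x \<otimes> \<psi> 1 = \<psi> x" using psi_one psi_closed[OF xA] by simp
    then show ?thesis unfolding extension_def using x(1) psi_closed[OF xA] S_one by blast
  qed
  moreover have "\<psi> x \<notin> extension K"
  proof
    assume "\<psi> x \<in> extension K"
    then obtain y s where y: "y \<in> K" "s \<in> S" "\<psi> x \<otimes> \<psi> s = \<psi> y" by (auto simp: extension_def)
    have A: "y \<in> A" "s \<in> A" using y K S_A by (auto simp: sat_ideal_def)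
    have "\<psi> (s * x - y) \<oplus> \<psi> y = \<psi> (s * x)"
      using psi_add[of "s * x - y" y] A xA A_closed(5,6) by simp
    also have "\<dots> = \<zero> \<oplus> \<psi> y"
      using A xA y(3) psi_closed by (simp add: psi_mult m_comm)
    finally have "\<psi> (s * x - y) \<oplus> \<psi> y = \<zero> \<oplus> \<psi> y" .
    then have "\<psi> (s * x - y) = \<zero>"
      using A xA A_closed(5,6) psi_closed by (simp only: add.right_cancel zero_closed)
    then obtain u where u: "u \<in> S" "u * (s * x - y) \<in> idl A G"
      using ker[of "s * x - y"] A xA A_closed(5,6) by blast
    have "u * (s * x - y) \<in> K" by (rule sat_ideal_idl[OF K u(2)])
    moreover have "u * y \<in> K" using K y u S_A unfolding sat_ideal_def by blast
    ultimately have "u * (s * x - y) + u * y \<in> K" using K unfolding sat_ideal_def by blast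
    then have "(u * s) * x \<in> K" by (simp add: algebra_simps)
    then show False using sat S_mult u y x by blast
  qed
  moreover have "extension K \<subseteq> extension K'" using sub unfolding extension_def by blast
  ultimately show ?thesis by blast
qed

text \<open>Contraction and extension both preserve strict inclusions, which is all that a
  comparison of chains requires.\<close>

lemma ideal_chain_iff:
  assumes G: "G \<subseteq> A" "\<And>x. x \<in> G \<Longrightarrow> \<psi> x = \<zero>"
    and ker: "\<And>x. x \<in> A \<Longrightarrow> \<psi> x = \<zero> \<Longrightarrow> \<exists>s\<in>S. s * x \<in> idl A G"
  shows "(\<exists>I. (\<forall>i\<le>d. ideal (I i) Q) \<and> (\<forall>i<d. I i \<subset> I (Suc i))) \<longleftrightarrow>
    (\<exists>K. (\<forall>i\<le>d::nat. sat_ideal A S G (K i)) \<and> (\<forall>i<d. K i \<subset> K (Suc i)))" (is "?L \<longleftrightarrow> ?R")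
proof
  assume ?L
  then obtain I where I: "\<And>i. i \<le> d \<Longrightarrow> ideal (I i) Q" "\<And>i. i < d \<Longrightarrow> I i \<subset> I (Suc i)" by blast
  show ?R
  proof (intro exI[of _ "\<lambda>i. contraction (I i)"] conjI allI impI)
    show "sat_ideal A S G (contraction (I i))" if "i \<le> d" for i
      by (rule sat_ideal_contraction[OF I(1)[OF that] G])
    show "contraction (I i) \<subset> contraction (I (Suc i))" if "i < d" for i
      by (rule contraction_strict[OF I(1) I(1) I(2)]) (use that in auto)
  qed
next
  assume ?R
  then obtain K where K: "\<And>i. i \<le> d \<Longrightarrow> sat_ideal A S G (K i)" "\<And>i. i < d \<Longrightarrow> K i \<subset> K (Suc i)" by blast
  show ?L
  proof (intro exI[of _ "\<lambda>i. extension (K i)"] conjI allI impI)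
    show "ideal (extension (K i)) Q" if "i \<le> d" for i
      using K(1)[OF that] by (intro ideal_extension) (auto simp: sat_ideal_def)
    show "extension (K i) \<subset> extension (K (Suc i))" if "i < d" for i
      by (rule extension_strict[OF K(1) K(1) K(2) ker]) (use that in auto)
  qed
qed

end

section \<open>The localization as a ring of fractions\<close>

context mult_subset begin

abbreviation (input) T where "T \<equiv> localization (class_ring A) S"
abbreviation (input) frac where "frac \<equiv> loc_cls (class_ring A) S"

lemma loc_rel_iff:
  "((a, s), (b, u)) \<in> loc_rel (class_ring A) S \<longleftrightarrow>
     a \<in> A \<and> s \<in> S \<and> b \<in> A \<and> u \<in> S \<and> (\<exists>v\<in>S. v * (a * u - b * s) = 0)"
proof -
  have "(a * u) \<ominus>\<^bsub>class_ring A\<^esub> (b * s) = a * u - b * s" if "a \<in> A" "s \<in> S" "b \<in> A" "u \<in> S"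
    using that S_A A_closed(5) by (intro a_minus_class_ring[OF subring]) auto
  then show ?thesis by (auto simp: loc_rel_def)
qed

lemma equiv_loc_rel: "equiv (A \<times> S) (loc_rel (class_ring A) S)"
proof (rule equivI)
  show "loc_rel (class_ring A) S \<subseteq> (A \<times> S) \<times> A \<times> S" by (auto simp: loc_rel_iff)
  show "refl_on (A \<times> S) (loc_rel (class_ring A) S)"
    using S_one by (auto simp: refl_on_def loc_rel_iff intro!: bexI[of _ 1])
  show "sym (loc_rel (class_ring A) S)"
  proof (rule symI, clarify)
    fix a s b u assume "((a, s), (b, u)) \<in> loc_rel (class_ring A) S"
    then obtain v where v: "a \<in> A" "s \<in> S" "b \<in> A" "u \<in> S" "v \<in> S" "v * (a * u - b * s) = 0"
      by (auto simp: loc_rel_iff)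
    have "v * (b * s - a * u) = - (v * (a * u - b * s))" by (simp add: algebra_simps)
    then show "((b, u), (a, s)) \<in> loc_rel (class_ring A) S" using v by (auto simp: loc_rel_iff)
  qed
  show "trans (loc_rel (class_ring A) S)"
  proof (rule transI, clarify)
    fix a s b u c w
    assume "((a, s), (b, u)) \<in> loc_rel (class_ring A) S" "((b, u), (c, w)) \<in> loc_rel (class_ring A) S"
    then obtain v v' where v: "a \<in> A" "s \<in> S" "c \<in> A" "w \<in> S" "u \<in> S" "v \<in> S" "v' \<in> S"
      "v * (a * u - b * s) = 0" "v' * (b * w - c * u) = 0"
      by (auto simp: loc_rel_iff)
    \<comment> \<open>The middle denominator \<open>u\<close> enters the multiplier, because the two
      relations combine only over it.\<close>
    have "(v * v' * u) * (a * w - c * s) = v' * w * (v * (a * u - b * s)) + v * s * (v' * (b * w - c * u))"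
      by (simp add: algebra_simps)
    also have "\<dots> = 0" using v by simp
    finally show "((a, s), (c, w)) \<in> loc_rel (class_ring A) S"
      using v S_mult unfolding loc_rel_iff by blast
  qed
qed

lemma frac_eq_iff:
  assumes "a \<in> A" "s \<in> S" "b \<in> A" "u \<in> S"
  shows "frac a s = frac b u \<longleftrightarrow> (\<exists>v\<in>S. v * (a * u - b * s) = 0)"
  unfolding loc_cls_def using eq_equiv_class_iff[OF equiv_loc_rel, of "(a, s)" "(b, u)"] assms
  by (simp add: loc_rel_iff)

lemma frac_eqI:
  assumes "a \<in> A" "s \<in> S" "b \<in> A" "u \<in> S" "a * u = b * s" shows "frac a s = frac b u"
  using frac_eq_iff[OF assms(1-4)] assms(5) S_one by auto

lemma frac_memD:
  assumes "(b, u) \<in> frac a s" "a \<in> A" "s \<in> S"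
  shows "b \<in> A" "u \<in> S" "frac b u = frac a s"
proof -
  have r: "((a, s), (b, u)) \<in> loc_rel (class_ring A) S" using assms by (simp add: loc_cls_def)
  then show "b \<in> A" "u \<in> S" by (auto simp: loc_rel_iff)
  show "frac b u = frac a s" unfolding loc_cls_def by (rule equiv_class_eq[OF equiv_loc_rel r, symmetric])
qed

lemma frac_self: "a \<in> A \<Longrightarrow> s \<in> S \<Longrightarrow> (a, s) \<in> frac a s"
  unfolding loc_cls_def by (rule equiv_class_self[OF equiv_loc_rel]) simp

lemma frac_carrierE:
  assumes "q \<in> carrier T" obtains a s where "a \<in> A" "s \<in> S" "q = frac a s"
  using assms unfolding localization_def loc_cls_def by (auto elim!: quotientE)

lemma frac_in_carrier: "a \<in> A \<Longrightarrow> s \<in> S \<Longrightarrow> frac a s \<in> carrier T"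
  unfolding localization_def loc_cls_def by (auto intro: quotientI)

text \<open>The ring operations are unions over all representatives; independence of the
  representatives collapses such a union to one class.\<close>

lemma UN_frac2:
  assumes "a \<in> A" "s \<in> S" "b \<in> A" "u \<in> S"
    and "\<And>a' s' b' u'. (a', s') \<in> frac a s \<Longrightarrow> (b', u') \<in> frac b u \<Longrightarrow> h a' s' b' u' = h a s b u"
  shows "(\<Union>(a', s')\<in>frac a s. \<Union>(b', u')\<in>frac b u. h a' s' b' u') = h a s b u"
  using assms(5) frac_self[OF assms(1,2)] frac_self[OF assms(3,4)] by blast

lemma frac_mult:
  assumes "a \<in> A" "s \<in> S" "b \<in> A" "u \<in> S"
  shows "frac a s \<otimes>\<^bsub>T\<^esub> frac b u = frac (a * b) (s * u)"
proof -
  have "frac (a' * b') (s' * u') = frac (a * b) (s * u)"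
    if m: "(a', s') \<in> frac a s" "(b', u') \<in> frac b u" for a' s' b' u'
  proof -
    note m1 = frac_memD[OF m(1) assms(1,2)] and m2 = frac_memD[OF m(2) assms(3,4)]
    obtain v v' where v: "v \<in> S" "v * (a' * s - a * s') = 0" "v' \<in> S" "v' * (b' * u - b * u') = 0"
      using m1 m2 assms frac_eq_iff by metis
    have "(v * v') * ((a' * b') * (s * u) - (a * b) * (s' * u')) =
        v' * b' * u * (v * (a' * s - a * s')) + v * a * s' * (v' * (b' * u - b * u'))"
      by (simp add: algebra_simps)
    also have "\<dots> = 0" using v by simp
    finally have "\<exists>w\<in>S. w * ((a' * b') * (s * u) - (a * b) * (s' * u')) = 0" using v S_mult by blast
    then show ?thesis using m1 m2 assms by (subst frac_eq_iff) (auto intro: A_closed(5) S_mult)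
  qed
  then show ?thesis
    using UN_frac2[OF assms, of "\<lambda>a s b u. frac (a * b) (s * u)"] by (simp add: localization_def)
qed

lemma frac_add:
  assumes "a \<in> A" "s \<in> S" "b \<in> A" "u \<in> S"
  shows "frac a s \<oplus>\<^bsub>T\<^esub> frac b u = frac (a * u + b * s) (s * u)"
proof -
  have "frac (a' * u' + b' * s') (s' * u') = frac (a * u + b * s) (s * u)"
    if m: "(a', s') \<in> frac a s" "(b', u') \<in> frac b u" for a' s' b' u'
  proof -
    note m1 = frac_memD[OF m(1) assms(1,2)] and m2 = frac_memD[OF m(2) assms(3,4)]
    obtain v v' where v: "v \<in> S" "v * (a' * s - a * s') = 0" "v' \<in> S" "v' * (b' * u - b * u') = 0"
      using m1 m2 assms frac_eq_iff by metis
    have "(v * v') * ((a' * u' + b' * s') * (s * u) - (a * u + b * s) * (s' * u')) =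
        v' * u * u' * (v * (a' * s - a * s')) + v * s * s' * (v' * (b' * u - b * u'))"
      by (simp add: algebra_simps)
    also have "\<dots> = 0" using v by simp
    finally have "\<exists>w\<in>S. w * ((a' * u' + b' * s') * (s * u) - (a * u + b * s) * (s' * u')) = 0"
      using v S_mult by blast
    then show ?thesis using m1 m2 assms
      by (subst frac_eq_iff) (auto intro!: A_closed(4,5) S_mult intro: S_A)
  qed
  then show ?thesis
    using UN_frac2[OF assms, of "\<lambda>a s b u. frac (a * u + b * s) (s * u)"] by (simp add: localization_def)
qed

lemma localization_one: "\<one>\<^bsub>T\<^esub> = frac 1 1" and localization_zero: "\<zero>\<^bsub>T\<^esub> = frac 0 1"
  by (simp_all add: localization_def)

lemma cring_localization: "cring T"
proof (rule cringI)
  note cl = A_closed S_A S_one S_mult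
  show "abelian_group T"
  proof (rule abelian_groupI)
    show "\<zero>\<^bsub>T\<^esub> \<in> carrier T" unfolding localization_zero by (intro frac_in_carrier cl)
    fix x assume "x \<in> carrier T"
    then obtain a s where x: "a \<in> A" "s \<in> S" "x = frac a s" by (rule frac_carrierE)
    show "\<zero>\<^bsub>T\<^esub> \<oplus>\<^bsub>T\<^esub> x = x"
      unfolding x localization_zero frac_add[OF A_closed(1) S_one x(1,2)] by simp
    have "frac (- a * s + a * s) (s * s) = frac 0 1" by (rule frac_eqI) (use x cl in auto)
    then have "frac (- a) s \<oplus>\<^bsub>T\<^esub> x = \<zero>\<^bsub>T\<^esub>"
      unfolding x localization_zero frac_add[OF A_closed(3)[OF x(1)] x(2) x(1,2)] .
    then show "\<exists>y\<in>carrier T. y \<oplus>\<^bsub>T\<^esub> x = \<zero>\<^bsub>T\<^esub>"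
      using frac_in_carrier[OF A_closed(3)[OF x(1)] x(2)] by blast
    fix y assume "y \<in> carrier T"
    then obtain b u where y: "b \<in> A" "u \<in> S" "y = frac b u" by (rule frac_carrierE)
    show "x \<oplus>\<^bsub>T\<^esub> y \<in> carrier T"
      unfolding x y frac_add[OF x(1,2) y(1,2)] by (intro frac_in_carrier cl x y)
    show "x \<oplus>\<^bsub>T\<^esub> y = y \<oplus>\<^bsub>T\<^esub> x"
      unfolding x y frac_add[OF x(1,2) y(1,2)] frac_add[OF y(1,2) x(1,2)] by (simp add: algebra_simps)
    fix z assume "z \<in> carrier T"
    then obtain c w where z: "c \<in> A" "w \<in> S" "z = frac c w" by (rule frac_carrierE)
    have su: "a * u + b * s \<in> A" "s * u \<in> S" "b * w + c * u \<in> A" "u * w \<in> S" by (intro cl x y z)+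
    show "(x \<oplus>\<^bsub>T\<^esub> y) \<oplus>\<^bsub>T\<^esub> z = x \<oplus>\<^bsub>T\<^esub> (y \<oplus>\<^bsub>T\<^esub> z)"
      unfolding x y z frac_add[OF x(1,2) y(1,2)] frac_add[OF y(1,2) z(1,2)]
        frac_add[OF su(1,2) z(1,2)] frac_add[OF x(1,2) su(3,4)] by (simp add: algebra_simps)
  qed
  show "comm_monoid T"
  proof (rule comm_monoidI)
    show "\<one>\<^bsub>T\<^esub> \<in> carrier T" unfolding localization_one by (intro frac_in_carrier cl)
    fix x assume "x \<in> carrier T"
    then obtain a s where x: "a \<in> A" "s \<in> S" "x = frac a s" by (rule frac_carrierE)
    show "\<one>\<^bsub>T\<^esub> \<otimes>\<^bsub>T\<^esub> x = x"
      unfolding x localization_one frac_mult[OF A_closed(2) S_one x(1,2)] by simp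
    fix y assume "y \<in> carrier T"
    then obtain b u where y: "b \<in> A" "u \<in> S" "y = frac b u" by (rule frac_carrierE)
    show "x \<otimes>\<^bsub>T\<^esub> y \<in> carrier T"
      unfolding x y frac_mult[OF x(1,2) y(1,2)] by (intro frac_in_carrier cl x y)
    show "x \<otimes>\<^bsub>T\<^esub> y = y \<otimes>\<^bsub>T\<^esub> x"
      unfolding x y frac_mult[OF x(1,2) y(1,2)] frac_mult[OF y(1,2) x(1,2)] by (simp add: mult.commute)
    fix z assume "z \<in> carrier T"
    then obtain c w where z: "c \<in> A" "w \<in> S" "z = frac c w" by (rule frac_carrierE)
    have su: "a * b \<in> A" "s * u \<in> S" "b * c \<in> A" "u * w \<in> S" by (intro cl x y z)+
    show "(x \<otimes>\<^bsub>T\<^esub> y) \<otimes>\<^bsub>T\<^esub> z = x \<otimes>\<^bsub>T\<^esub> (y \<otimes>\<^bsub>T\<^esub> z)"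
      unfolding x y z frac_mult[OF x(1,2) y(1,2)] frac_mult[OF y(1,2) z(1,2)]
        frac_mult[OF su(1,2) z(1,2)] frac_mult[OF x(1,2) su(3,4)] by (simp add: mult.assoc)
  qed
  fix x y z assume "x \<in> carrier T" "y \<in> carrier T" "z \<in> carrier T"
  then obtain a s b u c w where x: "a \<in> A" "s \<in> S" "x = frac a s" and y: "b \<in> A" "u \<in> S" "y = frac b u"
    and z: "c \<in> A" "w \<in> S" "z = frac c w" by (elim frac_carrierE)
  have su: "a * u + b * s \<in> A" "s * u \<in> S" "a * c \<in> A" "s * w \<in> S" "b * c \<in> A" "u * w \<in> S"
    by (intro cl x y z)+
  show "(x \<oplus>\<^bsub>T\<^esub> y) \<otimes>\<^bsub>T\<^esub> z = x \<otimes>\<^bsub>T\<^esub> z \<oplus>\<^bsub>T\<^esub> y \<otimes>\<^bsub>T\<^esub> z"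
    unfolding x y z frac_add[OF x(1,2) y(1,2)] frac_mult[OF x(1,2) z(1,2)] frac_mult[OF y(1,2) z(1,2)]
      frac_mult[OF su(1,2) z(1,2)] frac_add[OF su(3-6)]
  proof (rule frac_eqI)
    show "(a * u + b * s) * c \<in> A" "s * u * w \<in> S" "a * c * (u * w) + b * c * (s * w) \<in> A"
      "s * w * (u * w) \<in> S" by (intro cl x y z)+
  qed (simp add: algebra_simps)
qed

lemma fraction_hom_localization: "fraction_hom A S T (\<lambda>a. frac a 1)"
proof -
  interpret T: cring T by (rule cring_localization)
  note cl = A_closed S_A S_one S_mult
  show ?thesis
  proof
    fix x y assume x: "x \<in> A" "y \<in> A"
    show "frac (x + y) 1 = frac x 1 \<oplus>\<^bsub>T\<^esub> frac y 1"
      using frac_add[OF x(1) S_one x(2) S_one] by simp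
    show "frac (x * y) 1 = frac x 1 \<otimes>\<^bsub>T\<^esub> frac y 1"
      using frac_mult[OF x(1) S_one x(2) S_one] by simp
  next
    fix s assume s: "s \<in> S"
    have "frac s 1 \<otimes>\<^bsub>T\<^esub> frac 1 s = frac (s * 1) (1 * s)"
      by (intro frac_mult cl s)
    also have "\<dots> = \<one>\<^bsub>T\<^esub>" unfolding localization_one by (rule frac_eqI) (use s cl in auto)
    finally show "\<exists>w\<in>carrier T. frac s 1 \<otimes>\<^bsub>T\<^esub> w = \<one>\<^bsub>T\<^esub>"
      using frac_in_carrier[OF A_closed(2) s] by blast
  next
    fix q assume "q \<in> carrier T"
    then obtain a s where q: "a \<in> A" "s \<in> S" "q = frac a s" by (rule frac_carrierE)
    have "q \<otimes>\<^bsub>T\<^esub> frac s 1 = frac (a * s) (s * 1)" unfolding q by (intro frac_mult cl q)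
    also have "\<dots> = frac a 1" by (rule frac_eqI) (use q cl in auto)
    finally show "\<exists>x\<in>A. \<exists>s\<in>S. q \<otimes>\<^bsub>T\<^esub> frac s 1 = frac x 1" using q by blast
  qed (auto simp: localization_one intro: frac_in_carrier cl)
qed

lemma extended_ideal_eq:
  assumes G: "G \<subseteq> A"
  shows "genideal T ((\<lambda>a. frac a 1) ` idl A G) = fraction_hom.extension S T (\<lambda>a. frac a 1) (idl A G)"
proof -
  interpret fraction_hom A S T "\<lambda>a. frac a 1" by (rule fraction_hom_localization)
  let ?H = "(\<lambda>a. frac a 1) ` idl A G"
  have GA: "idl A G \<subseteq> A" by (rule idl_carrier[OF subring G])
  have "ideal (extension (idl A G)) T"
    by (rule ideal_extension) (auto intro: idl.zero idl_add idl_mult subring GA[THEN subsetD])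
  moreover have "?H \<subseteq> extension (idl A G)"
  proof clarify
    fix x assume x: "x \<in> idl A G"
    then have xA: "x \<in> A" using GA by blast
    have "frac x 1 \<otimes>\<^bsub>T\<^esub> frac 1 1 = frac x 1" using psi_closed[OF xA] psi_one by simp
    then show "frac x 1 \<in> extension (idl A G)"
      unfolding extension_def using x psi_closed[OF xA] S_one by blast
  qed
  ultimately have "genideal T ?H \<subseteq> extension (idl A G)" by (rule genideal_minimal)
  moreover have "extension (idl A G) \<subseteq> genideal T ?H"
  proof
    fix q assume "q \<in> extension (idl A G)"
    then obtain x s where x: "q \<in> carrier T" "x \<in> idl A G" "s \<in> S" "q \<otimes>\<^bsub>T\<^esub> frac s 1 = frac x 1"
      by (auto simp: extension_def)
    have H: "?H \<subseteq> carrier T" using GA psi_closed by blast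
    then have "frac x 1 \<in> genideal T ?H" using genideal_self[OF H] x by blast
    then show "q \<in> genideal T ?H" using psi_cancel[OF genideal_ideal[OF H] x(3,1)] x by simp
  qed
  ultimately show ?thesis by blast
qed

text \<open>The fraction map followed by the projection modulo \<open>I0\<close> is again a
  \<open>fraction_hom\<close>, and an element of its kernel has an \<open>S\<close>-multiple in the
  ideal of \<open>G\<close>.\<close>

lemma quotient_chain_iff:
  assumes G: "G \<subseteq> A"
  defines "I0 \<equiv> genideal T ((\<lambda>a. frac a 1) ` idl A G)"
  shows "(\<exists>I. (\<forall>i\<le>d. ideal (I i) (T Quot I0)) \<and> (\<forall>i<d. I i \<subset> I (Suc i))) \<longleftrightarrow>
    (\<exists>K. (\<forall>i\<le>d::nat. sat_ideal A S G (K i)) \<and> (\<forall>i<d. K i \<subset> K (Suc i)))"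
proof -
  interpret T: fraction_hom A S T "\<lambda>a. frac a 1" by (rule fraction_hom_localization)
  have GA: "idl A G \<subseteq> A" by (rule idl_carrier[OF subring G])
  have I0: "I0 = T.extension (idl A G)" unfolding I0_def by (rule extended_ideal_eq[OF G])
  have id: "ideal I0 T" unfolding I0
    by (rule T.ideal_extension) (auto intro: idl.zero idl_add idl_mult subring GA[THEN subsetD])
  interpret I0: ideal I0 T by (rule id)
  interpret Q: cring "T Quot I0" by (rule I0.quotient_is_cring[OF T.is_cring])
  have hom: "(+>\<^bsub>T\<^esub>) I0 \<in> ring_hom T (T Quot I0)" by (rule I0.rcos_ring_hom)
  let ?\<psi> = "\<lambda>a. I0 +>\<^bsub>T\<^esub> frac a 1"
  have zero: "?\<psi> x = \<zero>\<^bsub>T Quot I0\<^esub> \<longleftrightarrow> frac x 1 \<in> I0" if "x \<in> A" for x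
  proof -
    have "\<zero>\<^bsub>T Quot I0\<^esub> = I0" by (simp add: FactRing_def)
    then show ?thesis
      using I0.rcos_const_imp_mem[OF T.psi_closed[OF that]] T.a_rcos_zero[OF id, of "frac x 1"] by metis
  qed
  interpret Q: fraction_hom A S "T Quot I0" ?\<psi>
  proof
    fix x y assume x: "x \<in> A" "y \<in> A"
    show "?\<psi> x \<in> carrier (T Quot I0)" using ring_hom_closed[OF hom] T.psi_closed[OF x(1)] by blast
    show "?\<psi> (x + y) = ?\<psi> x \<oplus>\<^bsub>T Quot I0\<^esub> ?\<psi> y"
      unfolding T.psi_add[OF x] using ring_hom_add[OF hom] T.psi_closed x by blast
    show "?\<psi> (x * y) = ?\<psi> x \<otimes>\<^bsub>T Quot I0\<^esub> ?\<psi> y"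
      unfolding T.psi_mult[OF x] using ring_hom_mult[OF hom] T.psi_closed x by blast
  next
    show "?\<psi> 1 = \<one>\<^bsub>T Quot I0\<^esub>" unfolding T.psi_one by (rule ring_hom_one[OF hom])
  next
    fix s assume s: "s \<in> S"
    obtain w where w: "w \<in> carrier T" "frac s 1 \<otimes>\<^bsub>T\<^esub> w = \<one>\<^bsub>T\<^esub>" using T.psi_unit[OF s] by blast
    have "?\<psi> s \<otimes>\<^bsub>T Quot I0\<^esub> (I0 +>\<^bsub>T\<^esub> w) = I0 +>\<^bsub>T\<^esub> (frac s 1 \<otimes>\<^bsub>T\<^esub> w)"
      using ring_hom_mult[OF hom T.psi_closed[OF S_A[OF s]] w(1)] by simp
    also have "\<dots> = \<one>\<^bsub>T Quot I0\<^esub>" unfolding w(2) by (rule ring_hom_one[OF hom])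
    finally show "\<exists>w\<in>carrier (T Quot I0). ?\<psi> s \<otimes>\<^bsub>T Quot I0\<^esub> w = \<one>\<^bsub>T Quot I0\<^esub>"
      using ring_hom_closed[OF hom w(1)] by blast
  next
    fix q assume "q \<in> carrier (T Quot I0)"
    then obtain z where z: "z \<in> carrier T" "q = I0 +>\<^bsub>T\<^esub> z"
      by (auto simp: FactRing_def A_RCOSETS_def')
    obtain x s where x: "x \<in> A" "s \<in> S" "z \<otimes>\<^bsub>T\<^esub> frac s 1 = frac x 1" using T.psi_frac[OF z(1)] by blast
    have "q \<otimes>\<^bsub>T Quot I0\<^esub> ?\<psi> s = ?\<psi> x"
      using ring_hom_mult[OF hom z(1) T.psi_closed[OF S_A[OF x(2)]]] unfolding z(2) x(3) by simp
    then show "\<exists>x\<in>A. \<exists>s\<in>S. q \<otimes>\<^bsub>T Quot I0\<^esub> ?\<psi> s = ?\<psi> x" using x by blast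
  qed
  show ?thesis
  proof (rule Q.ideal_chain_iff[OF G])
    fix x assume x: "x \<in> G"
    then have "frac x 1 \<in> (\<lambda>a. frac a 1) ` idl A G" using idl_gen[OF subring] by blast
    moreover have "(\<lambda>a. frac a 1) ` idl A G \<subseteq> carrier T" using GA T.psi_closed by blast
    ultimately have "frac x 1 \<in> I0" unfolding I0_def using T.genideal_self by blast
    then show "?\<psi> x = \<zero>\<^bsub>T Quot I0\<^esub>" using zero x G by blast
  next
    fix x assume x: "x \<in> A" "?\<psi> x = \<zero>\<^bsub>T Quot I0\<^esub>"
    then have "frac x 1 \<in> T.extension (idl A G)" using zero unfolding I0 by blast
    then obtain y s where y: "y \<in> idl A G" "s \<in> S" "frac x 1 \<otimes>\<^bsub>T\<^esub> frac s 1 = frac y 1"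
      by (auto simp: T.extension_def)
    have yA: "y \<in> A" using y GA by blast
    have "frac (x * s) (1 * 1) = frac y 1"
      using y(3) frac_mult[OF x(1) S_one S_A[OF y(2)] S_one] by simp
    then have "frac (x * s) 1 = frac y 1" by simp
    then obtain v where v: "v \<in> S" "v * (x * s * 1 - y * 1) = 0"
      using frac_eq_iff[OF A_closed(5)[OF x(1) S_A[OF y(2)]] S_one yA S_one] by blast
    then have "(v * s) * x = v * y" by (simp add: algebra_simps)
    moreover have "v * y \<in> idl A G" by (rule idl_mult[OF subring y(1) S_A[OF v(1)]])
    ultimately have "(v * s) * x \<in> idl A G" by simp
    then show "\<exists>s\<in>S. s * x \<in> idl A G" using S_mult[OF v(1) y(2)] by blast
  qed
qed

end

lemma jet_ring_eq: "jet_ring n m = class_ring (mpolys (jet_vars n m))"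
  by (simp add: jet_ring_def class_ring_def mpolys_def)

theorem mainTheorem1:
  fixes k_ty :: "'k::field_char_0 itself"
    and n m r :: nat and t :: "nat \<Rightarrow> nat"
  assumes "alg_closed TYPE('k)"
    and "1 \<le> r" and "r \<le> n"
    and "\<forall>i \<in> {1..r}. t i \<le> m + 1"
    and "(\<Sum>i=1..r. t i) = m + 1"
  shows "multiplicity_along (jet_ring n m :: 'k mpoly ring) (jet_ideal n m r) (Pideal n m r t)
           = enat (fact (m + 1) div (\<Prod>i=1..r. fact (t i)))"
proof -
  interpret jet_setup n m r t using assms by unfold_locales
  let ?A = "mpolys (jet_vars n m) :: 'k mpoly set"
  let ?P = "idl ?A (low_gens r t)"
  let ?J = "{jet_gen r k | k. k \<le> m} :: 'k mpoly set"
  let ?N = "fact (m + 1) div (\<Prod>i=1..r. fact (t i)) :: nat"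
  interpret mult_subset ?A "?A - ?P" by (rule mult_subset_S)
  have "{var i j | i j. 1 \<le> i \<and> i \<le> r \<and> j < t i} = (low_gens r t :: 'k mpoly set)"
    by (auto simp: low_gens_def)
  then have P: "Pideal n m r t = ?P"
    unfolding Pideal_def jet_ring_eq using genideal_class_ring[OF subring low_gens_A] by simp
  have J: "jet_ideal n m r = idl ?A ?J"
    unfolding jet_ideal_def jet_ring_eq by (rule genideal_class_ring[OF subring J_in_A])
  have "multiplicity_along (jet_ring n m :: 'k mpoly ring) (jet_ideal n m r) (Pideal n m r t) =
      Sup {enat d | d. d \<le> ?N}"
    unfolding multiplicity_along_def ring_length_def ext_ideal_def loc_at_def P J jet_ring_eq class_ring_simps
      quotient_chain_iff[OF J_in_A] sat_chain_iff ..
  also have "\<dots> = enat ?N"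
    by (rule antisym) (auto intro!: Sup_least Sup_upper)
  finally show ?thesis .
qed

end
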